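(* Let $(X_1,Y_1),\dots,(X_n,Y_n)$ be independent data pairs distributed as $(X,Y)$, where $Y=a+\int_{\mathcal I}bX+\varepsilon$ as described in the context. Assume $\int_{\mathcal I}b^2<\infty$, $E\|X\|^4<\infty$ and $E(\varepsilon^2)<\infty$. Let $\theta_1\ge\theta_2\ge\cdots\ge0$ be the ordered eigenvalue sequence of $K$, and assume $0<\theta_1<|||K|||<1$. Then, for each $C>0$, as $n\to\infty$, $$\|\eta_j\|=O_p(|||K|||^j)\quad\text{uniformly in }1\le j\le Cn^{1/2},$$ and $$\widehat h_{jk}=h_{jk}+n^{-1/2}\int_{\mathcal I}\{\xi_{j+1}K^k(b)+K^{j+1}(b)\,\xi_k\}+O_p\bigl(n^{-1}\theta_1^j|||K|||^k+n^{-2}|||K|||^{j+k}\bigr)$$ uniformly in $1\le j\le k\le Cn^{1/2}$.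
   Context: $\mathcal I$ is a nondegenerate compact interval; $X$ is a random function on $\mathcal I$ with $\int_{\mathcal I}E(X^2)<\infty$; $a$ is a scalar, $b$ a function on $\mathcal I$, and $\varepsilon$ a scalar random variable with $E(\varepsilon\mid X)=0$. Put $\mu=E(X)$, $\bar X=n^{-1}\sum_iX_i$, $\bar Y=n^{-1}\sum_iY_i$. $\|x\|^2=\int_{\mathcal I}x^2$ for functions of one variable, and $|||L|||^2=\int_{\mathcal I}\int_{\mathcal I}L^2$ for functions of two variables. $K(s,t)=\operatorname{cov}\{X(s),X(t)\}$; $K$ also denotes the operator $K(\psi)(t)=\int_{\mathcal I}\psi(s)K(s,t)\,ds$; $K^j$ is its $j$-fold iterate, $K^0$ the identity. The spectral decomposition is $K(s,t)=\sum_k\theta_k\phi_k(s)\phi_k(t)$ with $(\phi_k)$ a complete orthonormal sequence. Estimators: $\widehat K(s,t)=n^{-1}\sum_{i=1}^n\{X_i(s)-\bar X(s)\}\{X_i(t)-\bar X(t)\}$; $\widehat K^1(b)=n^{-1}\sum_{i=1}^n(X_i-\bar X)(Y_i-\bar Y)$; $\widehat K^{j+1}(b)(t)=\int_{\mathcal I}\widehat K^j(b)(s)\,\widehat K(s,t)\,ds$ for $j\ge1$. Further, $$h_{jk}=\int_{\mathcal I}K^{j+1}(b)K^k(b),\qquad \widehat h_{jk}=\int_{\mathcal I}\widehat K^{j+1}(b)\,\widehat K^k(b).$$ With $(1-E)Z=Z-E(Z)$, let $\xi(s,t)=n^{-1/2}\sum_{i=1}^n(1-E)\{X_i(s)-\mu(s)\}\{X_i(t)-\mu(t)\}$,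 $\xi_0(t)=n^{-1/2}\sum_{i=1}^n(1-E)\{X_i(t)-\mu(t)\}\{Y_i-E(Y_i)\}$, $\zeta_j(t)=\int_{\mathcal I}K^j(b)(s)\,\xi(s,t)\,ds$, and for $j\ge1$ $$\xi_j=K^{j-1}(\xi_0)+\sum_{k=0}^{j-2}K^k(\zeta_{j-k-1})$$ (empty sums are zero). The remainder $\eta_j$ is defined by $\widehat K^j(b)=K^j(b)+n^{-1/2}\xi_j+n^{-1}\eta_j$. "$A_{n,\iota}=O_p(r_{n,\iota})$ uniformly in $\iota\in S_n$" means $\sup_{\iota\in S_n}|A_{n,\iota}|/r_{n,\iota}=O_p(1)$ as $n\to\infty$.
   Formalization: The formal theorem additionally assumes E(‖X‖²ε²)<∞; without it the claim fails at j=2 for heavy-tailed X whose error variance given X is unbounded. The condition holds automatically when ε is independent of X or E(ε²|X) is bounded. *)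

theory Defs
  imports "HOL-Probability.Probability"
begin

(* Functions on the interval I are real functions whose values outside I are irrelevant: all
   integrals are taken over lebesgue_on I.  A random function is a map 'w => real => real that
   is jointly measurable in the sample point and the argument. *)

definition fun_norm :: "real set \<Rightarrow> (real \<Rightarrow> real) \<Rightarrow> real" where
  "fun_norm I x = sqrt (LINT t|lebesgue_on I. (x t)\<^sup>2)"

definition ker_norm :: "real set \<Rightarrow> (real \<Rightarrow> real \<Rightarrow> real) \<Rightarrow> real" where
  "ker_norm I k = sqrt (LINT s|lebesgue_on I. LINT t|lebesgue_on I. (k s t)\<^sup>2)"

definition ker_op :: "real set \<Rightarrow> (real \<Rightarrow> real \<Rightarrow> real) \<Rightarrow> (real \<Rightarrow> real) \<Rightarrow> (real \<Rightarrow> real)" where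
  "ker_op I k \<psi> t = (LINT s|lebesgue_on I. \<psi> s * k s t)"

definition square_integrable_on :: "(real \<Rightarrow> real) \<Rightarrow> real set \<Rightarrow> bool" where
  "square_integrable_on f I \<longleftrightarrow>
     f \<in> borel_measurable (lebesgue_on I) \<and> integrable (lebesgue_on I) (\<lambda>t. (f t)\<^sup>2)"

definition random_function :: "'w measure \<Rightarrow> real set \<Rightarrow> ('w \<Rightarrow> real \<Rightarrow> real) \<Rightarrow> bool" where
  "random_function M I X \<longleftrightarrow> (\<lambda>(\<omega>, t). X \<omega> t) \<in> borel_measurable (M \<Otimes>\<^sub>M lebesgue_on I)"

(* X viewed as a random element of the product space of its coordinates X(t), t in I *)

definition sample_path :: "real set \<Rightarrow> ('w \<Rightarrow> real \<Rightarrow> real) \<Rightarrow> 'w \<Rightarrow> (real \<Rightarrow> real)" where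
  "sample_path I X \<omega> = restrict (X \<omega>) I"

abbreviation path_space :: "real set \<Rightarrow> (real \<Rightarrow> real) measure" where
  "path_space I \<equiv> Pi\<^sub>M I (\<lambda>_. borel)"

definition sigma_gen_path :: "'w measure \<Rightarrow> real set \<Rightarrow> ('w \<Rightarrow> real \<Rightarrow> real) \<Rightarrow> 'w measure" where
  "sigma_gen_path M I X = vimage_algebra (space M) (sample_path I X) (path_space I)"

definition mean_fun :: "'w measure \<Rightarrow> ('w \<Rightarrow> real \<Rightarrow> real) \<Rightarrow> real \<Rightarrow> real" where
  "mean_fun M X t = (LINT \<omega>|M. X \<omega> t)"

definition cov_fun :: "'w measure \<Rightarrow> ('w \<Rightarrow> real \<Rightarrow> real) \<Rightarrow> real \<Rightarrow> real \<Rightarrow> real" where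
  "cov_fun M X s t = (LINT \<omega>|M. (X \<omega> s - mean_fun M X s) * (X \<omega> t - mean_fun M X t))"

(* Indices run over k >= 1; theta 0 and phi 0 are not used.  The expansion of the kernel is
   understood in mean square on I x I. *)

definition complete_orthonormal :: "real set \<Rightarrow> (nat \<Rightarrow> real \<Rightarrow> real) \<Rightarrow> bool" where
  "complete_orthonormal I \<phi> \<longleftrightarrow>
     (\<forall>k\<ge>1. square_integrable_on (\<phi> k) I) \<and>
     (\<forall>j\<ge>1. \<forall>k\<ge>1. (LINT t|lebesgue_on I. \<phi> j t * \<phi> k t) = (if j = k then 1 else 0)) \<and>
     (\<forall>f. square_integrable_on f I \<longrightarrow> (\<forall>k\<ge>1. (LINT t|lebesgue_on I. f t * \<phi> k t) = 0) \<longrightarrow>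
        (AE t in lebesgue_on I. f t = 0))"

definition spectral_decomposition ::
    "real set \<Rightarrow> (real \<Rightarrow> real \<Rightarrow> real) \<Rightarrow> (nat \<Rightarrow> real) \<Rightarrow> (nat \<Rightarrow> real \<Rightarrow> real) \<Rightarrow> bool" where
  "spectral_decomposition I k \<theta> \<phi> \<longleftrightarrow>
     complete_orthonormal I \<phi> \<and>
     (\<forall>i\<ge>1. AE t in lebesgue_on I. ker_op I k (\<phi> i) t = \<theta> i * \<phi> i t) \<and>
     (\<lambda>N. ker_norm I (\<lambda>s t. k s t - (\<Sum>i=1..N. \<theta> i * \<phi> i s * \<phi> i t))) \<longlonglongrightarrow> 0"

(* The sample of size n consists of the pairs with indices 1..n. *)

definition fun_avg :: "(nat \<Rightarrow> 'w \<Rightarrow> real \<Rightarrow> real) \<Rightarrow> nat \<Rightarrow> 'w \<Rightarrow> real \<Rightarrow> real" where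
  "fun_avg Xs n \<omega> t = (\<Sum>i=1..n. Xs i \<omega> t) / real n"

definition avg :: "(nat \<Rightarrow> 'w \<Rightarrow> real) \<Rightarrow> nat \<Rightarrow> 'w \<Rightarrow> real" where
  "avg Ys n \<omega> = (\<Sum>i=1..n. Ys i \<omega>) / real n"

definition Khat :: "(nat \<Rightarrow> 'w \<Rightarrow> real \<Rightarrow> real) \<Rightarrow> nat \<Rightarrow> 'w \<Rightarrow> real \<Rightarrow> real \<Rightarrow> real" where
  "Khat Xs n \<omega> s t =
     (\<Sum>i=1..n. (Xs i \<omega> s - fun_avg Xs n \<omega> s) * (Xs i \<omega> t - fun_avg Xs n \<omega> t)) / real n"

definition Khat1 ::
    "(nat \<Rightarrow> 'w \<Rightarrow> real \<Rightarrow> real) \<Rightarrow> (nat \<Rightarrow> 'w \<Rightarrow> real) \<Rightarrow> nat \<Rightarrow> 'w \<Rightarrow> real \<Rightarrow> real" where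
  "Khat1 Xs Ys n \<omega> t =
     (\<Sum>i=1..n. (Xs i \<omega> t - fun_avg Xs n \<omega> t) * (Ys i \<omega> - avg Ys n \<omega>)) / real n"

(* Meaningful for j >= 1 only: the estimator of K(b) is Khat1, which involves the Y_i, and not
   the operator Khat applied to b. *)

definition Khat_iter :: "real set \<Rightarrow> (nat \<Rightarrow> 'w \<Rightarrow> real \<Rightarrow> real) \<Rightarrow> (nat \<Rightarrow> 'w \<Rightarrow> real) \<Rightarrow>
    nat \<Rightarrow> nat \<Rightarrow> 'w \<Rightarrow> real \<Rightarrow> real" where
  "Khat_iter I Xs Ys j n \<omega> = (ker_op I (Khat Xs n \<omega>) ^^ (j - 1)) (Khat1 Xs Ys n \<omega>)"

definition K_iter :: "real set \<Rightarrow> (real \<Rightarrow> real \<Rightarrow> real) \<Rightarrow> nat \<Rightarrow> (real \<Rightarrow> real) \<Rightarrow> real \<Rightarrow> real" where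
  "K_iter I K j = ker_op I K ^^ j"

definition h_coef :: "real set \<Rightarrow> (real \<Rightarrow> real \<Rightarrow> real) \<Rightarrow> (real \<Rightarrow> real) \<Rightarrow> nat \<Rightarrow> nat \<Rightarrow> real" where
  "h_coef I K b j k = (LINT t|lebesgue_on I. K_iter I K (j + 1) b t * K_iter I K k b t)"

definition hhat_coef :: "real set \<Rightarrow> (nat \<Rightarrow> 'w \<Rightarrow> real \<Rightarrow> real) \<Rightarrow> (nat \<Rightarrow> 'w \<Rightarrow> real) \<Rightarrow>
    nat \<Rightarrow> nat \<Rightarrow> nat \<Rightarrow> 'w \<Rightarrow> real" where
  "hhat_coef I Xs Ys j k n \<omega> =
     (LINT t|lebesgue_on I. Khat_iter I Xs Ys (j + 1) n \<omega> t * Khat_iter I Xs Ys k n \<omega> t)"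

definition centred :: "'w measure \<Rightarrow> ('w \<Rightarrow> real) \<Rightarrow> 'w \<Rightarrow> real" where
  "centred M Z \<omega> = Z \<omega> - (LINT \<omega>'|M. Z \<omega>')"

definition xi :: "'w measure \<Rightarrow> (real \<Rightarrow> real) \<Rightarrow> (nat \<Rightarrow> 'w \<Rightarrow> real \<Rightarrow> real) \<Rightarrow>
    nat \<Rightarrow> 'w \<Rightarrow> real \<Rightarrow> real \<Rightarrow> real" where
  "xi M \<mu> Xs n \<omega> s t =
     (\<Sum>i=1..n. centred M (\<lambda>\<omega>'. (Xs i \<omega>' s - \<mu> s) * (Xs i \<omega>' t - \<mu> t)) \<omega>) / sqrt (real n)"

(* Pitfall: xi0 is bounded in probability if ||X|| eps has a finite second moment, but
   E||X||^4 < infinity, E eps^2 < infinity and E(eps | X) = 0 alone do not give this when the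
   conditional variance of eps given X is unbounded. *)

definition xi0 :: "'w measure \<Rightarrow> (real \<Rightarrow> real) \<Rightarrow> (nat \<Rightarrow> 'w \<Rightarrow> real \<Rightarrow> real) \<Rightarrow> (nat \<Rightarrow> 'w \<Rightarrow> real) \<Rightarrow>
    nat \<Rightarrow> 'w \<Rightarrow> real \<Rightarrow> real" where
  "xi0 M \<mu> Xs Ys n \<omega> t =
     (\<Sum>i=1..n. centred M (\<lambda>\<omega>'. (Xs i \<omega>' t - \<mu> t) * (Ys i \<omega>' - (LINT \<omega>''|M. Ys i \<omega>''))) \<omega>)
       / sqrt (real n)"

definition zeta :: "real set \<Rightarrow> 'w measure \<Rightarrow> (real \<Rightarrow> real \<Rightarrow> real) \<Rightarrow> (real \<Rightarrow> real) \<Rightarrow> (real \<Rightarrow> real) \<Rightarrow>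
    (nat \<Rightarrow> 'w \<Rightarrow> real \<Rightarrow> real) \<Rightarrow> nat \<Rightarrow> nat \<Rightarrow> 'w \<Rightarrow> real \<Rightarrow> real" where
  "zeta I M K \<mu> b Xs j n \<omega> t = (LINT s|lebesgue_on I. K_iter I K j b s * xi M \<mu> Xs n \<omega> s t)"

(* For j >= 1, as for Khat_iter.  The range k < j - 1 is the set 0..j-2, also when j = 1, where
   truncated subtraction would make the set {0..j-2} nonempty. *)

definition xij :: "real set \<Rightarrow> 'w measure \<Rightarrow> (real \<Rightarrow> real \<Rightarrow> real) \<Rightarrow> (real \<Rightarrow> real) \<Rightarrow> (real \<Rightarrow> real) \<Rightarrow>
    (nat \<Rightarrow> 'w \<Rightarrow> real \<Rightarrow> real) \<Rightarrow> (nat \<Rightarrow> 'w \<Rightarrow> real) \<Rightarrow> nat \<Rightarrow> nat \<Rightarrow> 'w \<Rightarrow> real \<Rightarrow> real" where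
  "xij I M K \<mu> b Xs Ys j n \<omega> t =
     K_iter I K (j - 1) (xi0 M \<mu> Xs Ys n \<omega>) t +
     (\<Sum>k<j - 1. K_iter I K k (zeta I M K \<mu> b Xs (j - k - 1) n \<omega>) t)"

(* Khat_iter = K_iter + n^(-1/2) xij + n^(-1) eta, solved for eta *)

definition eta :: "real set \<Rightarrow> 'w measure \<Rightarrow> (real \<Rightarrow> real \<Rightarrow> real) \<Rightarrow> (real \<Rightarrow> real) \<Rightarrow> (real \<Rightarrow> real) \<Rightarrow>
    (nat \<Rightarrow> 'w \<Rightarrow> real \<Rightarrow> real) \<Rightarrow> (nat \<Rightarrow> 'w \<Rightarrow> real) \<Rightarrow> nat \<Rightarrow> nat \<Rightarrow> 'w \<Rightarrow> real \<Rightarrow> real" where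
  "eta I M K \<mu> b Xs Ys j n \<omega> t =
     real n * (Khat_iter I Xs Ys j n \<omega> t - K_iter I K j b t
               - xij I M K \<mu> b Xs Ys j n \<omega> t / sqrt (real n))"

(* O_p(1).  The explicit membership in sets M matters because measure M is 0 on nonmeasurable
   sets. *)

definition bounded_in_prob :: "'w measure \<Rightarrow> (nat \<Rightarrow> 'w \<Rightarrow> ennreal) \<Rightarrow> bool" where
  "bounded_in_prob M Z \<longleftrightarrow>
     (\<forall>e>0. \<exists>B::real. \<forall>\<^sub>F n in sequentially.
        {\<omega> \<in> space M. Z n \<omega> > ennreal B} \<in> sets M \<and>
        measure M {\<omega> \<in> space M. Z n \<omega> > ennreal B} \<le> e)"

(* The supremum is taken in ennreal, so that it is 0 over an empty index set. *)

definition Op_uniformly :: "'w measure \<Rightarrow> (nat \<Rightarrow> 'i set) \<Rightarrow> (nat \<Rightarrow> 'i \<Rightarrow> 'w \<Rightarrow> real) \<Rightarrow>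
    (nat \<Rightarrow> 'i \<Rightarrow> real) \<Rightarrow> bool" where
  "Op_uniformly M S A r \<longleftrightarrow>
     bounded_in_prob M (\<lambda>n \<omega>. SUP i\<in>S n. ennreal \<bar>A n i \<omega>\<bar> / ennreal (r n i))"

end

theory Submission
  imports Defs
begin

text \<open>
  Write \<open>m = n\<^sup>1\<^sup>/\<^sup>2 (Xbar - \<mu>)\<close> and \<open>y = n\<^sup>1\<^sup>/\<^sup>2 (Ybar - E Y)\<close>. Recentring the sample moments gives the exact
  identities \<open>Khat = K + n\<^sup>-\<^sup>1\<^sup>/\<^sup>2 \<xi> - n\<^sup>-\<^sup>1 m \<otimes> m\<close> and \<open>Khat\<^sup>1(b) = K(b) + n\<^sup>-\<^sup>1\<^sup>/\<^sup>2 \<xi>\<^sub>0 - n\<^sup>-\<^sup>1 y m\<close>, whence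
  \<open>\<xi>\<^sub>j\<^sub>+\<^sub>1 = K(\<xi>\<^sub>j) + \<xi>(K\<^sup>j b)\<close> and
  \<open>\<eta>\<^sub>j\<^sub>+\<^sub>1 = Khat(\<eta>\<^sub>j) + \<xi>(\<xi>\<^sub>j) - (m \<otimes> m)(K\<^sup>j b) - n\<^sup>-\<^sup>1\<^sup>/\<^sup>2 (m \<otimes> m)(\<xi>\<^sub>j)\<close>.
  The operator norm of \<open>K\<close> is at most \<open>\<theta>\<^sub>1\<close> (Bessel for the partial sums of the spectral expansion), so
  as long as \<open>\<xi>\<close>, \<open>\<xi>\<^sub>0\<close>, \<open>m\<close>, \<open>y\<close> are bounded by a constant, the recursions give \<open>\<parallel>\<xi>\<^sub>j\<parallel> = O(j \<theta>\<^sub>1\<^sup>j)\<close> and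
  \<open>\<parallel>\<eta>\<^sub>j\<parallel> = O(j\<^sup>2 (\<theta>\<^sub>1 + D n\<^sup>-\<^sup>1\<^sup>/\<^sup>2)\<^sup>j)\<close> for a constant \<open>D\<close>. For \<open>j \<le> C n\<^sup>1\<^sup>/\<^sup>2\<close> the perturbation of the base only costs a
  constant factor, and the polynomial factor is absorbed by passing from \<open>\<theta>\<^sub>1\<close> to \<open>|||K||| > \<theta>\<^sub>1\<close>. Finally the
  second moments of \<open>\<xi>\<close>, \<open>\<xi>\<^sub>0\<close>, \<open>m\<close>, \<open>y\<close> are bounded in \<open>n\<close>, so Markov's inequality bounds them uniformly
  outside an event of small probability.
\<close>

section \<open>Square-integrable functions over an arbitrary measure, used alike for paths, kernels
  and random variables\<close>

definition sqint :: "'a measure \<Rightarrow> ('a \<Rightarrow> real) \<Rightarrow> bool" where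
  "sqint L f \<longleftrightarrow> f \<in> borel_measurable L \<and> integrable L (\<lambda>t. (f t)\<^sup>2)"

definition l2norm :: "'a measure \<Rightarrow> ('a \<Rightarrow> real) \<Rightarrow> real" where
  "l2norm L f = sqrt (LINT t|L. (f t)\<^sup>2)"

lemma sqint_measurable[measurable_dest]: "sqint L f \<Longrightarrow> f \<in> borel_measurable L"
  by (simp add: sqint_def)

lemma sqint_integrable_square: "sqint L f \<Longrightarrow> integrable L (\<lambda>t. (f t)\<^sup>2)"
  by (simp add: sqint_def)

lemma l2norm_nonneg[simp]: "0 \<le> l2norm L f"
  by (simp add: l2norm_def)

lemma l2norm_square: "(l2norm L f)\<^sup>2 = (LINT t|L. (f t)\<^sup>2)"
  by (simp add: l2norm_def)

lemma sqint_integrable_mult: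
  assumes "sqint L f" "sqint L g"
  shows "integrable L (\<lambda>t. f t * g t)"
proof (rule Bochner_Integration.integrable_bound)
  show "integrable L (\<lambda>t. (f t)\<^sup>2 + (g t)\<^sup>2)"
    using assms by (auto simp: sqint_def)
  show "(\<lambda>t. f t * g t) \<in> borel_measurable L"
    using assms by (auto simp: sqint_def)
  show "AE t in L. norm (f t * g t) \<le> norm ((f t)\<^sup>2 + (g t)\<^sup>2)"
  proof (rule AE_I2)
    fix t
    have "2 * \<bar>f t * g t\<bar> \<le> (f t)\<^sup>2 + (g t)\<^sup>2"
      using sum_squares_bound[of "\<bar>f t\<bar>" "\<bar>g t\<bar>"] by (simp add: abs_mult)
    then show "norm (f t * g t) \<le> norm ((f t)\<^sup>2 + (g t)\<^sup>2)"
      by simp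
  qed
qed

lemma sqint_add:
  assumes "sqint L f" "sqint L g"
  shows "sqint L (\<lambda>t. f t + g t)"
  using assms sqint_integrable_mult[OF assms]
  by (auto simp: sqint_def power2_sum mult.assoc)

lemma sqint_scale:
  assumes "sqint L f"
  shows "sqint L (\<lambda>t. a * f t)"
  using assms by (auto simp: sqint_def power_mult_distrib)

lemma sqint_diff:
  assumes "sqint L f" "sqint L g"
  shows "sqint L (\<lambda>t. f t - g t)"
  using sqint_add[OF assms(1) sqint_scale[OF assms(2), of "-1"]] by simp

lemma sqint_divide: "sqint L f \<Longrightarrow> sqint L (\<lambda>t. f t / a)"
  using sqint_scale[of L f "inverse a"] by (simp add: field_simps)

lemma sqint_zero: "sqint L (\<lambda>t. 0)"
  by (simp add: sqint_def)

lemma sqint_sum: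
  assumes "\<And>i. i \<in> A \<Longrightarrow> sqint L (f i)"
  shows "sqint L (\<lambda>t. \<Sum>i\<in>A. f i t)"
  using assms by (induction A rule: infinite_finite_induct) (auto simp: sqint_zero sqint_add)

lemma l2norm_scale: "l2norm L (\<lambda>t. a * f t) = \<bar>a\<bar> * l2norm L f"
  by (simp add: l2norm_def power_mult_distrib real_sqrt_mult)

lemma l2norm_divide: "l2norm L (\<lambda>t. f t / a) = l2norm L f / \<bar>a\<bar>"
  using l2norm_scale[of L "inverse a" f] by (simp add: field_simps)

lemma l2norm_cong_AE:
  assumes "f \<in> borel_measurable L" "g \<in> borel_measurable L" "AE t in L. f t = g t"
  shows "l2norm L f = l2norm L g"
  unfolding l2norm_def using assms by (intro arg_cong[where f = sqrt] integral_cong_AE) auto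

text \<open>The discriminant of \<open>x \<mapsto> \<integral>(f + x g)\<^sup>2\<close> is nonpositive.\<close>

lemma l2_Cauchy_Schwarz:
  assumes f: "sqint L f" and g: "sqint L g"
  shows "\<bar>LINT t|L. f t * g t\<bar> \<le> l2norm L f * l2norm L g"
proof -
  define A B C where "A = (l2norm L f)\<^sup>2" and "B = (LINT t|L. f t * g t)" and "C = (l2norm L g)\<^sup>2"
  have nn: "0 \<le> A + 2 * x * B + x\<^sup>2 * C" for x
  proof -
    have "0 \<le> (LINT t|L. (f t + x * g t)\<^sup>2)" by simp
    also have "\<dots> = (LINT t|L. ((f t)\<^sup>2 + (2 * x) * (f t * g t) + x\<^sup>2 * (g t)\<^sup>2))"
      by (intro Bochner_Integration.integral_cong) (auto simp: power2_eq_square algebra_simps)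
    also have "\<dots> = A + 2 * x * B + x\<^sup>2 * C"
      using sqint_integrable_mult[OF f g] sqint_integrable_square[OF f] sqint_integrable_square[OF g]
      by (simp add: A_def B_def C_def l2norm_square)
    finally show ?thesis .
  qed
  have "B\<^sup>2 \<le> A * C"
  proof (cases "C = 0")
    case True
    have "B = 0"
    proof (rule ccontr)
      assume "B \<noteq> 0"
      \<comment> \<open>For \<open>C = 0\<close> the quadratic is affine in \<open>x\<close>, and
        this \<open>x\<close> gives it the value -1.\<close>
      with nn[of "- (A + 1) / (2 * B)"] True show False by (simp add: field_simps)
    qed
    then show ?thesis using True by simp
  next
    case False
    then have "C > 0" by (auto simp: C_def zero_less_power2)
    have "A + 2 * (- B / C) * B + (- B / C)\<^sup>2 * C = A - B\<^sup>2 / C"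
      using False by (simp add: field_simps power2_eq_square)
    with nn[of "- B / C"] have "B\<^sup>2 / C \<le> A" by simp
    then show ?thesis using \<open>C > 0\<close> by (simp add: field_simps)
  qed
  then have "B\<^sup>2 \<le> (l2norm L f * l2norm L g)\<^sup>2" by (simp add: A_def C_def power_mult_distrib)
  then have "\<bar>B\<bar> \<le> l2norm L f * l2norm L g"
    by (simp add: power2_le_iff_abs_le)
  then show ?thesis by (simp add: B_def)
qed

lemma l2norm_triangle:
  assumes f: "sqint L f" and g: "sqint L g"
  shows "l2norm L (\<lambda>t. f t + g t) \<le> l2norm L f + l2norm L g"
proof (rule power2_le_imp_le)
  have "(l2norm L (\<lambda>t. f t + g t))\<^sup>2 = (LINT t|L. ((f t)\<^sup>2 + 2 * (f t * g t) + (g t)\<^sup>2))"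
    unfolding l2norm_square
    by (intro Bochner_Integration.integral_cong) (auto simp: power2_eq_square algebra_simps)
  also have "\<dots> = (l2norm L f)\<^sup>2 + 2 * (LINT t|L. f t * g t) + (l2norm L g)\<^sup>2"
    using sqint_integrable_mult[OF f g] sqint_integrable_square[OF f] sqint_integrable_square[OF g]
    by (simp add: l2norm_square)
  also have "\<dots> \<le> (l2norm L f + l2norm L g)\<^sup>2"
    using l2_Cauchy_Schwarz[OF f g] by (simp add: power2_sum)
  finally show "(l2norm L (\<lambda>t. f t + g t))\<^sup>2 \<le> (l2norm L f + l2norm L g)\<^sup>2" .
qed simp

lemma l2norm_triangle_diff:
  assumes f: "sqint L f" and g: "sqint L g"
  shows "l2norm L (\<lambda>t. f t - g t) \<le> l2norm L f + l2norm L g"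
  using l2norm_triangle[OF f sqint_scale[OF g, of "-1"]] l2norm_scale[of L "-1" g] by simp

lemma sqint_iff_nn_integral:
  assumes "f \<in> borel_measurable L"
  shows "sqint L f \<longleftrightarrow> (\<integral>\<^sup>+t. ennreal ((f t)\<^sup>2) \<partial>L) < \<infinity>"
  using assms by (auto simp: sqint_def integrable_iff_bounded)

lemma nn_integral_square_eq:
  assumes "sqint L f"
  shows "(\<integral>\<^sup>+t. ennreal ((f t)\<^sup>2) \<partial>L) = ennreal ((l2norm L f)\<^sup>2)"
  unfolding l2norm_square using assms by (intro nn_integral_eq_integral) (auto simp: sqint_def)

text \<open>Orthonormality removes the cross terms in the norm of a finite combination. For the
  inequality, \<open>f\<close> is paired with its projection \<open>S\<close>: the inner product and
  the squared norm of \<open>S\<close> are both \<open>N\<close>, so Cauchy-Schwarz bounds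
  \<open>N\<close> by the product of the norms of \<open>f\<close> and \<open>S\<close>.\<close>

lemma l2_Bessel:
  assumes f: "sqint L f" and p: "\<And>i. i \<in> A \<Longrightarrow> sqint L (p i)" and fin: "finite A"
    and on: "\<And>i j. i \<in> A \<Longrightarrow> j \<in> A \<Longrightarrow> (LINT t|L. p i t * p j t) = (if i = j then 1 else 0)"
  shows "(l2norm L (\<lambda>t. \<Sum>i\<in>A. a i * p i t))\<^sup>2 = (\<Sum>i\<in>A. (a i)\<^sup>2)"
    and "(\<Sum>i\<in>A. (LINT t|L. f t * p i t)\<^sup>2) \<le> (l2norm L f)\<^sup>2"
proof -
  have norm: "(l2norm L (\<lambda>t. \<Sum>i\<in>A. a i * p i t))\<^sup>2 = (\<Sum>i\<in>A. (a i)\<^sup>2)" for a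
  proof -
    have "(l2norm L (\<lambda>t. \<Sum>i\<in>A. a i * p i t))\<^sup>2 = (LINT t|L. (\<Sum>i\<in>A. \<Sum>j\<in>A. a i * a j * (p i t * p j t)))"
      unfolding l2norm_square
      unfolding power2_eq_square sum_product
      by (intro Bochner_Integration.integral_cong sum.cong refl) (simp add: mult_ac)
    also have "\<dots> = (\<Sum>i\<in>A. \<Sum>j\<in>A. a i * a j * (LINT t|L. p i t * p j t))"
      using sqint_integrable_mult[OF p p]
      by (simp add: Bochner_Integration.integral_sum)
    also have "\<dots> = (\<Sum>i\<in>A. \<Sum>j\<in>A. if i = j then (a i)\<^sup>2 else 0)"
      by (intro sum.cong refl) (auto simp: on power2_eq_square)
    also have "\<dots> = (\<Sum>i\<in>A. (a i)\<^sup>2)" using fin by (simp add: sum.delta)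
    finally show ?thesis .
  qed
  show "(l2norm L (\<lambda>t. \<Sum>i\<in>A. a i * p i t))\<^sup>2 = (\<Sum>i\<in>A. (a i)\<^sup>2)" by (rule norm)
  define c where "c i = (LINT t|L. f t * p i t)" for i
  define S where "S t = (\<Sum>i\<in>A. c i * p i t)" for t
  define N where "N = (\<Sum>i\<in>A. (c i)\<^sup>2)"
  have S: "sqint L S" unfolding S_def by (intro sqint_sum sqint_scale p)
  have "(LINT t|L. f t * S t) = (LINT t|L. (\<Sum>i\<in>A. c i * (f t * p i t)))"
    unfolding S_def sum_distrib_left
    by (intro Bochner_Integration.integral_cong sum.cong refl) (simp add: mult_ac)
  also have "\<dots> = N"
    using sqint_integrable_mult[OF f p]
    by (simp add: Bochner_Integration.integral_sum N_def c_def power2_eq_square)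
  finally have "N \<le> l2norm L f * l2norm L S" using l2_Cauchy_Schwarz[OF f S] by simp
  moreover have "(l2norm L S)\<^sup>2 = N" unfolding S_def N_def by (rule norm)
  ultimately have "l2norm L S * l2norm L S \<le> l2norm L f * l2norm L S" by (simp add: power2_eq_square)
  \<comment> \<open>One factor \<open>l2norm L S\<close> is cancelled; if it is zero, the claim is
    nonnegativity of the norm of \<open>f\<close>.\<close>
  then have "l2norm L S \<le> l2norm L f"
    by (metis l2norm_nonneg mult_right_le_imp_le order_le_less)
  then have "(l2norm L S)\<^sup>2 \<le> (l2norm L f)\<^sup>2" by (simp add: power_mono)
  then show "(\<Sum>i\<in>A. (LINT t|L. f t * p i t)\<^sup>2) \<le> (l2norm L f)\<^sup>2"
    using \<open>(l2norm L S)\<^sup>2 = N\<close> by (simp add: N_def c_def)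
qed

lemma fun_norm_eq: "fun_norm I = l2norm (lebesgue_on I)"
  by (simp add: fun_norm_def l2norm_def fun_eq_iff)

lemma square_integrable_on_eq: "square_integrable_on f I = sqint (lebesgue_on I) f"
  by (simp add: square_integrable_on_def sqint_def)

section \<open>Square-integrable kernels and their integral operators\<close>

locale lmeasurable_domain =
  fixes I :: "real set"
  assumes lmeasurable: "I \<in> lmeasurable"
begin

abbreviation L :: "real measure" where "L \<equiv> lebesgue_on I"

sublocale finite_measure L
  by (rule finite_measure_lebesgue_on[OF lmeasurable])

sublocale LL: pair_sigma_finite L L ..

text \<open>Square integrability is required jointly, on the product measure, whereas
  \<open>ker_norm\<close> is an iterated integral; Fubini identifies the two in
  \<open>ker_norm_eq\<close>.\<close>

definition sqker :: "(real \<Rightarrow> real \<Rightarrow> real) \<Rightarrow> bool" where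
  "sqker k \<longleftrightarrow> sqint (L \<Otimes>\<^sub>M L) (\<lambda>(s, t). k s t)"

lemma sqker_measurable: "sqker k \<Longrightarrow> (\<lambda>(s, t). k s t) \<in> borel_measurable (L \<Otimes>\<^sub>M L)"
  by (simp add: sqker_def sqint_def)

lemma kernel_section_measurable:
  assumes "(\<lambda>(s, t). k s t) \<in> borel_measurable (L \<Otimes>\<^sub>M L)" "t \<in> space L"
  shows "(\<lambda>s. k s t) \<in> borel_measurable L"
  using measurable_compose[OF measurable_Pair2'[OF assms(2)] assms(1)] by simp

lemma sqker_integrable_square: "sqker k \<Longrightarrow> integrable (L \<Otimes>\<^sub>M L) (\<lambda>(s, t). (k s t)\<^sup>2)"
  by (simp add: sqker_def sqint_def split_beta')

lemma ker_norm_eq: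
  assumes "sqker k"
  shows "ker_norm I k = l2norm (L \<Otimes>\<^sub>M L) (\<lambda>(s, t). k s t)"
  unfolding ker_norm_def l2norm_def
  using LL.integral_fst[OF sqker_integrable_square[OF assms]] by (simp add: split_beta')

lemma ker_norm_nonneg[simp]: "0 \<le> ker_norm I k"
  by (simp add: ker_norm_def)

lemma sqker_add: "sqker k \<Longrightarrow> sqker l \<Longrightarrow> sqker (\<lambda>s t. k s t + l s t)"
  unfolding sqker_def using sqint_add by (fastforce simp: split_beta')

lemma sqker_diff: "sqker k \<Longrightarrow> sqker l \<Longrightarrow> sqker (\<lambda>s t. k s t - l s t)"
  unfolding sqker_def using sqint_diff by (fastforce simp: split_beta')

lemma sqker_divide: "sqker k \<Longrightarrow> sqker (\<lambda>s t. k s t / a)"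
  unfolding sqker_def using sqint_divide by (fastforce simp: split_beta')

lemma sqker_sum: "(\<And>i. i \<in> A \<Longrightarrow> sqker (k i)) \<Longrightarrow> sqker (\<lambda>s t. \<Sum>i\<in>A. k i s t)"
  unfolding sqker_def using sqint_sum[of A "L \<Otimes>\<^sub>M L" "\<lambda>i (s, t). k i s t"] by (simp add: split_beta')

lemma sqker_tensor:
  assumes f: "sqint L f" and g: "sqint L g"
  shows "sqker (\<lambda>s t. f s * g t)" and "ker_norm I (\<lambda>s t. f s * g t) = l2norm L f * l2norm L g"
proof -
  note [measurable] = sqint_measurable[OF f] sqint_measurable[OF g]
  have "(\<integral>\<^sup>+p. ennreal ((case p of (s, t) \<Rightarrow> f s * g t)\<^sup>2) \<partial>(L \<Otimes>\<^sub>M L))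
      = (\<integral>\<^sup>+s. \<integral>\<^sup>+t. ennreal ((f s)\<^sup>2) * ennreal ((g t)\<^sup>2) \<partial>L \<partial>L)"
    by (subst nn_integral_fst[symmetric]) (auto simp: power_mult_distrib ennreal_mult')
  also have "\<dots> = ennreal ((l2norm L f)\<^sup>2) * ennreal ((l2norm L g)\<^sup>2)"
    by (simp add: nn_integral_cmult nn_integral_multc nn_integral_square_eq[OF f] nn_integral_square_eq[OF g])
  finally show "sqker (\<lambda>s t. f s * g t)"
    unfolding sqker_def by (subst sqint_iff_nn_integral) (auto simp: ennreal_mult_less_top)
  show "ker_norm I (\<lambda>s t. f s * g t) = l2norm L f * l2norm L g"
    by (simp add: ker_norm_def l2norm_def power_mult_distrib real_sqrt_mult)
qed

text \<open>Fubini controls sections only for almost every \<open>t\<close>. At the remaining points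
  the integral defining the operator may be the default 0, so linearity in the kernel or in the
  function, and with it every operator identity below, is used almost everywhere.\<close>

lemma sqker_AE_section:
  assumes k: "sqker k"
  shows "AE t in L. sqint L (\<lambda>s. k s t)"
proof -
  note [measurable] = sqker_measurable[OF k]
  have "AE t in L. integrable L (\<lambda>s. (k s t)\<^sup>2)"
    using LL.AE_integrable_snd[OF sqker_integrable_square[OF k]] .
  moreover have "AE t in L. (\<lambda>s. k s t) \<in> borel_measurable L"
    using kernel_section_measurable[OF sqker_measurable[OF k]] by auto
  ultimately show ?thesis by eventually_elim (simp add: sqint_def)
qed

lemma ker_op_measurable:
  assumes k: "(\<lambda>(s, t). k s t) \<in> borel_measurable (L \<Otimes>\<^sub>M L)" and f: "f \<in> borel_measurable L"
  shows "ker_op I k f \<in> borel_measurable L"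
proof -
  note [measurable] = k f
  have "(\<lambda>(t, s). f s * k s t) \<in> borel_measurable (L \<Otimes>\<^sub>M L)"
    by measurable
  then show ?thesis
    unfolding ker_op_def[abs_def] by (rule borel_measurable_lebesgue_integral)
qed

text \<open>The Hilbert-Schmidt norm dominates the operator norm: Cauchy-Schwarz in \<open>s\<close>
  at almost every \<open>t\<close> gives the integrable majorant \<open>w\<close>, which is then
  integrated over \<open>t\<close>.\<close>

lemma ker_op_bound:
  assumes k: "sqker k" and f: "sqint L f"
  shows "sqint L (ker_op I k f)" and "l2norm L (ker_op I k f) \<le> ker_norm I k * l2norm L f"
proof -
  note int = sqker_integrable_square[OF k]
  define w where "w t = (l2norm L f)\<^sup>2 * (LINT s|L. (k s t)\<^sup>2)" for t
  have w: "integrable L w"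
    unfolding w_def using LL.integrable_snd[OF int] by simp
  have meas: "ker_op I k f \<in> borel_measurable L"
    by (rule ker_op_measurable[OF sqker_measurable[OF k] sqint_measurable[OF f]])
  have le: "AE t in L. (ker_op I k f t)\<^sup>2 \<le> w t"
    using sqker_AE_section[OF k]
  proof eventually_elim
    case (elim t)
    have "\<bar>ker_op I k f t\<bar> \<le> l2norm L f * l2norm L (\<lambda>s. k s t)"
      unfolding ker_op_def by (rule l2_Cauchy_Schwarz[OF f elim])
    then have "(ker_op I k f t)\<^sup>2 \<le> (l2norm L f * l2norm L (\<lambda>s. k s t))\<^sup>2"
      by (simp add: abs_le_square_iff[symmetric])
    then show ?case by (simp add: w_def power_mult_distrib l2norm_square)
  qed
  show sq: "sqint L (ker_op I k f)"
    unfolding sqint_def using meas le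
    by (auto intro!: Bochner_Integration.integrable_bound[OF w] elim!: eventually_mono)
  have "(l2norm L (ker_op I k f))\<^sup>2 \<le> (LINT t|L. w t)"
    unfolding l2norm_square using le w sqint_integrable_square[OF sq]
    by (intro integral_mono_AE) auto
  also have "\<dots> = (l2norm L f)\<^sup>2 * (ker_norm I k)\<^sup>2"
    using LL.integral_snd[OF int] unfolding w_def ker_norm_eq[OF k] l2norm_square
    by (simp add: split_beta')
  finally have "(l2norm L (ker_op I k f))\<^sup>2 \<le> (ker_norm I k * l2norm L f)\<^sup>2"
    by (simp add: power_mult_distrib mult.commute)
  then show "l2norm L (ker_op I k f) \<le> ker_norm I k * l2norm L f"
    by (rule power2_le_imp_le) simp
qed

lemma ker_op_add_fun:
  assumes "sqint L (\<lambda>s. k s t)" "sqint L f" "sqint L g"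
  shows "ker_op I k (\<lambda>s. f s + g s) t = ker_op I k f t + ker_op I k g t"
  unfolding ker_op_def using assms by (simp add: sqint_integrable_mult distrib_right)

lemma ker_op_divide_fun: "ker_op I k (\<lambda>s. f s / a) t = ker_op I k f t / a"
  unfolding ker_op_def by simp

lemma ker_op_sum_fun:
  assumes "sqint L (\<lambda>s. k s t)" "\<And>i. i \<in> A \<Longrightarrow> sqint L (f i)"
  shows "ker_op I k (\<lambda>s. \<Sum>i\<in>A. f i s) t = (\<Sum>i\<in>A. ker_op I k (f i) t)"
  unfolding ker_op_def sum_distrib_right
  by (rule Bochner_Integration.integral_sum) (auto intro: sqint_integrable_mult assms)

lemma ker_op_add_ker:
  assumes "sqint L (\<lambda>s. k s t)" "sqint L (\<lambda>s. l s t)" "sqint L f"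
  shows "ker_op I (\<lambda>s t. k s t + l s t) f t = ker_op I k f t + ker_op I l f t"
  unfolding ker_op_def using assms by (simp add: sqint_integrable_mult distrib_left)

lemma ker_op_diff_ker:
  assumes "sqint L (\<lambda>s. k s t)" "sqint L (\<lambda>s. l s t)" "sqint L f"
  shows "ker_op I (\<lambda>s t. k s t - l s t) f t = ker_op I k f t - ker_op I l f t"
  unfolding ker_op_def using assms by (simp add: sqint_integrable_mult right_diff_distrib)

lemma ker_op_divide_ker: "ker_op I (\<lambda>s t. k s t / a) f t = ker_op I k f t / a"
  unfolding ker_op_def by simp

text \<open>The operator bound is a parameter rather than \<open>ker_norm I k\<close>, so that the
  powers of \<open>K\<close> can be shown to decay like powers of its largest eigenvalue.\<close>

lemma ker_op_funpow_bound:
  assumes k: "sqker k" and bound: "\<And>f. sqint L f \<Longrightarrow> l2norm L (ker_op I k f) \<le> \<theta> * l2norm L f"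
    and "0 \<le> \<theta>" and f: "sqint L f"
  shows "sqint L ((ker_op I k ^^ j) f) \<and> l2norm L ((ker_op I k ^^ j) f) \<le> \<theta> ^ j * l2norm L f"
proof (induction j)
  case (Suc j)
  then have "l2norm L (ker_op I k ((ker_op I k ^^ j) f)) \<le> \<theta> * l2norm L ((ker_op I k ^^ j) f)"
    by (intro bound) simp
  also have "\<dots> \<le> \<theta> * (\<theta> ^ j * l2norm L f)"
    using Suc \<open>0 \<le> \<theta>\<close> by (intro mult_left_mono) auto
  finally show ?case using Suc ker_op_bound(1)[OF k] by (simp add: mult.assoc)
qed (simp add: f)

text \<open>The finite-rank operator multiplies the coefficient of \<open>f\<close> along
  \<open>\<phi> i\<close> by \<open>\<theta> i\<close>. Parseval for the finite sum and Bessel for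
  \<open>f\<close> then compare the two norms.\<close>

lemma spectral_partial_sum_bound:
  assumes p: "\<And>i. i \<in> A \<Longrightarrow> sqint L (\<phi> i)" and fin: "finite A"
    and on: "\<And>i j. i \<in> A \<Longrightarrow> j \<in> A \<Longrightarrow> (LINT t|L. \<phi> i t * \<phi> j t) = (if i = j then 1 else 0)"
    and \<theta>: "\<And>i. i \<in> A \<Longrightarrow> \<bar>\<theta> i\<bar> \<le> r" and "0 \<le> r" and f: "sqint L f"
  shows "l2norm L (ker_op I (\<lambda>s t. \<Sum>i\<in>A. \<theta> i * \<phi> i s * \<phi> i t) f) \<le> r * l2norm L f"
proof -
  have "ker_op I (\<lambda>s t. \<Sum>i\<in>A. \<theta> i * \<phi> i s * \<phi> i t) f t
      = (\<Sum>i\<in>A. (\<theta> i * (LINT s|L. f s * \<phi> i s)) * \<phi> i t)" for t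
  proof -
    have "ker_op I (\<lambda>s t. \<Sum>i\<in>A. \<theta> i * \<phi> i s * \<phi> i t) f t
        = (LINT s|L. (\<Sum>i\<in>A. (\<theta> i * \<phi> i t) * (f s * \<phi> i s)))"
      unfolding ker_op_def sum_distrib_left
      by (intro Bochner_Integration.integral_cong sum.cong refl) (simp add: mult_ac)
    also have "\<dots> = (\<Sum>i\<in>A. (\<theta> i * \<phi> i t) * (LINT s|L. f s * \<phi> i s))"
      using sqint_integrable_mult[OF f p] by (simp add: Bochner_Integration.integral_sum)
    finally show ?thesis by (simp add: mult_ac)
  qed
  then have "(l2norm L (ker_op I (\<lambda>s t. \<Sum>i\<in>A. \<theta> i * \<phi> i s * \<phi> i t) f))\<^sup>2
      = (\<Sum>i\<in>A. (\<theta> i * (LINT s|L. f s * \<phi> i s))\<^sup>2)"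
    using l2_Bessel(1)[OF f p fin on, where a = "\<lambda>i. \<theta> i * (LINT s|L. f s * \<phi> i s)"] by presburger
  also have "\<dots> \<le> (\<Sum>i\<in>A. r\<^sup>2 * (LINT s|L. f s * \<phi> i s)\<^sup>2)"
    unfolding power_mult_distrib using \<theta> \<open>0 \<le> r\<close>
    by (intro sum_mono mult_right_mono) (auto simp: abs_le_square_iff[symmetric])
  also have "\<dots> \<le> r\<^sup>2 * (l2norm L f)\<^sup>2"
    unfolding sum_distrib_left[symmetric]
    by (intro mult_left_mono l2_Bessel(2)[OF f p fin on]) auto
  finally have "(l2norm L (ker_op I (\<lambda>s t. \<Sum>i\<in>A. \<theta> i * \<phi> i s * \<phi> i t) f))\<^sup>2 \<le> (r * l2norm L f)\<^sup>2"
    by (simp add: power_mult_distrib)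
  then show ?thesis using \<open>0 \<le> r\<close> by (auto intro: power2_le_imp_le)
qed

text \<open>Split \<open>k\<close> into a partial sum of its expansion and a rest. The partial sum
  has operator norm at most \<open>\<theta> 1\<close>, the rest at most its Hilbert-Schmidt norm,
  which tends to 0.\<close>

lemma spectral_op_bound:
  assumes k: "sqker k" and sp: "spectral_decomposition I k \<theta> \<phi>"
    and ord: "\<And>k. k \<ge> 1 \<Longrightarrow> 0 \<le> \<theta> (Suc k) \<and> \<theta> (Suc k) \<le> \<theta> k" and pos: "0 \<le> \<theta> 1"
    and f: "sqint L f"
  shows "l2norm L (ker_op I k f) \<le> \<theta> 1 * l2norm L f"
proof -
  have th: "0 \<le> \<theta> i \<and> \<theta> i \<le> \<theta> 1" if "i \<ge> 1" for i
    using that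
  proof (induction i rule: dec_induct)
    case (step n)
    then show ?case using ord[of n] by linarith
  qed (use pos in simp)
  define S where "S N s t = (\<Sum>i=1..N. \<theta> i * \<phi> i s * \<phi> i t)" for N s t
  have phi: "sqint L (\<phi> i)" if "i \<ge> 1" for i
    using sp that by (auto simp: spectral_decomposition_def complete_orthonormal_def square_integrable_on_eq)
  have on: "(LINT t|L. \<phi> i t * \<phi> j t) = (if i = j then 1 else 0)" if "i \<ge> 1" "j \<ge> 1" for i j
    using sp that by (auto simp: spectral_decomposition_def complete_orthonormal_def)
  have lim: "(\<lambda>N. ker_norm I (\<lambda>s t. k s t - S N s t)) \<longlonglongrightarrow> 0"
    using sp by (simp add: spectral_decomposition_def S_def)
  have S: "sqker (S N)" for N
    unfolding S_def using sqker_tensor(1)[OF sqint_scale[OF phi] phi]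
    by (intro sqker_sum) auto
  have "l2norm L (ker_op I k f) \<le> ker_norm I (\<lambda>s t. k s t - S N s t) * l2norm L f + \<theta> 1 * l2norm L f" for N
  proof -
    note kS = sqker_diff[OF k S[of N]]
    have "l2norm L (ker_op I k f) = l2norm L (\<lambda>t. ker_op I (\<lambda>s t. k s t - S N s t) f t + ker_op I (S N) f t)"
    proof (rule l2norm_cong_AE)
      show "AE t in L. ker_op I k f t = ker_op I (\<lambda>s t. k s t - S N s t) f t + ker_op I (S N) f t"
        using sqker_AE_section[OF k] sqker_AE_section[OF S[of N]]
        by eventually_elim (simp add: ker_op_diff_ker f)
    qed (use sqint_measurable[OF ker_op_bound(1)[OF k f]] sqint_measurable[OF ker_op_bound(1)[OF S f]]
          sqint_measurable[OF ker_op_bound(1)[OF kS f]] in measurable)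
    also have "\<dots> \<le> l2norm L (ker_op I (\<lambda>s t. k s t - S N s t) f) + l2norm L (ker_op I (S N) f)"
      by (rule l2norm_triangle[OF ker_op_bound(1)[OF kS f] ker_op_bound(1)[OF S f]])
    also have "l2norm L (ker_op I (S N) f) \<le> \<theta> 1 * l2norm L f"
      unfolding S_def using phi on th pos
      by (intro spectral_partial_sum_bound[OF _ _ _ _ _ f]) auto
    also note ker_op_bound(2)[OF kS f]
    finally show ?thesis by simp
  qed
  moreover have "(\<lambda>N. ker_norm I (\<lambda>s t. k s t - S N s t) * l2norm L f + \<theta> 1 * l2norm L f)
      \<longlonglongrightarrow> 0 * l2norm L f + \<theta> 1 * l2norm L f"
    by (intro tendsto_intros lim)
  ultimately show ?thesis
    by (intro LIMSEQ_le_const[where X = "\<lambda>N. ker_norm I (\<lambda>s t. k s t - S N s t) * l2norm L f + \<theta> 1 * l2norm L f"]) auto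
qed

end

section \<open>Real recursions and the growth of their solutions\<close>

lemma linear_recursion_bound:
  fixes x :: "nat \<Rightarrow> real"
  assumes "0 < \<theta>" "0 \<le> B" "x 1 \<le> A" "0 \<le> A"
    and step: "\<And>j. 1 \<le> j \<Longrightarrow> x (Suc j) \<le> \<theta> * x j + B * \<theta> ^ j"
    and "1 \<le> j"
  shows "x j \<le> (A + B) / \<theta> * (real j * \<theta> ^ j)"
  using \<open>1 \<le> j\<close>
proof (induction j rule: dec_induct)
  case base
  then show ?case using assms by simp
next
  case (step j)
  have "x (Suc j) \<le> \<theta> * x j + B * \<theta> ^ j" by (rule assms(5)[OF step(1)])
  \<comment> \<open>Enlarging the forcing coefficient from \<open>B\<close> to \<open>A + B\<close>
    makes each step raise the factor \<open>j\<close> by exactly one.\<close>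
  also have "\<dots> \<le> \<theta> * ((A + B) / \<theta> * (real j * \<theta> ^ j)) + (A + B) * \<theta> ^ j"
    using step assms by (intro add_mono mult_left_mono mult_right_mono) auto
  also have "\<dots> = (A + B) / \<theta> * (real (Suc j) * \<theta> ^ Suc j)"
    using \<open>0 < \<theta>\<close> by (simp add: field_simps)
  finally show ?case .
qed

text \<open>The forcing has the same base \<open>q\<close> as the homogeneous solution, so its
  polynomial degree goes up by one; the increment \<open>2 * j + 1\<close> of the square leaves room
  for \<open>j\<close>. The constant is divided by \<open>\<theta>\<close> and not by
  \<open>q\<close>, since \<open>q\<close> will depend on the sample size.\<close>

lemma quadratic_recursion_bound:
  fixes e :: "nat \<Rightarrow> real"
  assumes "0 < \<theta>" "\<theta> \<le> q" "0 \<le> B" "e 1 \<le> A" "0 \<le> A"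
    and step: "\<And>j. 1 \<le> j \<Longrightarrow> e (Suc j) \<le> q * e j + B * (real j * q ^ j)"
    and "1 \<le> j"
  shows "e j \<le> (A + B) / \<theta> * ((real j)\<^sup>2 * q ^ j)"
  using \<open>1 \<le> j\<close>
proof (induction j rule: dec_induct)
  case base
  have "A * \<theta> \<le> (A + B) * q" using assms by (intro mult_mono) auto
  then have "A \<le> (A + B) / \<theta> * q" using assms(1) by (simp add: field_simps)
  then show ?case using assms by simp
next
  case (step j)
  define G where "G = (A + B) / \<theta>"
  have "G \<ge> 0" "0 \<le> q" using assms by (auto simp: G_def)
  have "B \<le> G * \<theta>" using assms by (simp add: G_def)
  also have "\<dots> \<le> G * q" using assms \<open>G \<ge> 0\<close> by (intro mult_left_mono) auto
  finally have "B * real j \<le> G * q * real j" by (intro mult_right_mono) auto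
  also have "\<dots> \<le> G * q * (2 * real j + 1)" using \<open>G \<ge> 0\<close> \<open>0 \<le> q\<close> by (intro mult_left_mono) auto
  finally have B: "B * real j * q ^ j \<le> G * q * (2 * real j + 1) * q ^ j"
    using \<open>0 \<le> q\<close> by (intro mult_right_mono) auto
  have "e (Suc j) \<le> q * e j + B * (real j * q ^ j)" by (rule assms(6)[OF step(1)])
  also have "\<dots> \<le> q * (G * ((real j)\<^sup>2 * q ^ j)) + G * q * (2 * real j + 1) * q ^ j"
    using step(3) \<open>0 \<le> q\<close> B unfolding G_def by (intro add_mono mult_left_mono) (auto simp: mult_ac)
  also have "\<dots> = G * ((real (Suc j))\<^sup>2 * q ^ Suc j)"
    by (simp add: algebra_simps power2_eq_square)
  finally show ?case by (simp add: G_def)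
qed

text \<open>Follows from \<open>1 + x \<le> exp x\<close>. With \<open>r\<close> the root of the
  sample size, this is how the restriction of \<open>j\<close> to a multiple of that root
  enters.\<close>

lemma power_perturbation_bound:
  fixes \<theta> D r C :: real
  assumes "0 < \<theta>" "0 \<le> D" "0 < r" "real j \<le> C * r"
  shows "(\<theta> + D / r) ^ j \<le> exp (C * D / \<theta>) * \<theta> ^ j"
proof -
  have "(1 + D / (\<theta> * r)) ^ j \<le> exp (D / (\<theta> * r)) ^ j"
    using assms by (intro power_mono) (auto simp: exp_ge_add_one_self)
  also have "\<dots> = exp (real j * (D / (\<theta> * r)))" by (rule exp_of_nat_mult[symmetric])
  also have "\<dots> \<le> exp ((C * r) * (D / (\<theta> * r)))"
    using assms by (subst exp_le_cancel_iff, intro mult_right_mono) auto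
  also have "(C * r) * (D / (\<theta> * r)) = C * D / \<theta>" using assms by simp
  finally have "\<theta> ^ j * (1 + D / (\<theta> * r)) ^ j \<le> \<theta> ^ j * exp (C * D / \<theta>)"
    using assms by (intro mult_left_mono) auto
  moreover have "\<theta> + D / r = \<theta> * (1 + D / (\<theta> * r))" using assms by (simp add: field_simps)
  ultimately show ?thesis by (simp add: power_mult_distrib mult.commute)
qed

lemma square_times_geometric_bounded:
  fixes \<theta> \<kappa> :: real
  assumes "0 < \<theta>" "\<theta> < \<kappa>"
  obtains B where "0 \<le> B" "\<And>j. (real j)\<^sup>2 * \<theta> ^ j \<le> B * \<kappa> ^ j"
proof -
  \<comment> \<open>With the square root as base, the quadratic claim is the square of the linear
    one: \<open>j * \<sigma> ^ j\<close> tends to 0, hence is bounded.\<close>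
  define \<sigma> where "\<sigma> = sqrt (\<theta> / \<kappa>)"
  have "norm \<sigma> < 1" and \<sigma>: "\<sigma>\<^sup>2 = \<theta> / \<kappa>"
    using assms by (auto simp: \<sigma>_def)
  then have "(\<lambda>j. of_nat j * \<sigma> ^ j) \<longlonglongrightarrow> 0"
    by (intro powser_times_n_limit_0)
  then have "Bseq (\<lambda>j. of_nat j * \<sigma> ^ j)"
    by (intro convergent_imp_Bseq convergentI)
  then obtain G where G: "\<And>j. norm (of_nat j * \<sigma> ^ j) \<le> G"
    unfolding Bseq_def by auto
  define B where "B = G\<^sup>2"
  have B: "norm ((real j)\<^sup>2 * (\<theta> / \<kappa>) ^ j) \<le> B" for j
  proof -
    have "(real j)\<^sup>2 * (\<theta> / \<kappa>) ^ j = (norm (of_nat j * \<sigma> ^ j))\<^sup>2"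
      by (simp add: \<sigma>[symmetric] power_mult_distrib power_mult[symmetric] mult.commute)
    also have "\<dots> \<le> B" unfolding B_def by (intro power_mono G) simp
    finally show ?thesis using assms by simp
  qed
  show ?thesis
  proof
    show "0 \<le> B" using B[of 0] by simp
    show "(real j)\<^sup>2 * \<theta> ^ j \<le> B * \<kappa> ^ j" for j
    proof -
      have "(real j)\<^sup>2 * \<theta> ^ j = ((real j)\<^sup>2 * (\<theta> / \<kappa>) ^ j) * \<kappa> ^ j"
        using assms by (simp add: power_divide)
      also have "\<dots> \<le> B * \<kappa> ^ j" using B[of j] assms by (intro mult_right_mono) auto
      finally show ?thesis .
    qed
  qed
qed

section \<open>Explicit constants and the deterministic expansion of the iterates\<close>

definition first_order_const :: "real \<Rightarrow> real \<Rightarrow> real" where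
  "first_order_const A \<theta> = (A + A * A) / \<theta>"

text \<open>Just as \<open>first_order_const\<close> is the constant of
  \<open>linear_recursion_bound\<close> with start \<open>A\<close> and forcing
  \<open>A * A\<close>, this is the one of \<open>quadratic_recursion_bound\<close> with start
  \<open>A\<^sup>2\<close>. Its forcing comes from applying \<open>\<xi>\<close> and the tensor of
  \<open>m\<close> to the first-order term, and that tensor to the iterates of \<open>b\<close> (the
  summand \<open>A ^ 3\<close>). The exponential is the price of
  \<open>power_perturbation_bound\<close> with \<open>D = A + A\<^sup>2\<close>.\<close>

definition remainder_const :: "real \<Rightarrow> real \<Rightarrow> real \<Rightarrow> real" where
  "remainder_const A \<theta> C =
     (A\<^sup>2 + ((A + A\<^sup>2) * first_order_const A \<theta> + A ^ 3)) / \<theta> * exp (C * (A + A\<^sup>2) / \<theta>)"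

text \<open>Collects the six second-order terms of the product of two expansions, with indices \<open>j + 1\<close> and \<open>k\<close>;
  the bound \<open>C + 1\<close> accounts for \<open>j + 1 \<le> (C + 1) n\<^sup>1\<^sup>/\<^sup>2\<close>.\<close>

definition product_const :: "real \<Rightarrow> real \<Rightarrow> real \<Rightarrow> real" where
  "product_const A \<theta> C =
     (A + first_order_const A \<theta> + remainder_const A \<theta> (C + 1))\<^sup>2 * (7 + 3 * (C + 1) + (C + 1)\<^sup>2) * \<theta>"

text \<open>An exact identity: the terms of order 0 and 1 in \<open>1 / r\<close> are subtracted,
  and the other six are sorted by order so that they can be estimated one by one.\<close>

lemma integral_expansion_product:
  assumes u: "sqint L u" "sqint L u'" and x: "sqint L x" "sqint L x'" and e: "sqint L e" "sqint L e'"
    and "r \<noteq> 0"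
  shows "(LINT t|L. (u t + x t / r + e t / r\<^sup>2) * (u' t + x' t / r + e' t / r\<^sup>2))
       - ((LINT t|L. u t * u' t) + (LINT t|L. x t * u' t + u t * x' t) / r)
     = ((LINT t|L. x t * x' t) + (LINT t|L. u t * e' t) + (LINT t|L. e t * u' t)) / r\<^sup>2
       + ((LINT t|L. x t * e' t) + (LINT t|L. e t * x' t)) / r ^ 3 + (LINT t|L. e t * e' t) / r ^ 4"
proof -
  note i = sqint_integrable_mult[OF u] sqint_integrable_mult[OF u(1) x(2)]
    sqint_integrable_mult[OF u(1) e(2)] sqint_integrable_mult[OF x(1) u(2)] sqint_integrable_mult[OF x]
    sqint_integrable_mult[OF x(1) e(2)] sqint_integrable_mult[OF e(1) u(2)]
    sqint_integrable_mult[OF e(1) x(2)] sqint_integrable_mult[OF e]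
  have "(LINT t|L. (u t + x t / r + e t / r\<^sup>2) * (u' t + x' t / r + e' t / r\<^sup>2))
      = (LINT t|L. u t * u' t + (x t * u' t + u t * x' t) / r
         + (x t * x' t + u t * e' t + e t * u' t) / r\<^sup>2 + (x t * e' t + e t * x' t) / r ^ 3
         + e t * e' t / r ^ 4)"
    using \<open>r \<noteq> 0\<close>
    by (intro Bochner_Integration.integral_cong refl) (simp add: field_simps power2_eq_square eval_nat_numeral)
  also have "\<dots> = (LINT t|L. u t * u' t) + (LINT t|L. x t * u' t + u t * x' t) / r
      + ((LINT t|L. x t * x' t) + (LINT t|L. u t * e' t) + (LINT t|L. e t * u' t)) / r\<^sup>2
      + ((LINT t|L. x t * e' t) + (LINT t|L. e t * x' t)) / r ^ 3 + (LINT t|L. e t * e' t) / r ^ 4"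
    using i by simp
  finally show ?thesis by simp
qed

text \<open>Deterministic part, at a fixed sample point: \<open>H\<close>, \<open>v1\<close>, \<open>x0\<close> play the roles of the kernel estimator, of the
  estimator of \<open>K(b)\<close> and of \<open>\<xi>\<^sub>0\<close>, and \<open>u j\<close>, \<open>v j\<close>, \<open>x j\<close>, \<open>e j\<close> those of \<open>K\<^sup>j(b)\<close>, its estimator, \<open>\<xi>\<^sub>j\<close> and \<open>\<eta>\<^sub>j\<close>.
  As in the definitions, \<open>v j\<close>, \<open>x j\<close> and \<open>e j\<close> are meaningful for \<open>j \<ge> 1\<close> only.\<close>

locale kernel_perturbation = lmeasurable_domain +
  fixes K \<xi> H :: "real \<Rightarrow> real \<Rightarrow> real" and b x0 m v1 :: "real \<Rightarrow> real" and y \<theta> A :: real and n :: nat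
  assumes K: "sqker K" and \<xi>: "sqker \<xi>" and b: "sqint L b" and x0: "sqint L x0" and m: "sqint L m"
    and n: "1 \<le> n" and \<theta>: "0 < \<theta>"
    and K_bound: "\<And>f. sqint L f \<Longrightarrow> l2norm L (ker_op I K f) \<le> \<theta> * l2norm L f"
    and bounds: "ker_norm I \<xi> \<le> A" "l2norm L x0 \<le> A" "l2norm L m \<le> A" "\<bar>y\<bar> \<le> A" "l2norm L b \<le> A"
    and H_eq: "\<And>s t. s \<in> space L \<Longrightarrow> t \<in> space L \<Longrightarrow>
           H s t = K s t + \<xi> s t / sqrt (real n) - m s * m t / real n"
    and v1_measurable: "v1 \<in> borel_measurable L"
    and v1_eq: "AE t in L. v1 t = ker_op I K b t + x0 t / sqrt (real n) - m t * y / real n"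
begin

abbreviation "r \<equiv> sqrt (real n)"
abbreviation "u j \<equiv> (ker_op I K ^^ j) b"
abbreviation "v j \<equiv> (ker_op I H ^^ (j - 1)) v1"

definition x :: "nat \<Rightarrow> real \<Rightarrow> real" where
  "x j t = (ker_op I K ^^ (j - 1)) x0 t
     + (\<Sum>k<j - 1. (ker_op I K ^^ k) (ker_op I \<xi> ((ker_op I K ^^ (j - k - 1)) b)) t)"

definition e :: "nat \<Rightarrow> real \<Rightarrow> real" where
  "e j t = real n * (v j t - u j t - x j t / r)"

lemma r: "1 \<le> r" "r\<^sup>2 = real n" "0 < r" "r \<noteq> 0" "real n \<noteq> 0"
  using n by auto

lemma A_nonneg: "0 \<le> A"
  using bounds(4) by linarith

lemma v_eq: "v j t = u j t + x j t / r + e j t / real n"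
  using r by (simp add: e_def field_simps)

lemma u: "sqint L (u j)" "l2norm L (u j) \<le> \<theta> ^ j * l2norm L b"
  using ker_op_funpow_bound[OF K K_bound _ b] \<theta> by auto

lemma K_funpow: "sqint L f \<Longrightarrow> sqint L ((ker_op I K ^^ j) f)"
  using ker_op_funpow_bound[OF K K_bound] \<theta> by auto

lemma x: "sqint L (x j)"
  unfolding x_def[abs_def]
  by (intro sqint_add sqint_sum K_funpow x0 ker_op_bound(1)[OF \<xi>] b)

text \<open>The formula for \<open>H\<close> is assumed on \<open>I\<close> only. This explicit
  kernel agrees with \<open>H\<close> there and is square integrable, so facts about the operator
  are proved for it and transferred by \<open>ker_op_H\<close>.\<close>

lemma H': "sqker (\<lambda>s t. K s t + \<xi> s t / r - m s * m t / real n)"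
  by (intro sqker_diff sqker_add K sqker_divide \<xi> sqker_tensor(1) m)

lemma ker_op_H:
  "t \<in> space L \<Longrightarrow> ker_op I H f t = ker_op I (\<lambda>s t. K s t + \<xi> s t / r - m s * m t / real n) f t"
  unfolding ker_op_def by (intro Bochner_Integration.integral_cong) (auto simp: H_eq)

lemma ker_op_H_AE:
  assumes f: "sqint L f"
  shows "AE t in L. ker_op I H f t
    = ker_op I K f t + ker_op I \<xi> f t / r - ker_op I (\<lambda>s t. m s * m t) f t / real n"
  using AE_space sqker_AE_section[OF K] sqker_AE_section[OF sqker_divide[OF \<xi>, of r]]
    sqker_AE_section[OF sqker_divide[OF sqker_tensor(1)[OF m m], of "real n"]]
    sqker_AE_section[OF sqker_add[OF K sqker_divide[OF \<xi>, of r]]]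
  by eventually_elim
    (simp add: ker_op_H ker_op_diff_ker ker_op_add_ker ker_op_divide_ker f)

lemma ker_op_H_sqint: "sqint L f \<Longrightarrow> sqint L (ker_op I H f)"
proof -
  assume f: "sqint L f"
  have "sqint L (ker_op I (\<lambda>s t. K s t + \<xi> s t / r - m s * m t / real n) f)"
    by (rule ker_op_bound(1)[OF H' f])
  moreover have "ker_op I H f \<in> borel_measurable L
      \<longleftrightarrow> ker_op I (\<lambda>s t. K s t + \<xi> s t / r - m s * m t / real n) f \<in> borel_measurable L"
    by (intro measurable_cong ker_op_H)
  moreover have "integrable L (\<lambda>t. (ker_op I H f t)\<^sup>2)
      \<longleftrightarrow> integrable L (\<lambda>t. (ker_op I (\<lambda>s t. K s t + \<xi> s t / r - m s * m t / real n) f t)\<^sup>2)"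
    by (intro Bochner_Integration.integrable_cong refl) (simp only: ker_op_H)
  ultimately show ?thesis by (simp add: sqint_def)
qed

lemma v1: "sqint L v1"
proof -
  have *: "sqint L (\<lambda>t. ker_op I K b t + x0 t / r - m t * y / real n)"
    using sqint_scale[OF m, of y]
    by (intro sqint_diff sqint_add sqint_divide ker_op_bound(1)[OF K] b x0) (simp add: mult.commute)
  have "integrable L (\<lambda>t. (v1 t)\<^sup>2)
      \<longleftrightarrow> integrable L (\<lambda>t. (ker_op I K b t + x0 t / r - m t * y / real n)\<^sup>2)"
    using v1_eq v1_measurable sqint_measurable[OF *]
    by (intro integrable_cong_AE) auto
  with * v1_measurable show ?thesis by (simp add: sqint_def)
qed

lemma v: "sqint L (v j)"
proof -
  have "sqint L ((ker_op I H ^^ i) v1)" for i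
    by (induction i) (simp_all add: v1 ker_op_H_sqint)
  then show ?thesis .
qed

lemma e: "sqint L (e j)"
  unfolding e_def[abs_def] by (intro sqint_scale sqint_diff sqint_divide v u x)

text \<open>The summand \<open>k = 0\<close> of the sum for \<open>Suc j\<close> is
  \<open>\<xi>\<close> applied to \<open>u j\<close>; every other summand is \<open>K\<close>
  applied to the preceding summand of the sum for \<open>j\<close>.\<close>

lemma x_Suc:
  assumes "1 \<le> j"
  shows "AE t in L. x (Suc j) t = ker_op I K (x j) t + ker_op I \<xi> (u j) t"
proof -
  obtain i where j: "j = Suc i" using assms by (cases j) auto
  define F where "F k = (ker_op I K ^^ k) (ker_op I \<xi> ((ker_op I K ^^ (Suc i - k - 1)) b))" for k
  have F: "sqint L (F k)" for k
    unfolding F_def by (intro K_funpow ker_op_bound(1)[OF \<xi>] b)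
  have xj: "x (Suc i) = (\<lambda>t. (ker_op I K ^^ i) x0 t + (\<Sum>k<i. F k t))"
    by (simp add: x_def[abs_def] F_def)
  have xS: "x (Suc (Suc i)) t = ker_op I K ((ker_op I K ^^ i) x0) t + (ker_op I \<xi> (u (Suc i)) t
      + (\<Sum>k<i. ker_op I K (F k) t))" for t
    by (simp add: x_def F_def sum.lessThan_Suc_shift del: sum.lessThan_Suc)
  show ?thesis
    unfolding j using sqker_AE_section[OF K]
  proof eventually_elim
    case (elim t)
    have "ker_op I K (x (Suc i)) t = ker_op I K ((ker_op I K ^^ i) x0) t + (\<Sum>k<i. ker_op I K (F k) t)"
      unfolding xj
      by (simp add: ker_op_add_fun ker_op_sum_fun elim K_funpow x0 sqint_sum F)
    then show ?case unfolding xS by simp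
  qed
qed

lemma e_1: "AE t in L. e 1 t = - y * m t"
  using v1_eq
proof eventually_elim
  case (elim t)
  have "e 1 t = real n * (- (m t * y / real n))"
    using elim by (simp add: e_def x_def)
  then show ?case using r by simp
qed

text \<open>The expansion of \<open>v j\<close> is inserted into \<open>v (Suc j) = H (v j)\<close>,
  and \<open>H\<close> is expanded on \<open>u j\<close> and \<open>x j\<close> only. Keeping
  \<open>H\<close> whole on \<open>e j\<close> closes the recursion; the terms of order 0 and 1
  cancel by \<open>x_Suc\<close>.\<close>

lemma e_Suc:
  assumes "1 \<le> j"
  shows "AE t in L. e (Suc j) t = ker_op I H (e j) t + ker_op I \<xi> (x j) t
    - ker_op I (\<lambda>s t. m s * m t) (u j) t - ker_op I (\<lambda>s t. m s * m t) (x j) t / r"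
  using AE_space sqker_AE_section[OF H'] ker_op_H_AE[OF u(1)[of j]] ker_op_H_AE[OF x[of j]] x_Suc[OF assms]
proof eventually_elim
  case (elim t)
  have "v (Suc j) t = ker_op I H (v j) t" using assms by (cases j) auto
  also have "\<dots> = ker_op I H (\<lambda>s. u j s + x j s / r + e j s / real n) t"
    unfolding v_eq[symmetric] ..
  also have "\<dots> = ker_op I H (u j) t + ker_op I H (x j) t / r + ker_op I H (e j) t / real n"
    using elim(1,2)
    by (simp add: ker_op_H ker_op_add_fun ker_op_divide_fun sqint_add sqint_divide u x e)
  finally have v: "v (Suc j) t = ker_op I H (u j) t + ker_op I H (x j) t / r + ker_op I H (e j) t / real n" .
  have "e (Suc j) t = real n * (v (Suc j) t - ker_op I K (u j) t - x (Suc j) t / r)"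
    by (simp add: e_def)
  \<comment> \<open>The \<open>\<xi>\<close> part of \<open>H\<close> and the weight of
    \<open>x j\<close> each contribute \<open>1 / r\<close>, which together cancel the prefactor
    \<open>n\<close>.\<close>
  also have "\<dots> = ker_op I H (e j) t + (real n / r\<^sup>2) * ker_op I \<xi> (x j) t
    - ker_op I (\<lambda>s t. m s * m t) (u j) t - ker_op I (\<lambda>s t. m s * m t) (x j) t / r"
    unfolding v elim using r(4,5) by (simp add: field_simps power2_eq_square del: real_sqrt_mult_self)
  finally show ?case using r by simp
qed

lemma tensor_op: "sqint L f \<Longrightarrow> l2norm L (ker_op I (\<lambda>s t. m s * m t) f) \<le> A\<^sup>2 * l2norm L f"
proof -
  assume f: "sqint L f"
  have "l2norm L m * l2norm L m \<le> A * A" using bounds A_nonneg by (intro mult_mono) auto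
  then have "l2norm L m * l2norm L m * l2norm L f \<le> A\<^sup>2 * l2norm L f"
    by (intro mult_right_mono) (auto simp: power2_eq_square)
  with ker_op_bound(2)[OF sqker_tensor(1)[OF m m] f] show ?thesis
    by (simp add: sqker_tensor(2)[OF m m])
qed

lemma \<xi>_op: "sqint L f \<Longrightarrow> l2norm L (ker_op I \<xi> f) \<le> A * l2norm L f"
  using ker_op_bound(2)[OF \<xi>, of f] mult_right_mono[OF bounds(1), of "l2norm L f"] by simp

lemma H_op:
  assumes f: "sqint L f"
  shows "l2norm L (ker_op I H f) \<le> (\<theta> + (A + A\<^sup>2) / r) * l2norm L f"
proof -
  note Kf = ker_op_bound(1)[OF K f] and \<xi>f = ker_op_bound(1)[OF \<xi> f]
    and mf = ker_op_bound(1)[OF sqker_tensor(1)[OF m m] f]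
  note s = sqint_add[OF Kf sqint_divide[OF \<xi>f, of r]] sqint_divide[OF mf, of "real n"]
  have "l2norm L (ker_op I H f)
      = l2norm L (\<lambda>t. ker_op I K f t + ker_op I \<xi> f t / r - ker_op I (\<lambda>s t. m s * m t) f t / real n)"
    using ker_op_H_AE[OF f] sqint_measurable[OF ker_op_H_sqint[OF f]] sqint_measurable[OF sqint_diff[OF s]]
    by (intro l2norm_cong_AE) auto
  also have "\<dots> \<le> l2norm L (ker_op I K f) + l2norm L (ker_op I \<xi> f) / r
      + l2norm L (ker_op I (\<lambda>s t. m s * m t) f) / real n"
    using l2norm_triangle_diff[OF s] l2norm_triangle[OF Kf sqint_divide[OF \<xi>f, of r]]
    by (simp add: l2norm_divide)
  also have "\<dots> \<le> \<theta> * l2norm L f + A * l2norm L f / r + A\<^sup>2 * l2norm L f / r"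
  proof (intro add_mono K_bound f divide_right_mono \<xi>_op)
    \<comment> \<open>As \<open>r \<ge> 1\<close>, the perturbation of order \<open>1 / n\<close> is
      also at most of order \<open>1 / r\<close>, which gives the single base
      \<open>\<theta> + D / r\<close> of \<open>power_perturbation_bound\<close>.\<close>
    have "r \<le> r\<^sup>2" using r(1) by (simp add: self_le_power del: real_sqrt_pow2_iff real_sqrt_pow2)
    then have "r \<le> real n" by simp
    then have "l2norm L (ker_op I (\<lambda>s t. m s * m t) f) / real n \<le> l2norm L (ker_op I (\<lambda>s t. m s * m t) f) / r"
      using r by (intro divide_left_mono) auto
    also have "\<dots> \<le> A\<^sup>2 * l2norm L f / r" using r by (intro divide_right_mono tensor_op f) auto
    finally show "l2norm L (ker_op I (\<lambda>s t. m s * m t) f) / real n \<le> A\<^sup>2 * l2norm L f / r" .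
  qed (use r in auto)
  finally show ?thesis by (simp add: algebra_simps add_divide_distrib)
qed

lemma x_bound:
  assumes "1 \<le> j"
  shows "l2norm L (x j) \<le> first_order_const A \<theta> * (real j * \<theta> ^ j)"
  unfolding first_order_const_def
proof (rule linear_recursion_bound[OF \<theta> _ _ A_nonneg _ assms])
  have "x 1 = x0" by (simp add: x_def fun_eq_iff)
  then show "l2norm L (x 1) \<le> A" using bounds by simp
next
  fix j :: nat assume "1 \<le> j"
  note s = ker_op_bound(1)[OF K x[of j]] ker_op_bound(1)[OF \<xi> u(1)[of j]]
  have "l2norm L (x (Suc j)) = l2norm L (\<lambda>t. ker_op I K (x j) t + ker_op I \<xi> (u j) t)"
    using x_Suc[OF \<open>1 \<le> j\<close>] sqint_measurable[OF x] sqint_measurable[OF sqint_add[OF s]]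
    by (intro l2norm_cong_AE) auto
  also have "\<dots> \<le> \<theta> * l2norm L (x j) + A * l2norm L (u j)"
    using l2norm_triangle[OF s] K_bound[OF x[of j]] \<xi>_op[OF u(1)[of j]] by linarith
  also have "A * l2norm L (u j) \<le> A * (\<theta> ^ j * A)"
    using u(2)[of j] bounds(5) A_nonneg \<theta> by (intro mult_left_mono order_trans[OF u(2)]) auto
  finally show "l2norm L (x (Suc j)) \<le> \<theta> * l2norm L (x j) + A * A * \<theta> ^ j"
    by (simp add: mult_ac)
qed (use A_nonneg in simp)

lemma e_step:
  assumes "1 \<le> j"
  shows "l2norm L (e (Suc j)) \<le> (\<theta> + (A + A\<^sup>2) / r) * l2norm L (e j)
    + (A + A\<^sup>2) * l2norm L (x j) + A\<^sup>2 * l2norm L (u j)"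
proof -
  note t = sqker_tensor(1)[OF m m]
  note s = ker_op_H_sqint[OF e[of j]] ker_op_bound(1)[OF \<xi> x[of j]] ker_op_bound(1)[OF t u(1)[of j]]
    sqint_divide[OF ker_op_bound(1)[OF t x[of j]], of r]
  note s2 = sqint_add[OF s(1,2)]
  note s3 = sqint_diff[OF s2 s(3)]
  have "l2norm L (e (Suc j)) = l2norm L (\<lambda>t. ker_op I H (e j) t + ker_op I \<xi> (x j) t
    - ker_op I (\<lambda>s t. m s * m t) (u j) t - ker_op I (\<lambda>s t. m s * m t) (x j) t / r)"
    using e_Suc[OF assms] sqint_measurable[OF e] sqint_measurable[OF sqint_diff[OF s3 s(4)]]
    by (intro l2norm_cong_AE) auto
  also have "\<dots> \<le> l2norm L (ker_op I H (e j)) + l2norm L (ker_op I \<xi> (x j))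
    + l2norm L (ker_op I (\<lambda>s t. m s * m t) (u j)) + l2norm L (ker_op I (\<lambda>s t. m s * m t) (x j)) / r"
    using l2norm_triangle_diff[OF s3 s(4)] l2norm_triangle_diff[OF s2 s(3)] l2norm_triangle[OF s(1,2)]
    by (simp add: l2norm_divide)
  also have "l2norm L (ker_op I (\<lambda>s t. m s * m t) (x j)) / r \<le> l2norm L (ker_op I (\<lambda>s t. m s * m t) (x j)) / 1"
    using r by (intro divide_left_mono) auto
  also have "\<dots> \<le> A\<^sup>2 * l2norm L (x j)" using tensor_op[OF x] by simp
  finally show ?thesis
    using H_op[OF e[of j]] \<xi>_op[OF x[of j]] tensor_op[OF u(1)[of j]] by (simp add: distrib_right)
qed

lemma e_bound:
  assumes "1 \<le> j" "real j \<le> C * r"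
  shows "l2norm L (e j) \<le> remainder_const A \<theta> C * ((real j)\<^sup>2 * \<theta> ^ j)"
proof -
  define q where "q = \<theta> + (A + A\<^sup>2) / r"
  define B where "B = (A + A\<^sup>2) * first_order_const A \<theta> + A ^ 3"
  have c: "0 \<le> first_order_const A \<theta>" using A_nonneg \<theta> by (simp add: first_order_const_def)
  have B: "0 \<le> B" using A_nonneg c by (simp add: B_def)
  have q: "\<theta> \<le> q" using A_nonneg r(3) by (simp add: q_def)
  have "l2norm L (e j) \<le> (A\<^sup>2 + B) / \<theta> * ((real j)\<^sup>2 * q ^ j)"
  proof (rule quadratic_recursion_bound[OF \<theta> q B _ _ _ assms(1)])
    have "l2norm L (e 1) = l2norm L (\<lambda>t. - y * m t)"
      using e_1 sqint_measurable[OF e] sqint_measurable[OF m] by (intro l2norm_cong_AE) auto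
    also have "\<dots> = \<bar>y\<bar> * l2norm L m" by (simp only: l2norm_scale abs_minus)
    also have "\<dots> \<le> A * A" using bounds A_nonneg by (intro mult_mono) auto
    finally show "l2norm L (e 1) \<le> A\<^sup>2" by (simp add: power2_eq_square)
  next
    fix j :: nat assume j: "1 \<le> j"
    \<comment> \<open>The bounds for \<open>x j\<close> and \<open>u j\<close> have base
      \<open>\<theta>\<close>; they are weakened to base \<open>q\<close>, the growth rate of the
      homogeneous part.\<close>
    have pow: "\<theta> ^ j \<le> q ^ j" using \<theta> q by (intro power_mono) auto
    have "l2norm L (x j) \<le> first_order_const A \<theta> * (real j * q ^ j)"
      using x_bound[OF j] mult_left_mono[OF mult_left_mono[OF pow, of "real j"] c] by simp
    then have 1: "(A + A\<^sup>2) * l2norm L (x j) \<le> (A + A\<^sup>2) * (first_order_const A \<theta> * (real j * q ^ j))"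
      using A_nonneg by (intro mult_left_mono) auto
    have "l2norm L (u j) \<le> \<theta> ^ j * A"
      using \<theta> by (intro order_trans[OF u(2)] mult_left_mono bounds(5)) simp
    also have "\<dots> \<le> (real j * q ^ j) * A"
    proof (intro mult_right_mono A_nonneg)
      show "\<theta> ^ j \<le> real j * q ^ j" using pow j \<theta> q mult_mono[of 1 "real j" "\<theta> ^ j" "q ^ j"] by simp
    qed
    finally have 2: "A\<^sup>2 * l2norm L (u j) \<le> A\<^sup>2 * ((real j * q ^ j) * A)"
      by (intro mult_left_mono) auto
    have "l2norm L (e (Suc j)) \<le> q * l2norm L (e j) + (A + A\<^sup>2) * (first_order_const A \<theta> * (real j * q ^ j))
        + A\<^sup>2 * ((real j * q ^ j) * A)"
      using e_step[OF j] 1 2 by (simp add: q_def)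
    then show "l2norm L (e (Suc j)) \<le> q * l2norm L (e j) + B * (real j * q ^ j)"
      by (simp add: B_def algebra_simps power2_eq_square power3_eq_cube)
  qed simp
  \<comment> \<open>Return from base \<open>q\<close> to base \<open>\<theta>\<close>, at the cost
    of a constant factor; only here is the range of \<open>j\<close> used.\<close>
  also have "\<dots> \<le> (A\<^sup>2 + B) / \<theta> * ((real j)\<^sup>2 * (exp (C * (A + A\<^sup>2) / \<theta>) * \<theta> ^ j))"
    unfolding q_def using assms(2) \<theta> A_nonneg r(3) B
    by (intro mult_left_mono power_perturbation_bound) auto
  finally show ?thesis by (simp add: remainder_const_def B_def mult_ac)
qed

text \<open>The norms of \<open>u i\<close>, \<open>x i\<close>, \<open>e i\<close> carry the
  weights 1, \<open>i\<close>, \<open>i\<^sup>2\<close>. The terms over \<open>r\<^sup>2\<close>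
  have total degree two, and each further \<open>1 / r\<close> comes with one further degree, which
  the range of the indices turns into a factor \<open>(C + 1) * r\<close>. So all six terms have the
  same order.\<close>

lemma product_bound:
  assumes j: "1 \<le> j" "j \<le> k" and k: "real k \<le> C * r"
  shows "\<bar>(LINT t|L. v (Suc j) t * v k t)
      - ((LINT t|L. u (Suc j) t * u k t) + (LINT t|L. x (Suc j) t * u k t + u (Suc j) t * x k t) / r)\<bar>
    \<le> product_const A \<theta> C * ((real k)\<^sup>2 * \<theta> ^ (j + k)) / real n"
proof -
  define p where "p = Suc j"
  define G where "G = A + first_order_const A \<theta> + remainder_const A \<theta> (C + 1)"
  have C: "0 < C"
    using j k r(3) by (smt (verit) mult_nonpos_nonneg of_nat_0_less_iff le_trans less_le_trans zero_less_one)
  have nonneg: "0 \<le> first_order_const A \<theta>" "0 \<le> remainder_const A \<theta> (C + 1)"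
    using A_nonneg \<theta> by (simp_all add: first_order_const_def remainder_const_def)
  then have G: "0 \<le> G" using A_nonneg by (simp add: G_def)
  have p: "1 \<le> p" "real p \<le> (C + 1) * r" "real p \<le> 2 * real k" and k': "1 \<le> k" "real k \<le> (C + 1) * r"
  proof -
    have "real k + 1 \<le> C * r + 1 * r" using k r(1) by linarith
    then show "real p \<le> (C + 1) * r" "real k \<le> (C + 1) * r"
      using j by (simp_all add: p_def distrib_right)
  qed (use j in \<open>simp_all add: p_def\<close>)
  have U: "l2norm L (u i) \<le> G * \<theta> ^ i" for i
    by (rule order_trans[OF u(2)], subst mult.commute)
      (use \<theta> nonneg bounds(5) in \<open>auto simp: G_def intro!: mult_right_mono\<close>)
  have X: "l2norm L (x i) \<le> G * (real i * \<theta> ^ i)" if "1 \<le> i" for i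
    by (rule order_trans[OF x_bound[OF that]])
      (use \<theta> nonneg A_nonneg in \<open>auto simp: G_def intro!: mult_right_mono\<close>)
  have E: "l2norm L (e i) \<le> G * ((real i)\<^sup>2 * \<theta> ^ i)" if "1 \<le> i" "real i \<le> (C + 1) * r" for i
    by (rule order_trans[OF e_bound[OF that]])
      (use \<theta> nonneg A_nonneg in \<open>auto simp: G_def intro!: mult_right_mono\<close>)
  define W where "W = G\<^sup>2 * ((real k)\<^sup>2 * \<theta> ^ (p + k))"
  have W: "0 \<le> W" using \<theta> by (simp add: W_def)
  \<comment> \<open>Here \<open>a'\<close> and \<open>b'\<close> are the polynomial weights of the
    two factors, and \<open>c\<close> is what their product costs relative to \<open>k\<close>
    squared.\<close>
  have weight: "G * a * (G * b) \<le> c * W" if "a \<le> a' * \<theta> ^ p" "b \<le> b' * \<theta> ^ k" "a' * b' \<le> c * (real k)\<^sup>2"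
    "0 \<le> a'" "0 \<le> b" for a b a' b' c
  proof -
    have "G * a * (G * b) = G\<^sup>2 * (a * b)" by (simp add: power2_eq_square)
    also have "\<dots> \<le> G\<^sup>2 * ((a' * \<theta> ^ p) * (b' * \<theta> ^ k))"
      using that \<theta> by (intro mult_left_mono mult_mono) auto
    also have "\<dots> = G\<^sup>2 * (\<theta> ^ (p + k) * (a' * b'))" by (simp add: power_add mult_ac)
    also have "\<dots> \<le> G\<^sup>2 * (\<theta> ^ (p + k) * (c * (real k)\<^sup>2))"
      using that \<theta> by (intro mult_left_mono) auto
    finally show ?thesis by (simp add: W_def mult_ac)
  qed
  have cs: "\<bar>LINT t|L. f t * g t\<bar> \<le> a * b"
    if "sqint L f" "sqint L g" "l2norm L f \<le> a" "l2norm L g \<le> b" for f g a b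
    using l2_Cauchy_Schwarz[OF that(1,2)] mult_mono[OF that(3,4) order_trans[OF l2norm_nonneg that(3)]]
    by simp
  have pr: "real p / r \<le> C + 1" using p(2) r(3) by (simp add: pos_divide_le_eq)
  have 1: "\<bar>LINT t|L. x p t * x k t\<bar> \<le> 2 * W"
    by (rule order_trans[OF cs[OF x x X[OF p(1)] X[OF k'(1)]]], rule weight[OF order_refl order_refl])
      (use mult_right_mono[OF p(3), of "real k"] \<theta> in \<open>auto simp: power2_eq_square\<close>)
  have 2: "\<bar>LINT t|L. u p t * e k t\<bar> \<le> 1 * W"
    by (rule order_trans[OF cs[OF u(1) e U E[OF k']]], rule weight[where a' = 1 and b' = "(real k)\<^sup>2"])
      (use \<theta> in auto)
  have p2: "(real p)\<^sup>2 \<le> 4 * (real k)\<^sup>2"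
    using power_mono[OF p(3), of 2] by (simp add: power_mult_distrib)
  have 3: "\<bar>LINT t|L. e p t * u k t\<bar> \<le> 4 * W"
    by (rule order_trans[OF cs[OF e u(1) E[OF p(1,2)] U]], rule weight[where a' = "(real p)\<^sup>2" and b' = 1])
      (use p2 \<theta> in auto)
  \<comment> \<open>Degree three: the weight \<open>p\<close> of the first factor is traded for
    \<open>(C + 1) * r\<close>.\<close>
  have 4: "\<bar>LINT t|L. x p t * e k t\<bar> \<le> ((C + 1) * r) * W"
    by (rule order_trans[OF cs[OF x e X[OF p(1)] E[OF k']]], rule weight[OF order_refl order_refl])
      (use p(2) \<theta> in \<open>auto intro: mult_right_mono\<close>)
  have 5: "\<bar>LINT t|L. e p t * x k t\<bar> \<le> (2 * ((C + 1) * r)) * W"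
  proof (rule order_trans[OF cs[OF e x E[OF p(1,2)] X[OF k'(1)]]], rule weight[OF order_refl order_refl])
    \<comment> \<open>Of the two factors \<open>p\<close>, one is traded for
      \<open>(C + 1) * r\<close> and the other for \<open>2 * k\<close>.\<close>
    have "real p * real p \<le> ((C + 1) * r) * (2 * real k)" using p by (intro mult_mono) auto
    then have "real p * real p * real k \<le> ((C + 1) * r) * (2 * real k) * real k" by (rule mult_right_mono) simp
    then show "(real p)\<^sup>2 * real k \<le> (2 * ((C + 1) * r)) * (real k)\<^sup>2" by (simp add: power2_eq_square mult_ac)
  qed (use \<theta> in auto)
  have 6: "\<bar>LINT t|L. e p t * e k t\<bar> \<le> ((C + 1) * r)\<^sup>2 * W"
    by (rule order_trans[OF cs[OF e e E[OF p(1,2)] E[OF k']]], rule weight[OF order_refl order_refl])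
      (use p(2) \<theta> in \<open>auto intro!: mult_right_mono power_mono\<close>)
  have v: "v i t = u i t + x i t / r + e i t / r\<^sup>2" for i t
    using v_eq[of i t] by simp
  have "\<bar>(LINT t|L. v p t * v k t)
      - ((LINT t|L. u p t * u k t) + (LINT t|L. x p t * u k t + u p t * x k t) / r)\<bar>
    = \<bar>((LINT t|L. x p t * x k t) + (LINT t|L. u p t * e k t) + (LINT t|L. e p t * u k t)) / r\<^sup>2
       + ((LINT t|L. x p t * e k t) + (LINT t|L. e p t * x k t)) / r ^ 3 + (LINT t|L. e p t * e k t) / r ^ 4\<bar>"
    unfolding v using integral_expansion_product[OF u(1)[of p] u(1)[of k] x[of p] x[of k] e[of p] e[of k] r(4)]
    by presburger
  also have "\<dots> \<le> (2 * W + 1 * W + 4 * W) / r\<^sup>2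
      + (((C + 1) * r) * W + (2 * ((C + 1) * r)) * W) / r ^ 3 + (((C + 1) * r)\<^sup>2 * W) / r ^ 4"
  proof (intro order_trans[OF abs_triangle_ineq] add_mono)
    show "\<bar>((LINT t|L. x p t * x k t) + (LINT t|L. u p t * e k t) + (LINT t|L. e p t * u k t)) / r\<^sup>2\<bar>
        \<le> (2 * W + 1 * W + 4 * W) / r\<^sup>2"
      unfolding abs_divide using 1 2 3 r(3) by (intro frac_le) auto
    show "\<bar>((LINT t|L. x p t * e k t) + (LINT t|L. e p t * x k t)) / r ^ 3\<bar>
        \<le> (((C + 1) * r) * W + (2 * ((C + 1) * r)) * W) / r ^ 3"
    proof -
      have "\<bar>(LINT t|L. x p t * e k t) + (LINT t|L. e p t * x k t)\<bar>
          \<le> ((C + 1) * r) * W + (2 * ((C + 1) * r)) * W"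
        using 4 5 by linarith
      moreover have "0 \<le> r ^ 3" "\<bar>r ^ 3\<bar> = r ^ 3" using r(3) by simp_all
      ultimately show ?thesis unfolding abs_divide by (simp only: divide_right_mono)
    qed
    show "\<bar>(LINT t|L. e p t * e k t) / r ^ 4\<bar> \<le> (((C + 1) * r)\<^sup>2 * W) / r ^ 4"
      unfolding abs_divide using 6 r(3) by (intro frac_le) auto
  qed
  also have "\<dots> = W * (7 + 3 * (C + 1) + (C + 1)\<^sup>2) / r\<^sup>2"
  proof -
    have "(((C + 1) * r) * W + (2 * ((C + 1) * r)) * W) / r ^ 3 = 3 * (C + 1) * W / r\<^sup>2"
      using r(4) by (simp add: power3_eq_cube power2_eq_square divide_simps del: real_sqrt_mult_self real_sqrt_eq_zero_cancel_iff)
    moreover have "(((C + 1) * r)\<^sup>2 * W) / r ^ 4 = (C + 1)\<^sup>2 * W / r\<^sup>2"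
    proof -
      have "r ^ 4 = r\<^sup>2 * r\<^sup>2" by (simp only: power_add[symmetric]) simp
      then show ?thesis using r(5) by (simp add: power_mult_distrib)
    qed
    ultimately show ?thesis by (simp add: add_divide_distrib[symmetric] algebra_simps)
  qed
  \<comment> \<open>Since \<open>p = j + 1\<close>, one power of \<open>\<theta>\<close> is moved
    into \<open>product_const\<close>.\<close>
  also have "\<dots> = product_const A \<theta> C * ((real k)\<^sup>2 * \<theta> ^ (j + k)) / real n"
    unfolding r(2) by (simp add: W_def G_def product_const_def p_def mult_ac)
  finally show ?thesis by (simp only: p_def)
qed

end

section \<open>Second moments of independent sums, and Markov's inequality\<close>

lemma (in prob_space) square_expectation_le:
  fixes f :: "'a \<Rightarrow> real"
  assumes f: "f \<in> borel_measurable M"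
  shows "ennreal ((LINT \<omega>|M. f \<omega>)\<^sup>2) \<le> (\<integral>\<^sup>+\<omega>. ennreal ((f \<omega>)\<^sup>2) \<partial>M)"
proof (cases "(\<integral>\<^sup>+\<omega>. ennreal ((f \<omega>)\<^sup>2) \<partial>M) < \<infinity>")
  case True
  then have sq: "sqint M f" using f by (simp add: sqint_iff_nn_integral)
  \<comment> \<open>Cauchy-Schwarz against the constant 1; when the right side is infinite there is
    nothing to prove.\<close>
  have one: "sqint M (\<lambda>_. 1)" "l2norm M (\<lambda>_. 1) = 1" by (auto simp: sqint_def l2norm_def prob_space)
  have "\<bar>LINT \<omega>|M. f \<omega>\<bar> \<le> l2norm M f"
    using l2_Cauchy_Schwarz[OF sq one(1)] by (simp add: one(2))
  then have "(LINT \<omega>|M. f \<omega>)\<^sup>2 \<le> (l2norm M f)\<^sup>2" by (simp add: abs_le_square_iff[symmetric])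
  then show ?thesis by (simp add: nn_integral_square_eq[OF sq] ennreal_leI)
qed (simp add: not_less top_unique)

lemma (in prob_space) sqint_integrable:
  assumes "sqint M f"
  shows "integrable M f"
  using sqint_integrable_mult[OF assms, of "\<lambda>_. 1"] by (simp add: sqint_def)

text \<open>Independence and centring remove the cross terms, and each variance is at most the
  common second moment, computed on the population space \<open>P\<close>. The bound is therefore
  free of \<open>n\<close>.\<close>

lemma (in prob_space) iid_centred_sum_square:
  fixes W :: "nat \<Rightarrow> 'a \<Rightarrow> 'b" and W0 :: "'p \<Rightarrow> 'b" and g :: "'b \<Rightarrow> real"
  assumes W: "indep_vars (\<lambda>_. N) W {1..}"
    and W0: "W0 \<in> measurable P N"
    and distr: "\<And>i. 1 \<le> i \<Longrightarrow> distr M N (W i) = distr P N W0"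
    and g: "g \<in> borel_measurable N"
  shows "(\<integral>\<^sup>+\<omega>. ennreal (((\<Sum>i=1..n. centred M (\<lambda>\<omega>. g (W i \<omega>)) \<omega>) / sqrt (real n))\<^sup>2) \<partial>M)
      \<le> (\<integral>\<^sup>+\<omega>. ennreal ((g (W0 \<omega>))\<^sup>2) \<partial>P)"
\<comment> \<open>For \<open>n = 0\<close> the quotient is 0, as division by zero yields 0; an
  infinite right side is trivial.\<close>
proof (cases "n = 0 \<or> (\<integral>\<^sup>+\<omega>. ennreal ((g (W0 \<omega>))\<^sup>2) \<partial>P) = \<infinity>")
  case False
  define Y where "Y i = centred M (\<lambda>\<omega>. g (W i \<omega>))" for i
  define s where "s = (\<integral>\<^sup>+\<omega>. ennreal ((g (W0 \<omega>))\<^sup>2) \<partial>P)"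
  have W_meas: "W i \<in> measurable M N" if "1 \<le> i" for i
    using W that by (auto simp: indep_vars_def)
  note [measurable] = g W0
  have V: "sqint M (\<lambda>\<omega>. g (W i \<omega>))" "(LINT \<omega>|M. (g (W i \<omega>))\<^sup>2) = enn2real s" if "1 \<le> i" for i
  proof -
    note [measurable] = W_meas[OF that]
    have "(\<integral>\<^sup>+\<omega>. ennreal ((g (W i \<omega>))\<^sup>2) \<partial>M) = (\<integral>\<^sup>+z. ennreal ((g z)\<^sup>2) \<partial>distr M N (W i))"
      by (subst nn_integral_distr) auto
    also have "\<dots> = s"
      unfolding distr[OF that] s_def by (subst nn_integral_distr) auto
    finally have *: "(\<integral>\<^sup>+\<omega>. ennreal ((g (W i \<omega>))\<^sup>2) \<partial>M) = s" .
    then show "sqint M (\<lambda>\<omega>. g (W i \<omega>))"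
      using False by (subst sqint_iff_nn_integral) (auto simp: s_def less_top)
    show "(LINT \<omega>|M. (g (W i \<omega>))\<^sup>2) = enn2real s"
      by (subst integral_eq_nn_integral) (auto simp: *)
  qed
  have Y: "sqint M (Y i)" "integrable M (Y i)" "(LINT \<omega>|M. Y i \<omega>) = 0" "(LINT \<omega>|M. (Y i \<omega>)\<^sup>2) \<le> enn2real s"
    if "1 \<le> i" for i
  proof -
    define c where "c = (LINT \<omega>|M. g (W i \<omega>))"
    have Yc: "Y i = (\<lambda>\<omega>. g (W i \<omega>) - c)" by (simp add: Y_def centred_def fun_eq_iff c_def)
    note int = sqint_integrable[OF V(1)[OF that]] sqint_integrable_square[OF V(1)[OF that]]
    show sq: "sqint M (Y i)" unfolding Yc by (intro sqint_diff V that) (simp add: sqint_def)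
    show "integrable M (Y i)" "(LINT \<omega>|M. Y i \<omega>) = 0"
      unfolding Yc using int by (simp_all add: c_def prob_space)
    have "(LINT \<omega>|M. (Y i \<omega>)\<^sup>2) = (LINT \<omega>|M. (g (W i \<omega>))\<^sup>2 + c\<^sup>2 - 2 * c * g (W i \<omega>))"
      unfolding Yc by (intro Bochner_Integration.integral_cong) (auto simp: power2_diff)
    also have "\<dots> = enn2real s - c\<^sup>2"
      using int by (simp add: V(2)[OF that] prob_space c_def[symmetric]) (simp add: power2_eq_square)
    finally show "(LINT \<omega>|M. (Y i \<omega>)\<^sup>2) \<le> enn2real s" by simp
  qed
  have indep: "indep_vars (\<lambda>_. borel) Y {1..}"
    unfolding Y_def centred_def[abs_def] by (rule indep_vars_compose2[OF W]) measurable
  have orth: "(LINT \<omega>|M. Y i \<omega> * Y j \<omega>) = 0" if "1 \<le> i" "1 \<le> j" "i \<noteq> j" for i j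
  proof -
    have "(LINT \<omega>|M. (\<Prod>k\<in>{i, j}. Y k \<omega>)) = (\<Prod>k\<in>{i, j}. LINT \<omega>|M. Y k \<omega>)"
      using that Y(2) by (intro indep_vars_lebesgue_integral indep_vars_subset[OF indep]) auto
    then show ?thesis using that Y(3) by simp
  qed
  have S: "sqint M (\<lambda>\<omega>. (\<Sum>i=1..n. Y i \<omega>) / sqrt (real n))"
    by (intro sqint_divide sqint_sum Y) simp
  have "(LINT \<omega>|M. (\<Sum>i=1..n. Y i \<omega>)\<^sup>2) = (LINT \<omega>|M. (\<Sum>i=1..n. \<Sum>j=1..n. Y i \<omega> * Y j \<omega>))"
    by (simp add: power2_eq_square sum_product)
  also have "\<dots> = (\<Sum>i=1..n. \<Sum>j=1..n. LINT \<omega>|M. Y i \<omega> * Y j \<omega>)"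
  proof -
    have "integrable M (\<lambda>\<omega>. Y i \<omega> * Y j \<omega>)" if "i \<in> {1..n}" "j \<in> {1..n}" for i j
      using that by (intro sqint_integrable_mult Y) auto
    then show ?thesis by (simp add: Bochner_Integration.integral_sum del: atLeastAtMost_iff One_nat_def)
  qed
  also have "\<dots> = (\<Sum>i=1..n. \<Sum>j=1..n. if i = j then LINT \<omega>|M. (Y i \<omega>)\<^sup>2 else 0)"
    by (intro sum.cong refl) (auto simp: orth power2_eq_square)
  also have "\<dots> = (\<Sum>i=1..n. LINT \<omega>|M. (Y i \<omega>)\<^sup>2)"
    by (intro sum.cong refl) (simp add: sum.delta)
  also have "\<dots> \<le> real n * enn2real s"
    using sum_mono[of "{1..n}" "\<lambda>i. LINT \<omega>|M. (Y i \<omega>)\<^sup>2" "\<lambda>_. enn2real s"] Y(4) by simp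
  finally have le: "(LINT \<omega>|M. (\<Sum>i=1..n. Y i \<omega>)\<^sup>2) \<le> real n * enn2real s" .
  have "(l2norm M (\<lambda>\<omega>. (\<Sum>i=1..n. Y i \<omega>) / sqrt (real n)))\<^sup>2 = (LINT \<omega>|M. (\<Sum>i=1..n. Y i \<omega>)\<^sup>2) / real n"
    by (simp add: l2norm_square power_divide)
  also have "\<dots> \<le> enn2real s" using le False by (simp add: divide_le_eq mult.commute)
  finally have bound: "(l2norm M (\<lambda>\<omega>. (\<Sum>i=1..n. Y i \<omega>) / sqrt (real n)))\<^sup>2 \<le> enn2real s" .
  have "s = ennreal (enn2real s)" using False by (simp add: s_def less_top)
  then have "ennreal ((l2norm M (\<lambda>\<omega>. (\<Sum>i=1..n. Y i \<omega>) / sqrt (real n)))\<^sup>2) \<le> s"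
    using ennreal_leI[OF bound] by simp
  then show ?thesis
    unfolding nn_integral_square_eq[OF S, symmetric] by (simp add: Y_def s_def)
qed auto

text \<open>Markov's inequality for \<open>Q\<close>, whose mean is bounded uniformly in
  \<open>n\<close>: where \<open>Q n\<close> is at most \<open>B\<close>, \<open>Z n\<close> is at
  most \<open>B'\<close>. Measurability of \<open>Z n\<close> is assumed because
  \<open>bounded_in_prob\<close> demands it explicitly.\<close>

lemma (in prob_space) bounded_in_probI:
  fixes Z Q :: "nat \<Rightarrow> 'a \<Rightarrow> ennreal"
  assumes Q: "\<And>n. 1 \<le> n \<Longrightarrow> Q n \<in> borel_measurable M"
    and mean: "\<And>n. 1 \<le> n \<Longrightarrow> (\<integral>\<^sup>+\<omega>. Q n \<omega> \<partial>M) \<le> G" and G: "G < \<infinity>"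
    and Z: "\<And>n. 1 \<le> n \<Longrightarrow> Z n \<in> borel_measurable M"
    and bound: "\<And>B::real. 0 < B \<Longrightarrow> \<exists>B'. \<forall>n\<ge>1. \<forall>\<omega>\<in>space M. Q n \<omega> \<le> ennreal B \<longrightarrow> Z n \<omega> \<le> ennreal B'"
  shows "bounded_in_prob M Z"
  unfolding bounded_in_prob_def
proof (intro allI impI)
  fix d :: real assume d: "0 < d"
  define g where "g = enn2real G"
  have g: "G = ennreal g" "0 \<le> g" using G by (simp_all add: g_def)
  \<comment> \<open>Chosen so that \<open>g / B \<le> d\<close>; the summand 1 keeps
    \<open>B\<close> positive when \<open>g = 0\<close>.\<close>
  define B where "B = (g + 1) / d"
  have B: "0 < B" using d g by (simp add: B_def)
  obtain B' where B': "\<And>n \<omega>. 1 \<le> n \<Longrightarrow> \<omega> \<in> space M \<Longrightarrow> Q n \<omega> \<le> ennreal B \<Longrightarrow> Z n \<omega> \<le> ennreal B'"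
    using bound[OF B] by blast
  have "{\<omega> \<in> space M. ennreal B' < Z n \<omega>} \<in> sets M \<and> measure M {\<omega> \<in> space M. ennreal B' < Z n \<omega>} \<le> d"
    if n: "1 \<le> n" for n
  proof
    note [measurable] = Q[OF n] Z[OF n]
    show "{\<omega> \<in> space M. ennreal B' < Z n \<omega>} \<in> sets M" by measurable
    have 1: "1 \<le> ennreal (1 / B) * q" if "ennreal B < q" for q
    proof -
      have "1 = ennreal (1 / B) * ennreal B" using B by (simp flip: ennreal_mult)
      also have "\<dots> \<le> ennreal (1 / B) * q" using that by (intro mult_left_mono) auto
      finally show ?thesis .
    qed
    have "emeasure M {\<omega> \<in> space M. ennreal B' < Z n \<omega>} \<le> emeasure M {\<omega> \<in> space M. 1 \<le> ennreal (1 / B) * Q n \<omega>}"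
      using B'[OF n] by (intro emeasure_mono) (auto intro!: 1 simp: not_le[symmetric])
    also have "\<dots> \<le> ennreal (1 / B) * (\<integral>\<^sup>+\<omega>. Q n \<omega> * indicator (space M) \<omega> \<partial>M)"
      by (rule nn_integral_Markov_inequality) auto
    also have "(\<integral>\<^sup>+\<omega>. Q n \<omega> * indicator (space M) \<omega> \<partial>M) = (\<integral>\<^sup>+\<omega>. Q n \<omega> \<partial>M)"
      by (intro nn_integral_cong) simp
    also have "ennreal (1 / B) * \<dots> \<le> ennreal (1 / B) * ennreal g"
      using mean[OF n] by (intro mult_left_mono) (auto simp: g)
    also have "\<dots> = ennreal (g / B)" using B g by (simp flip: ennreal_mult)
    also have "g / B \<le> d"
    proof -
      have "g * d \<le> d * (g + 1)" using d by (simp add: algebra_simps)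
      then show ?thesis using d g by (simp add: B_def divide_le_eq)
    qed
    finally have "emeasure M {\<omega> \<in> space M. ennreal B' < Z n \<omega>} \<le> ennreal d" by (simp add: ennreal_leI)
    then show "measure M {\<omega> \<in> space M. ennreal B' < Z n \<omega>} \<le> d"
      using d by (simp add: emeasure_eq_measure)
  qed
  then show "\<exists>B. \<forall>\<^sub>F n in sequentially. {\<omega> \<in> space M. ennreal B < Z n \<omega>} \<in> sets M \<and>
      measure M {\<omega> \<in> space M. ennreal B < Z n \<omega>} \<le> d"
    by (intro exI[of _ B'] eventually_sequentiallyI[of 1]) blast
qed

section \<open>The population: moments of the centred process and the normal equation\<close>

lemma measurable_sample_path:
  assumes "random_function M I X" "space (lebesgue_on I) = I"
  shows "sample_path I X \<in> measurable M (path_space I)"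
    and "t \<in> I \<Longrightarrow> (\<lambda>\<omega>. X \<omega> t) \<in> borel_measurable M"
proof -
  have X: "(\<lambda>\<omega>. X \<omega> t) \<in> borel_measurable M" if "t \<in> I" for t
    using measurable_compose[OF measurable_Pair2', of t "lebesgue_on I" "\<lambda>(\<omega>, t). X \<omega> t" M borel] assms that
    by (simp add: random_function_def)
  then show "t \<in> I \<Longrightarrow> (\<lambda>\<omega>. X \<omega> t) \<in> borel_measurable M" .
  show "sample_path I X \<in> measurable M (path_space I)"
    unfolding sample_path_def[abs_def] restrict_def by (intro measurable_restrict[unfolded restrict_def] X)
qed

lemma nn_integral_bounded_by_integrable:
  fixes g :: "'a \<Rightarrow> real"
  assumes "integrable M g" "AE \<omega> in M. f \<omega> \<le> ennreal (g \<omega>)"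
  shows "(\<integral>\<^sup>+\<omega>. f \<omega> \<partial>M) < \<infinity>"
proof -
  have "(\<integral>\<^sup>+\<omega>. f \<omega> \<partial>M) \<le> (\<integral>\<^sup>+\<omega>. ennreal (norm (g \<omega>)) \<partial>M)"
    using assms(2) by (intro nn_integral_mono_AE) (auto elim!: eventually_mono order_trans intro!: ennreal_leI)
  also have "\<dots> < \<infinity>" using assms(1) by (simp add: integrable_iff_bounded)
  finally show ?thesis .
qed

locale functional_regression = lmeasurable_domain I + P: prob_space P
  for I :: "real set" and P :: "'p measure" +
  fixes X :: "'p \<Rightarrow> real \<Rightarrow> real" and Y \<epsilon> :: "'p \<Rightarrow> real" and b :: "real \<Rightarrow> real" and a :: real
  assumes X_random: "random_function P I X"
    and X_square: "(\<integral>\<^sup>+ t. (\<integral>\<^sup>+ \<omega>. ennreal ((X \<omega> t)\<^sup>2) \<partial>P) \<partial>lebesgue_on I) < \<infinity>"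
    and X_fourth: "integrable P (\<lambda>\<omega>. fun_norm I (X \<omega>) ^ 4)"
    and b: "sqint (lebesgue_on I) b"
    and eps_random: "\<epsilon> \<in> borel_measurable P"
    and eps_square: "integrable P (\<lambda>\<omega>. (\<epsilon> \<omega>)\<^sup>2)"
    and eps_cond: "AE \<omega> in P. real_cond_exp P (sigma_gen_path P I X) \<epsilon> \<omega> = 0"
    and X_eps_square: "integrable P (\<lambda>\<omega>. (fun_norm I (X \<omega>))\<^sup>2 * (\<epsilon> \<omega>)\<^sup>2)"
    and Y_random: "Y \<in> borel_measurable P"
    and model: "AE \<omega> in P. Y \<omega> = a + (LINT t|lebesgue_on I. b t * X \<omega> t) + \<epsilon> \<omega>"
begin

sublocale PL: pair_sigma_finite P L ..

abbreviation "\<mu> \<equiv> mean_fun P X"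
abbreviation "K \<equiv> cov_fun P X"

definition Z :: "'p \<Rightarrow> real \<Rightarrow> real" where "Z \<omega> t = X \<omega> t - \<mu> t"
definition W :: "'p \<Rightarrow> real" where "W \<omega> = (fun_norm I (X \<omega>))\<^sup>2"

lemma space_L: "space L = I"
  by simp

lemma X_meas[measurable]: "(\<lambda>(\<omega>, t). X \<omega> t) \<in> borel_measurable (P \<Otimes>\<^sub>M L)"
  using X_random by (simp add: random_function_def)

declare eps_random[measurable] Y_random[measurable]

lemma mu_meas[measurable]: "\<mu> \<in> borel_measurable L"
  unfolding mean_fun_def[abs_def] by measurable

lemma Z_meas[measurable]: "(\<lambda>(\<omega>, t). Z \<omega> t) \<in> borel_measurable (P \<Otimes>\<^sub>M L)"
  unfolding Z_def by measurable

lemma Z_section: "t \<in> I \<Longrightarrow> (\<lambda>\<omega>. Z \<omega> t) \<in> borel_measurable P"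
  unfolding Z_def using measurable_sample_path(2)[OF X_random space_L] by measurable

lemma X_path: "\<omega> \<in> space P \<Longrightarrow> X \<omega> \<in> borel_measurable L"
  using measurable_compose[OF measurable_Pair1', of \<omega> P "\<lambda>(\<omega>, t). X \<omega> t" L borel] X_meas by simp

lemma K_eq: "K s t = (LINT \<omega>|P. Z \<omega> s * Z \<omega> t)"
  by (simp add: cov_fun_def Z_def)

lemma K_meas: "(\<lambda>(s, t). K s t) \<in> borel_measurable (L \<Otimes>\<^sub>M L)"
  unfolding K_eq by measurable

lemma X_sqint: "AE \<omega> in P. sqint L (X \<omega>)"
proof -
  have "(\<integral>\<^sup>+\<omega>. (\<integral>\<^sup>+t. ennreal ((X \<omega> t)\<^sup>2) \<partial>L) \<partial>P) < \<infinity>"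
    using X_square by (subst PL.Fubini'[symmetric]) auto
  then have "AE \<omega> in P. (\<integral>\<^sup>+t. ennreal ((X \<omega> t)\<^sup>2) \<partial>L) \<noteq> \<infinity>"
    by (intro nn_integral_PInf_AE) auto
  then show ?thesis
    using AE_space by eventually_elim (simp add: sqint_iff_nn_integral X_path less_top)
qed

lemma W_meas[measurable]: "W \<in> borel_measurable P"
  unfolding W_def[abs_def] fun_norm_def by measurable

lemma W_int: "integrable P (\<lambda>\<omega>. (W \<omega>)\<^sup>2)" "integrable P W" "integrable P (\<lambda>\<omega>. W \<omega> * (\<epsilon> \<omega>)\<^sup>2)"
proof -
  show *: "integrable P (\<lambda>\<omega>. (W \<omega>)\<^sup>2)" using X_fourth by (simp add: W_def)
  show "integrable P W" by (rule P.sqint_integrable) (simp add: sqint_def *)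
  show "integrable P (\<lambda>\<omega>. W \<omega> * (\<epsilon> \<omega>)\<^sup>2)" using X_eps_square by (simp add: W_def)
qed

lemma W_nonneg: "0 \<le> W \<omega>" by (simp add: W_def)

lemma mu: "sqint L \<mu>"
proof (subst sqint_iff_nn_integral)
  have "(\<integral>\<^sup>+t. ennreal ((\<mu> t)\<^sup>2) \<partial>L) \<le> (\<integral>\<^sup>+t. (\<integral>\<^sup>+\<omega>. ennreal ((X \<omega> t)\<^sup>2) \<partial>P) \<partial>L)"
    unfolding mean_fun_def using measurable_sample_path(2)[OF X_random space_L]
    by (intro nn_integral_mono P.square_expectation_le) simp
  then show "(\<integral>\<^sup>+t. ennreal ((\<mu> t)\<^sup>2) \<partial>L) < \<infinity>" using X_square by simp
qed measurable

definition c\<mu> :: real where "c\<mu> = (l2norm L \<mu>)\<^sup>2"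

text \<open>From \<open>(p + q)\<^sup>2 \<le> 2 * p\<^sup>2 + 2 * q\<^sup>2\<close>. It reduces the
  moments of the centred process to those of \<open>W\<close>, which is integrable together with its
  square.\<close>

lemma Z_nn: "AE \<omega> in P. sqint L (Z \<omega>) \<and> (\<integral>\<^sup>+t. ennreal ((Z \<omega> t)\<^sup>2) \<partial>L) \<le> ennreal (2 * W \<omega> + 2 * c\<mu>)"
  using X_sqint
proof eventually_elim
  case (elim \<omega>)
  have Z: "sqint L (Z \<omega>)" unfolding Z_def[abs_def] by (intro sqint_diff elim mu)
  have "(l2norm L (Z \<omega>))\<^sup>2 \<le> (l2norm L (X \<omega>) + l2norm L \<mu>)\<^sup>2"
    unfolding Z_def[abs_def] by (intro power_mono l2norm_triangle_diff elim mu) simp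
  also have "\<dots> \<le> 2 * W \<omega> + 2 * c\<mu>"
    using sum_squares_bound[of "l2norm L (X \<omega>)" "l2norm L \<mu>"]
    by (simp add: W_def fun_norm_eq c\<mu>_def power2_sum)
  finally show ?case using Z by (simp add: nn_integral_square_eq ennreal_leI)
qed

lemma Z_square: "(\<integral>\<^sup>+\<omega>. (\<integral>\<^sup>+t. ennreal ((Z \<omega> t)\<^sup>2) \<partial>L) \<partial>P) < \<infinity>"
  by (rule nn_integral_bounded_by_integrable[where g = "\<lambda>\<omega>. 2 * W \<omega> + 2 * c\<mu>"])
    (use Z_nn W_int in auto)

lemma Z_square': "(\<integral>\<^sup>+t. (\<integral>\<^sup>+\<omega>. ennreal ((Z \<omega> t)\<^sup>2) \<partial>P) \<partial>L) < \<infinity>"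
  using Z_square by (subst PL.Fubini') auto

lemma Z_sqint: "AE t in L. sqint P (\<lambda>\<omega>. Z \<omega> t)"
proof -
  have "AE t in L. (\<integral>\<^sup>+\<omega>. ennreal ((Z \<omega> t)\<^sup>2) \<partial>P) \<noteq> \<infinity>"
    using Z_square' by (intro nn_integral_PInf_AE) auto
  then show ?thesis
    using AE_space by eventually_elim (simp add: sqint_iff_nn_integral Z_section less_top)
qed

lemma Z_mean:
  assumes "sqint P (\<lambda>\<omega>. Z \<omega> t)"
  shows "(LINT \<omega>|P. Z \<omega> t) = 0"
proof -
  \<comment> \<open>This makes \<open>X\<close> integrable at \<open>t\<close>, so that
    \<open>\<mu> t\<close> is a true mean and not the default value 0.\<close>
  have "integrable P (\<lambda>\<omega>. Z \<omega> t + \<mu> t)" using P.sqint_integrable[OF assms] by simp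
  then show ?thesis unfolding Z_def by (simp add: mean_fun_def P.prob_space)
qed

text \<open>After exchanging the integrals, the inner double integral is the fourth power of the
  norm of the centred path; this is where the fourth moment of the norm of \<open>X\<close> enters.
  The bound serves both \<open>K\<close> and the second moment of \<open>\<xi>\<close>.\<close>

lemma ZZ_square:
  "(\<integral>\<^sup>+s. \<integral>\<^sup>+t. \<integral>\<^sup>+\<omega>. ennreal ((Z \<omega> s * Z \<omega> t)\<^sup>2) \<partial>P \<partial>L \<partial>L) < \<infinity>"
proof -
  have "(\<integral>\<^sup>+s. \<integral>\<^sup>+t. \<integral>\<^sup>+\<omega>. ennreal ((Z \<omega> s * Z \<omega> t)\<^sup>2) \<partial>P \<partial>L \<partial>L)
      = (\<integral>\<^sup>+s. \<integral>\<^sup>+\<omega>. \<integral>\<^sup>+t. ennreal ((Z \<omega> s * Z \<omega> t)\<^sup>2) \<partial>L \<partial>P \<partial>L)"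
    by (intro nn_integral_cong PL.Fubini') (use Z_section in measurable)
  also have "\<dots> = (\<integral>\<^sup>+\<omega>. \<integral>\<^sup>+s. \<integral>\<^sup>+t. ennreal ((Z \<omega> s * Z \<omega> t)\<^sup>2) \<partial>L \<partial>L \<partial>P)"
    by (intro PL.Fubini') measurable
  also have "\<dots> < \<infinity>"
  proof (rule nn_integral_bounded_by_integrable)
    show "integrable P (\<lambda>\<omega>. (2 * W \<omega> + 2 * c\<mu>)\<^sup>2)"
      using W_int by (simp add: power2_sum power_mult_distrib)
    show "AE \<omega> in P. (\<integral>\<^sup>+s. \<integral>\<^sup>+t. ennreal ((Z \<omega> s * Z \<omega> t)\<^sup>2) \<partial>L \<partial>L) \<le> ennreal ((2 * W \<omega> + 2 * c\<mu>)\<^sup>2)"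
      using Z_nn
    proof eventually_elim
      case (elim \<omega>)
      have [measurable]: "Z \<omega> \<in> borel_measurable L" using elim sqint_measurable by blast
      have "(\<integral>\<^sup>+s. \<integral>\<^sup>+t. ennreal ((Z \<omega> s * Z \<omega> t)\<^sup>2) \<partial>L \<partial>L)
          = (\<integral>\<^sup>+t. ennreal ((Z \<omega> t)\<^sup>2) \<partial>L) * (\<integral>\<^sup>+t. ennreal ((Z \<omega> t)\<^sup>2) \<partial>L)"
        by (simp add: power_mult_distrib ennreal_mult nn_integral_cmult nn_integral_multc)
      also have "\<dots> \<le> ennreal (2 * W \<omega> + 2 * c\<mu>) * ennreal (2 * W \<omega> + 2 * c\<mu>)"
        using elim by (intro mult_mono) auto
      finally show ?case
        using W_nonneg[of \<omega>] by (simp add: power2_eq_square ennreal_mult c\<mu>_def)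
    qed
  qed
  finally show ?thesis .
qed

lemma K_sqker: "sqker K"
  unfolding sqker_def
proof (subst sqint_iff_nn_integral)
  show "(\<lambda>(s, t). K s t) \<in> borel_measurable (L \<Otimes>\<^sub>M L)" by (rule K_meas)
  have "(\<integral>\<^sup>+p. ennreal ((case p of (s, t) \<Rightarrow> K s t)\<^sup>2) \<partial>(L \<Otimes>\<^sub>M L)) = (\<integral>\<^sup>+s. \<integral>\<^sup>+t. ennreal ((K s t)\<^sup>2) \<partial>L \<partial>L)"
    using K_meas by (subst nn_integral_fst[symmetric]) auto
  also have "\<dots> \<le> (\<integral>\<^sup>+s. \<integral>\<^sup>+t. \<integral>\<^sup>+\<omega>. ennreal ((Z \<omega> s * Z \<omega> t)\<^sup>2) \<partial>P \<partial>L \<partial>L)"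
    unfolding K_eq using Z_section
    by (intro nn_integral_mono P.square_expectation_le borel_measurable_times) auto
  finally show "(\<integral>\<^sup>+p. ennreal ((case p of (s, t) \<Rightarrow> K s t)\<^sup>2) \<partial>(L \<Otimes>\<^sub>M L)) < \<infinity>"
    using ZZ_square by (rule le_less_trans)
qed

text \<open>The shift \<open>c\<close> is 0 for the second moment of \<open>Y\<close> and the mean
  of \<open>Y\<close> for \<open>\<xi>\<^sub>0\<close>.\<close>

lemma Y_square_bound:
  "AE \<omega> in P. (Y \<omega> - c)\<^sup>2 \<le> 3 * ((a - c)\<^sup>2 + (l2norm L b)\<^sup>2 * W \<omega> + (\<epsilon> \<omega>)\<^sup>2)"
  using X_sqint model
proof eventually_elim
  case (elim \<omega>)
  define B where "B = (LINT t|L. b t * X \<omega> t)"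
  have "\<bar>B\<bar> \<le> l2norm L b * l2norm L (X \<omega>)" unfolding B_def by (rule l2_Cauchy_Schwarz[OF b elim(1)])
  then have "B\<^sup>2 \<le> (l2norm L b * l2norm L (X \<omega>))\<^sup>2" by (simp add: abs_le_square_iff[symmetric])
  then have B: "B\<^sup>2 \<le> (l2norm L b)\<^sup>2 * W \<omega>" by (simp add: W_def fun_norm_eq power_mult_distrib)
  have three: "(p + q + r)\<^sup>2 \<le> 3 * (p\<^sup>2 + q\<^sup>2 + r\<^sup>2)" for p q r :: real
    using sum_squares_bound[of p q] sum_squares_bound[of p r] sum_squares_bound[of q r]
    by (simp add: power2_eq_square algebra_simps)
  have "(Y \<omega> - c)\<^sup>2 = ((a - c) + B + \<epsilon> \<omega>)\<^sup>2" by (simp add: elim(2) B_def algebra_simps)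
  also have "\<dots> \<le> 3 * ((a - c)\<^sup>2 + B\<^sup>2 + (\<epsilon> \<omega>)\<^sup>2)" by (rule three)
  also have "\<dots> \<le> 3 * ((a - c)\<^sup>2 + (l2norm L b)\<^sup>2 * W \<omega> + (\<epsilon> \<omega>)\<^sup>2)" using B by simp
  finally show ?case .
qed

lemma Y_sqint: "sqint P Y"
proof (subst sqint_iff_nn_integral)
  show "(\<integral>\<^sup>+\<omega>. ennreal ((Y \<omega>)\<^sup>2) \<partial>P) < \<infinity>"
  proof (rule nn_integral_bounded_by_integrable)
    show "integrable P (\<lambda>\<omega>. 3 * ((a - 0)\<^sup>2 + (l2norm L b)\<^sup>2 * W \<omega> + (\<epsilon> \<omega>)\<^sup>2))"
      using W_int eps_square by simp
    show "AE \<omega> in P. ennreal ((Y \<omega>)\<^sup>2) \<le> ennreal (3 * ((a - 0)\<^sup>2 + (l2norm L b)\<^sup>2 * W \<omega> + (\<epsilon> \<omega>)\<^sup>2))"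
      using Y_square_bound[of 0] by eventually_elim (simp only: diff_zero ennreal_leI)
  qed
qed measurable

text \<open>The product of the bounds for the centred path and for \<open>Y\<close> contains the
  mixed term \<open>W \<omega> * (\<epsilon> \<omega>)\<^sup>2\<close>, whose integrability is the
  assumption \<open>X_eps_square\<close>.\<close>

lemma ZY_square: "(\<integral>\<^sup>+t. \<integral>\<^sup>+\<omega>. ennreal ((Z \<omega> t * (Y \<omega> - c))\<^sup>2) \<partial>P \<partial>L) < \<infinity>"
proof -
  define D where "D \<omega> = 3 * ((a - c)\<^sup>2 + (l2norm L b)\<^sup>2 * W \<omega> + (\<epsilon> \<omega>)\<^sup>2)" for \<omega>
  have D: "0 \<le> D \<omega>" for \<omega> using W_nonneg[of \<omega>] by (simp add: D_def)
  have "(\<integral>\<^sup>+t. \<integral>\<^sup>+\<omega>. ennreal ((Z \<omega> t * (Y \<omega> - c))\<^sup>2) \<partial>P \<partial>L)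
      = (\<integral>\<^sup>+\<omega>. \<integral>\<^sup>+t. ennreal ((Z \<omega> t * (Y \<omega> - c))\<^sup>2) \<partial>L \<partial>P)"
    by (intro PL.Fubini') measurable
  also have "\<dots> < \<infinity>"
  proof (rule nn_integral_bounded_by_integrable)
    have "(\<lambda>\<omega>. (2 * W \<omega> + 2 * c\<mu>) * D \<omega>) = (\<lambda>\<omega>. 6 * (l2norm L b)\<^sup>2 * (W \<omega>)\<^sup>2
        + (6 * (a - c)\<^sup>2 + 6 * c\<mu> * (l2norm L b)\<^sup>2) * W \<omega> + 6 * (W \<omega> * (\<epsilon> \<omega>)\<^sup>2)
        + 6 * c\<mu> * (\<epsilon> \<omega>)\<^sup>2 + 6 * c\<mu> * (a - c)\<^sup>2)"
      by (simp add: D_def fun_eq_iff algebra_simps power2_eq_square)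
    then show "integrable P (\<lambda>\<omega>. (2 * W \<omega> + 2 * c\<mu>) * D \<omega>)"
      using W_int eps_square by simp
    show "AE \<omega> in P. (\<integral>\<^sup>+t. ennreal ((Z \<omega> t * (Y \<omega> - c))\<^sup>2) \<partial>L) \<le> ennreal ((2 * W \<omega> + 2 * c\<mu>) * D \<omega>)"
      using Z_nn Y_square_bound[of c]
    proof eventually_elim
      case (elim \<omega>)
      have [measurable]: "Z \<omega> \<in> borel_measurable L" using elim sqint_measurable by blast
      have "(\<integral>\<^sup>+t. ennreal ((Z \<omega> t * (Y \<omega> - c))\<^sup>2) \<partial>L)
          = (\<integral>\<^sup>+t. ennreal ((Z \<omega> t)\<^sup>2) \<partial>L) * ennreal ((Y \<omega> - c)\<^sup>2)"
        by (simp add: power_mult_distrib ennreal_mult nn_integral_multc)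
      also have "\<dots> \<le> ennreal (2 * W \<omega> + 2 * c\<mu>) * ennreal (D \<omega>)"
        using elim by (intro mult_mono ennreal_leI) (auto simp: D_def)
      finally show ?case
        using W_nonneg[of \<omega>] D[of \<omega>] by (simp add: ennreal_mult c\<mu>_def)
    qed
  qed
  finally show ?thesis .
qed

text \<open>A coordinate of the path is measurable for the sigma-algebra generated by the path, so
  \<open>\<epsilon>\<close> may be replaced by its conditional expectation, which is 0.\<close>

lemma Z_eps_orthogonal:
  assumes t: "t \<in> I" and Z: "sqint P (\<lambda>\<omega>. Z \<omega> t)"
  shows "(LINT \<omega>|P. Z \<omega> t * \<epsilon> \<omega>) = 0"
proof -
  define F where "F = sigma_gen_path P I X"
  note path = measurable_sample_path(1)[OF X_random space_L]
  have "subalgebra P F"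
    using path unfolding subalgebra_def F_def sigma_gen_path_def
    by (simp add: in_vimage_algebra sets_vimage_algebra2 measurable_space measurable_sets) 
      (auto simp: sets_vimage_algebra2[OF funcsetI] measurable_space measurable_sets)
  then interpret finite_measure_subalgebra P F by unfold_locales
  have "sample_path I X \<in> measurable F (path_space I)"
    unfolding F_def sigma_gen_path_def
    using path by (intro measurable_vimage_algebra1) (auto dest: measurable_space)
  then have "(\<lambda>\<omega>. sample_path I X \<omega> t) \<in> borel_measurable F"
    using t by (rule measurable_compose[OF _ measurable_component_singleton])
  then have Z_meas: "(\<lambda>\<omega>. Z \<omega> t) \<in> borel_measurable F"
    using t by (simp add: sample_path_def Z_def)
  have "(LINT \<omega>|P. Z \<omega> t * \<epsilon> \<omega>) = (LINT \<omega>|P. Z \<omega> t * real_cond_exp P F \<epsilon> \<omega>)"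
    using Z eps_square
    by (intro real_cond_exp_intg(2)[symmetric] sqint_integrable_mult Z_meas) (auto simp: sqint_def)
  also have "\<dots> = (LINT \<omega>|P. 0)"
    using eps_cond Z_section[OF t] by (intro integral_cong_AE) (auto simp: F_def)
  finally show ?thesis by simp
qed

text \<open>Insert the model for \<open>Y\<close>: the noise drops out by orthogonality, all
  constants drop out because the centred process has mean zero, and Fubini turns the rest into
  \<open>K\<close> applied to \<open>b\<close>.\<close>

lemma normal_equation:
  "AE t in L. (LINT \<omega>|P. Z \<omega> t * (Y \<omega> - c)) = ker_op I K b t"
  using Z_sqint AE_space
proof eventually_elim
  case (elim t)
  then have t: "t \<in> I" and Zt: "sqint P (\<lambda>\<omega>. Z \<omega> t)" by auto
  note [measurable] = Z_section[OF t] sqint_measurable[OF b]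
  define f where "f \<omega> s = b s * (Z \<omega> s * Z \<omega> t)" for \<omega> s
  have f: "integrable (P \<Otimes>\<^sub>M L) (\<lambda>(\<omega>, s). f \<omega> s)"
  proof (rule integrableI_bounded)
    show meas: "(\<lambda>(\<omega>, s). f \<omega> s) \<in> borel_measurable (P \<Otimes>\<^sub>M L)"
      unfolding f_def by measurable
    \<comment> \<open>The inequality \<open>2 * p * q \<le> p\<^sup>2 + q\<^sup>2\<close> with
      \<open>p = b s * Z \<omega> t\<close> leaves a product of separate functions of
      \<open>s\<close> and \<open>\<omega>\<close>, plus the square of \<open>Z\<close>; both are
      integrable.\<close>
    have le: "ennreal (norm (f \<omega> s)) \<le> ennreal ((b s)\<^sup>2) * ennreal ((Z \<omega> t)\<^sup>2) + ennreal ((Z \<omega> s)\<^sup>2)" for \<omega> s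
    proof -
      have "2 * (\<bar>b s * Z \<omega> t\<bar> * \<bar>Z \<omega> s\<bar>) \<le> (b s * Z \<omega> t)\<^sup>2 + (Z \<omega> s)\<^sup>2"
        using sum_squares_bound[of "\<bar>b s * Z \<omega> t\<bar>" "\<bar>Z \<omega> s\<bar>"] by simp
      moreover have "norm (f \<omega> s) = \<bar>b s * Z \<omega> t\<bar> * \<bar>Z \<omega> s\<bar>" by (simp add: f_def abs_mult)
      moreover have "0 \<le> \<bar>b s * Z \<omega> t\<bar> * \<bar>Z \<omega> s\<bar>" by simp
      ultimately have "norm (f \<omega> s) \<le> (b s)\<^sup>2 * (Z \<omega> t)\<^sup>2 + (Z \<omega> s)\<^sup>2"
        by (simp add: power_mult_distrib)
      then show ?thesis by (simp add: ennreal_leI flip: ennreal_mult ennreal_plus)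
    qed
    have "(\<integral>\<^sup>+p. ennreal (norm (case p of (\<omega>, s) \<Rightarrow> f \<omega> s)) \<partial>(P \<Otimes>\<^sub>M L))
        = (\<integral>\<^sup>+\<omega>. \<integral>\<^sup>+s. ennreal (norm (f \<omega> s)) \<partial>L \<partial>P)"
      using meas by (subst nn_integral_fst[symmetric]) auto
    also have "\<dots> \<le> (\<integral>\<^sup>+\<omega>. \<integral>\<^sup>+s. ennreal ((b s)\<^sup>2) * ennreal ((Z \<omega> t)\<^sup>2) + ennreal ((Z \<omega> s)\<^sup>2) \<partial>L \<partial>P)"
      by (intro nn_integral_mono le)
    also have "\<dots> = (\<integral>\<^sup>+\<omega>. ennreal ((l2norm L b)\<^sup>2) * ennreal ((Z \<omega> t)\<^sup>2) + (\<integral>\<^sup>+s. ennreal ((Z \<omega> s)\<^sup>2) \<partial>L) \<partial>P)"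
      by (intro nn_integral_cong, subst nn_integral_add)
        (auto simp: nn_integral_multc nn_integral_square_eq[OF b])
    also have "\<dots> = ennreal ((l2norm L b)\<^sup>2) * ennreal ((l2norm P (\<lambda>\<omega>. Z \<omega> t))\<^sup>2)
        + (\<integral>\<^sup>+\<omega>. \<integral>\<^sup>+s. ennreal ((Z \<omega> s)\<^sup>2) \<partial>L \<partial>P)"
      by (subst nn_integral_add) (auto simp: nn_integral_cmult nn_integral_square_eq[OF Zt])
    also have "\<dots> < \<infinity>" using Z_square by (simp add: ennreal_mult_less_top)
    finally show "(\<integral>\<^sup>+p. ennreal (norm (case p of (\<omega>, s) \<Rightarrow> f \<omega> s)) \<partial>(P \<Otimes>\<^sub>M L)) < \<infinity>" .
  qed
  define d where "d = c - a - (LINT s|L. b s * \<mu> s)"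
  have "ker_op I K b t = (LINT s|L. LINT \<omega>|P. f \<omega> s)"
    unfolding ker_op_def K_eq f_def by simp
  also have "\<dots> = (LINT \<omega>|P. LINT s|L. f \<omega> s)" by (rule PL.Fubini_integral[OF f])
  also have "\<dots> = (LINT \<omega>|P. Z \<omega> t * (Y \<omega> - c) - Z \<omega> t * \<epsilon> \<omega> + d * Z \<omega> t)"
  proof (rule integral_cong_AE)
    show "AE \<omega> in P. (LINT s|L. f \<omega> s) = Z \<omega> t * (Y \<omega> - c) - Z \<omega> t * \<epsilon> \<omega> + d * Z \<omega> t"
      using X_sqint model
    proof eventually_elim
      case (elim \<omega>)
      have "(LINT s|L. f \<omega> s) = (LINT s|L. b s * Z \<omega> s) * Z \<omega> t"
        unfolding f_def by (simp flip: mult.assoc)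
      also have "(LINT s|L. b s * Z \<omega> s) = (LINT s|L. b s * X \<omega> s) - (LINT s|L. b s * \<mu> s)"
        unfolding Z_def using sqint_integrable_mult[OF b elim(1)] sqint_integrable_mult[OF b mu]
        by (simp add: right_diff_distrib)
      finally show ?case using elim(2) by (simp add: d_def algebra_simps)
    qed
    show "(\<lambda>\<omega>. LINT s|L. f \<omega> s) \<in> borel_measurable P"
      using borel_measurable_integrable[OF f] by (rule borel_measurable_lebesgue_integral)
    show "(\<lambda>\<omega>. Z \<omega> t * (Y \<omega> - c) - Z \<omega> t * \<epsilon> \<omega> + d * Z \<omega> t) \<in> borel_measurable P"
      using Z_section[OF t] by measurable
  qed
  also have "\<dots> = (LINT \<omega>|P. Z \<omega> t * (Y \<omega> - c)) - (LINT \<omega>|P. Z \<omega> t * \<epsilon> \<omega>) + d * (LINT \<omega>|P. Z \<omega> t)"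
  proof -
    have "integrable P (\<lambda>\<omega>. Z \<omega> t * (Y \<omega> - c))"
      by (intro sqint_integrable_mult Zt sqint_diff Y_sqint) (simp add: sqint_def)
    moreover have "integrable P (\<lambda>\<omega>. Z \<omega> t * \<epsilon> \<omega>)"
      by (intro sqint_integrable_mult Zt) (simp add: sqint_def eps_square)
    ultimately show ?thesis using P.sqint_integrable[OF Zt] by simp
  qed
  finally show ?case using Z_eps_orthogonal[OF t Zt] Z_mean[OF Zt] by simp
qed

end

section \<open>The sample: recentred moments, second-moment bounds and joint measurability\<close>

lemma sum_recentre:
  fixes p q :: "nat \<Rightarrow> real"
  assumes "1 \<le> n"
  defines "pm \<equiv> (\<Sum>i=1..n. p i) / real n" and "qm \<equiv> (\<Sum>i=1..n. q i) / real n"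
  shows "(\<Sum>i=1..n. (p i - pm) * (q i - qm)) / real n
    = (\<Sum>i=1..n. (p i - \<alpha>) * (q i - \<beta>)) / real n - (pm - \<alpha>) * (qm - \<beta>)"
proof -
  have n: "real n \<noteq> 0" using assms(1) by simp
  have p: "(\<Sum>i=1..n. p i) = real n * pm" and q: "(\<Sum>i=1..n. q i) = real n * qm"
    using n by (simp_all add: pm_def qm_def)
  define A where "A = (\<Sum>i=1..n. p i * q i)"
  \<comment> \<open>Proved for arbitrary centres and applied twice, to the sample means and to
    \<open>\<alpha>\<close>, \<open>\<beta>\<close>; the term \<open>A\<close> then cancels.\<close>
  have *: "(\<Sum>i=1..n. (p i - r) * (q i - s)) = A + real n * (r * s - s * pm - r * qm)" for r s
  proof -
    have "(\<Sum>i=1..n. (p i - r) * (q i - s)) = (\<Sum>i=1..n. p i * q i - s * p i - r * q i + r * s)"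
      by (intro sum.cong) (auto simp: algebra_simps)
    also have "\<dots> = A - s * (\<Sum>i=1..n. p i) - r * (\<Sum>i=1..n. q i) + real n * (r * s)"
      by (simp add: A_def sum.distrib sum_subtractf sum_distrib_left)
    finally show ?thesis unfolding p q by (simp add: algebra_simps)
  qed
  show ?thesis unfolding * using n by (simp add: field_simps)
qed

lemma sqrt_mult_mean:
  assumes "1 \<le> n"
  shows "sqrt (real n) * (S / real n - c) = (S - real n * c) / sqrt (real n)"
proof -
  have "(S - real n * c) / sqrt (real n) = (S / real n - c) * (real n / sqrt (real n))"
    using assms by (simp add: field_simps)
  then show ?thesis by (simp add: real_div_sqrt)
qed

text \<open>Kernel and argument may both depend on the sample point. Joint measurability survives
  the integration over \<open>s\<close> and thus passes to all iterates, as needed for the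
  measurability built into \<open>bounded_in_prob\<close>.\<close>

lemma (in lmeasurable_domain) ker_op_jointly_measurable:
  assumes "(\<lambda>(\<omega>, s, t). k \<omega> s t) \<in> borel_measurable (M \<Otimes>\<^sub>M (L \<Otimes>\<^sub>M L))"
    and "(\<lambda>(\<omega>, t). f \<omega> t) \<in> borel_measurable (M \<Otimes>\<^sub>M L)"
  shows "(\<lambda>(\<omega>, t). ker_op I (k \<omega>) (f \<omega>) t) \<in> borel_measurable (M \<Otimes>\<^sub>M L)"
proof -
  note [measurable] = assms(2)
  have [measurable]: "(\<lambda>q. k (fst (fst q)) (snd q) (snd (fst q))) \<in> borel_measurable ((M \<Otimes>\<^sub>M L) \<Otimes>\<^sub>M L)"
    using measurable_compose[of "\<lambda>q. (fst (fst q), snd q, snd (fst q))" "(M \<Otimes>\<^sub>M L) \<Otimes>\<^sub>M L" _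
        "\<lambda>(\<omega>, s, t). k \<omega> s t", OF _ assms(1)] by simp
  have "(\<lambda>(p, s). f (fst p) s * k (fst p) s (snd p)) \<in> borel_measurable ((M \<Otimes>\<^sub>M L) \<Otimes>\<^sub>M L)"
    by measurable
  from borel_measurable_lebesgue_integral[OF this] show ?thesis
    by (simp add: ker_op_def split_beta')
qed

lemma (in lmeasurable_domain) ker_op_funpow_jointly_measurable:
  assumes "(\<lambda>(\<omega>, s, t). k \<omega> s t) \<in> borel_measurable (M \<Otimes>\<^sub>M (L \<Otimes>\<^sub>M L))"
    and "(\<lambda>(\<omega>, t). f \<omega> t) \<in> borel_measurable (M \<Otimes>\<^sub>M L)"
  shows "(\<lambda>(\<omega>, t). (ker_op I (k \<omega>) ^^ j) (f \<omega>) t) \<in> borel_measurable (M \<Otimes>\<^sub>M L)"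
proof (induction j)
  case (Suc j)
  from ker_op_jointly_measurable[OF assms(1) this] show ?case by simp
qed (use assms(2) in simp)

locale functional_sample = functional_regression I P X Y \<epsilon> b a + M: prob_space M
  for I :: "real set" and P :: "'p measure" and X Y \<epsilon> b a and M :: "'w measure" +
  fixes Xs :: "nat \<Rightarrow> 'w \<Rightarrow> real \<Rightarrow> real" and Ys :: "nat \<Rightarrow> 'w \<Rightarrow> real"
  assumes Xs_random: "\<And>i. i \<ge> 1 \<Longrightarrow> random_function M I (Xs i)"
    and independent: "prob_space.indep_vars M (\<lambda>_. path_space I \<Otimes>\<^sub>M borel)
           (\<lambda>i \<omega>. (sample_path I (Xs i) \<omega>, Ys i \<omega>)) {1..}"
    and identical: "\<And>i. i \<ge> 1 \<Longrightarrow>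
           distr M (path_space I \<Otimes>\<^sub>M borel) (\<lambda>\<omega>. (sample_path I (Xs i) \<omega>, Ys i \<omega>))
             = distr P (path_space I \<Otimes>\<^sub>M borel) (\<lambda>\<omega>. (sample_path I X \<omega>, Y \<omega>))"
begin

sublocale S: pair_sigma_finite M L ..

abbreviation "EY \<equiv> (LINT \<omega>|P. Y \<omega>)"
abbreviation "\<xi> \<equiv> xi M \<mu> Xs"
abbreviation "\<xi>0 \<equiv> xi0 M \<mu> Xs Ys"

definition m :: "nat \<Rightarrow> 'w \<Rightarrow> real \<Rightarrow> real" where
  "m n \<omega> t = sqrt (real n) * (fun_avg Xs n \<omega> t - \<mu> t)"

definition y :: "nat \<Rightarrow> 'w \<Rightarrow> real" where
  "y n \<omega> = sqrt (real n) * (avg Ys n \<omega> - EY)"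

lemma population_pair_meas: "(\<lambda>\<omega>. (sample_path I X \<omega>, Y \<omega>)) \<in> measurable P (path_space I \<Otimes>\<^sub>M borel)"
  using measurable_sample_path(1)[OF X_random space_L] by measurable

lemma sample_pair_meas:
  "1 \<le> i \<Longrightarrow> (\<lambda>\<omega>. (sample_path I (Xs i) \<omega>, Ys i \<omega>)) \<in> measurable M (path_space I \<Otimes>\<^sub>M borel)"
  using independent by (auto simp: M.indep_vars_def)

lemma Ys_meas[measurable]: "1 \<le> i \<Longrightarrow> Ys i \<in> borel_measurable M"
  using measurable_compose[OF sample_pair_meas measurable_snd] by simp

lemma Xs_meas[measurable]: "1 \<le> i \<Longrightarrow> (\<lambda>(\<omega>, t). Xs i \<omega> t) \<in> borel_measurable (M \<Otimes>\<^sub>M L)"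
  using Xs_random by (simp add: random_function_def)

lemma sample_expectation:
  fixes g :: "(real \<Rightarrow> real) \<times> real \<Rightarrow> real"
  assumes "1 \<le> i" "g \<in> borel_measurable (path_space I \<Otimes>\<^sub>M borel)"
  shows "(LINT \<omega>|M. g (sample_path I (Xs i) \<omega>, Ys i \<omega>)) = (LINT \<omega>|P. g (sample_path I X \<omega>, Y \<omega>))"
  using integral_distr[OF sample_pair_meas[OF assms(1)] assms(2)]
    integral_distr[OF population_pair_meas assms(2)] identical[OF assms(1)] by simp

lemma sample_square:
  fixes g :: "(real \<Rightarrow> real) \<times> real \<Rightarrow> real"
  assumes "g \<in> borel_measurable (path_space I \<Otimes>\<^sub>M borel)"
  shows "(\<integral>\<^sup>+\<omega>. ennreal (((\<Sum>i=1..n. centred M (\<lambda>\<omega>. g (sample_path I (Xs i) \<omega>, Ys i \<omega>)) \<omega>) / sqrt (real n))\<^sup>2) \<partial>M)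
      \<le> (\<integral>\<^sup>+\<omega>. ennreal ((g (sample_path I X \<omega>, Y \<omega>))\<^sup>2) \<partial>P)"
  by (rule M.iid_centred_sum_square[OF independent population_pair_meas identical assms])

text \<open>Equality in law is given on the product sigma-algebra of paths, so it is applied to
  functionals of finitely many coordinates and of the response; integrals over the arguments are
  taken afterwards.\<close>

definition gX :: "real \<Rightarrow> (real \<Rightarrow> real) \<times> real \<Rightarrow> real" where "gX t p = fst p t - \<mu> t"
definition gK :: "real \<Rightarrow> real \<Rightarrow> (real \<Rightarrow> real) \<times> real \<Rightarrow> real" where "gK s t p = gX s p * gX t p"
definition g0 :: "real \<Rightarrow> (real \<Rightarrow> real) \<times> real \<Rightarrow> real" where "g0 t p = gX t p * (snd p - EY)"

lemma g_meas:
  assumes "t \<in> I"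
  shows "gX t \<in> borel_measurable (path_space I \<Otimes>\<^sub>M borel)"
    and "s \<in> I \<Longrightarrow> gK s t \<in> borel_measurable (path_space I \<Otimes>\<^sub>M borel)"
    and "g0 t \<in> borel_measurable (path_space I \<Otimes>\<^sub>M borel)"
proof -
  have *[measurable]: "gX t \<in> borel_measurable (path_space I \<Otimes>\<^sub>M borel)" if "t \<in> I" for t
    unfolding gX_def[abs_def]
    using measurable_compose[OF measurable_fst measurable_component_singleton[OF that]] by measurable
  show "gX t \<in> borel_measurable (path_space I \<Otimes>\<^sub>M borel)" by (rule *[OF assms])
  show "gK s t \<in> borel_measurable (path_space I \<Otimes>\<^sub>M borel)" if "s \<in> I"
    unfolding gK_def[abs_def] using *[OF assms] *[OF that] by measurable
  show "g0 t \<in> borel_measurable (path_space I \<Otimes>\<^sub>M borel)"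
    unfolding g0_def[abs_def] using *[OF assms] by measurable
qed

lemma g_eq:
  assumes "t \<in> I"
  shows "gX t (sample_path I V \<omega>, z) = V \<omega> t - \<mu> t"
    and "s \<in> I \<Longrightarrow> gK s t (sample_path I V \<omega>, z) = (V \<omega> s - \<mu> s) * (V \<omega> t - \<mu> t)"
    and "g0 t (sample_path I V \<omega>, z) = (V \<omega> t - \<mu> t) * (z - EY)"
  using assms by (simp_all add: gX_def gK_def g0_def sample_path_def)

lemma Ys_mean: "1 \<le> i \<Longrightarrow> (LINT \<omega>|M. Ys i \<omega>) = EY"
  using sample_expectation[of i snd] by simp

lemma xi_square:
  assumes "s \<in> I" "t \<in> I"
  shows "(\<integral>\<^sup>+\<omega>. ennreal ((\<xi> n \<omega> s t)\<^sup>2) \<partial>M) \<le> (\<integral>\<^sup>+\<omega>. ennreal ((Z \<omega> s * Z \<omega> t)\<^sup>2) \<partial>P)"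
  using sample_square[OF g_meas(2)[OF assms(2,1)], of n]
  by (simp add: g_eq(2)[OF assms(2,1)] xi_def Z_def)

lemma xi0_square:
  assumes "t \<in> I"
  shows "(\<integral>\<^sup>+\<omega>. ennreal ((\<xi>0 n \<omega> t)\<^sup>2) \<partial>M) \<le> (\<integral>\<^sup>+\<omega>. ennreal ((Z \<omega> t * (Y \<omega> - EY))\<^sup>2) \<partial>P)"
proof -
  have "\<xi>0 n \<omega> t = (\<Sum>i=1..n. centred M (\<lambda>\<omega>. g0 t (sample_path I (Xs i) \<omega>, Ys i \<omega>)) \<omega>) / sqrt (real n)" for \<omega>
    unfolding xi0_def
    by (intro arg_cong2[where f = "(/)"] sum.cong refl) (auto simp: g_eq(3)[OF assms] Ys_mean)
  then show ?thesis
    using sample_square[OF g_meas(3)[OF assms], of n] by (simp add: g_eq(3)[OF assms] Z_def)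
qed

text \<open>Square integrability at \<open>t\<close> ensures that \<open>\<mu> t\<close> is the mean
  of each \<open>Xs i\<close> at \<open>t\<close>, so \<open>m\<close> is a normalised centred
  sum.\<close>

lemma m_square:
  assumes "t \<in> I" "1 \<le> n" "sqint P (\<lambda>\<omega>. Z \<omega> t)"
  shows "(\<integral>\<^sup>+\<omega>. ennreal ((m n \<omega> t)\<^sup>2) \<partial>M) \<le> (\<integral>\<^sup>+\<omega>. ennreal ((Z \<omega> t)\<^sup>2) \<partial>P)"
proof -
  have c: "centred M (\<lambda>\<omega>. gX t (sample_path I (Xs i) \<omega>, Ys i \<omega>)) \<omega> = Xs i \<omega> t - \<mu> t" if "1 \<le> i" for i \<omega>
    using sample_expectation[OF that g_meas(1)[OF assms(1)]] Z_mean[OF assms(3)]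
    by (simp add: centred_def g_eq(1)[OF assms(1)] Z_def)
  have "m n \<omega> t = (\<Sum>i=1..n. centred M (\<lambda>\<omega>. gX t (sample_path I (Xs i) \<omega>, Ys i \<omega>)) \<omega>) / sqrt (real n)" for \<omega>
  proof -
    have "(\<Sum>i=1..n. centred M (\<lambda>\<omega>. gX t (sample_path I (Xs i) \<omega>, Ys i \<omega>)) \<omega>) = (\<Sum>i=1..n. Xs i \<omega> t) - real n * \<mu> t"
      using c by (simp add: sum_subtractf)
    then show ?thesis
      by (simp add: m_def fun_avg_def sqrt_mult_mean[OF assms(2)])
  qed
  then show ?thesis
    using sample_square[OF g_meas(1)[OF assms(1)], of n] by (simp add: g_eq(1)[OF assms(1)] Z_def)
qed

lemma y_square:
  assumes "1 \<le> n"
  shows "(\<integral>\<^sup>+\<omega>. ennreal ((y n \<omega>)\<^sup>2) \<partial>M) \<le> (\<integral>\<^sup>+\<omega>. ennreal ((Y \<omega>)\<^sup>2) \<partial>P)"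
proof -
  have "y n \<omega> = (\<Sum>i=1..n. centred M (\<lambda>\<omega>. snd (sample_path I (Xs i) \<omega>, Ys i \<omega>)) \<omega>) / sqrt (real n)" for \<omega>
  proof -
    have "(\<Sum>i=1..n. centred M (\<lambda>\<omega>. snd (sample_path I (Xs i) \<omega>, Ys i \<omega>)) \<omega>) = (\<Sum>i=1..n. Ys i \<omega>) - real n * EY"
      by (simp add: centred_def sum_subtractf Ys_mean)
    then show ?thesis
      by (simp add: y_def avg_def sqrt_mult_mean[OF assms])
  qed
  then show ?thesis
    using sample_square[OF measurable_snd, of n] by simp
qed

lemma xi_jmeas: "(\<lambda>(\<omega>, s, t). \<xi> n \<omega> s t) \<in> borel_measurable (M \<Otimes>\<^sub>M (L \<Otimes>\<^sub>M L))"
  unfolding xi_def centred_def split_beta'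
  by (intro borel_measurable_divide borel_measurable_sum borel_measurable_diff) measurable

lemma xi0_jmeas: "(\<lambda>(\<omega>, t). \<xi>0 n \<omega> t) \<in> borel_measurable (M \<Otimes>\<^sub>M L)"
  unfolding xi0_def centred_def split_beta'
  by (intro borel_measurable_divide borel_measurable_sum borel_measurable_diff) measurable

lemma fun_avg_jmeas[measurable]: "(\<lambda>(\<omega>, t). fun_avg Xs n \<omega> t) \<in> borel_measurable (M \<Otimes>\<^sub>M L)"
  unfolding fun_avg_def split_beta'
  by (intro borel_measurable_divide borel_measurable_sum) measurable

lemma avg_meas[measurable]: "avg Ys n \<in> borel_measurable M"
  unfolding avg_def[abs_def] by (intro borel_measurable_divide borel_measurable_sum) measurable

lemma m_jmeas[measurable]: "(\<lambda>(\<omega>, t). m n \<omega> t) \<in> borel_measurable (M \<Otimes>\<^sub>M L)"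
  unfolding m_def by measurable

lemma y_meas[measurable]: "y n \<in> borel_measurable M"
  unfolding y_def[abs_def] by measurable

lemma Khat_jmeas: "(\<lambda>(\<omega>, s, t). Khat Xs n \<omega> s t) \<in> borel_measurable (M \<Otimes>\<^sub>M (L \<Otimes>\<^sub>M L))"
  unfolding Khat_def split_beta'
  by (intro borel_measurable_divide borel_measurable_sum borel_measurable_times borel_measurable_diff) measurable

lemma Khat1_jmeas: "(\<lambda>(\<omega>, t). Khat1 Xs Ys n \<omega> t) \<in> borel_measurable (M \<Otimes>\<^sub>M L)"
  unfolding Khat1_def split_beta'
  by (intro borel_measurable_divide borel_measurable_sum borel_measurable_times borel_measurable_diff) measurable

end

section \<open>Control of the random quantities and uniform bounds in probability\<close>

lemma ennreal_ratio_le: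
  assumes "0 \<le> p" "0 < q" "p \<le> c * q"
  shows "ennreal p / ennreal q \<le> ennreal c"
  using assms by (simp add: divide_ennreal ennreal_leI pos_divide_le_eq)

lemma measurable_section1:
  assumes "(\<lambda>(x, y). f x y) \<in> borel_measurable (M \<Otimes>\<^sub>M N)" "x \<in> space M"
  shows "f x \<in> borel_measurable N"
  using measurable_compose[OF measurable_Pair1'[OF assms(2)] assms(1)] by simp

context functional_sample
begin

text \<open>Bounds on \<open>Q\<close> control every random quantity in the expansion. As \<open>Q\<close> is a sum of nonnegative extended integrals, finiteness of
  \<open>Q n \<omega>\<close> also yields square integrability at \<open>\<omega>\<close>, so that no exceptional null set is needed.\<close>

definition Q :: "nat \<Rightarrow> 'w \<Rightarrow> ennreal" where
  "Q n \<omega> = (\<integral>\<^sup>+s. \<integral>\<^sup>+t. ennreal ((\<xi> n \<omega> s t)\<^sup>2) \<partial>L \<partial>L) + (\<integral>\<^sup>+t. ennreal ((m n \<omega> t)\<^sup>2) \<partial>L)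
     + ennreal ((y n \<omega>)\<^sup>2) + (\<integral>\<^sup>+t. ennreal ((\<xi>0 n \<omega> t)\<^sup>2) \<partial>L)"

lemma xi_jmeas': "(\<lambda>(p, t). \<xi> n (fst p) (snd p) t) \<in> borel_measurable ((M \<Otimes>\<^sub>M L) \<Otimes>\<^sub>M L)"
  using measurable_compose[of "\<lambda>q. (fst (fst q), snd (fst q), snd q)" "(M \<Otimes>\<^sub>M L) \<Otimes>\<^sub>M L" _
      "\<lambda>(\<omega>, s, t). \<xi> n \<omega> s t", OF _ xi_jmeas] by (simp add: split_beta')

lemma xi_slice_meas: "s \<in> I \<Longrightarrow> (\<lambda>(\<omega>, t). \<xi> n \<omega> s t) \<in> borel_measurable (M \<Otimes>\<^sub>M L)"
  using measurable_compose[of "\<lambda>q. (fst q, s, snd q)" "M \<Otimes>\<^sub>M L" _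
      "\<lambda>(\<omega>, s, t). \<xi> n \<omega> s t", OF _ xi_jmeas] by (simp add: split_beta')

lemma xi_inner_meas: "(\<lambda>(\<omega>, s). \<integral>\<^sup>+t. ennreal ((\<xi> n \<omega> s t)\<^sup>2) \<partial>L) \<in> borel_measurable (M \<Otimes>\<^sub>M L)"
proof -
  note [measurable] = xi_jmeas'[of n]
  have "(\<lambda>p. \<integral>\<^sup>+t. ennreal ((\<xi> n (fst p) (snd p) t)\<^sup>2) \<partial>L) \<in> borel_measurable (M \<Otimes>\<^sub>M L)"
    by measurable
  then show ?thesis by (simp add: split_beta')
qed

lemma Q_meas: "Q n \<in> borel_measurable M"
proof -
  note [measurable] = xi_inner_meas[of n] xi0_jmeas[of n]
  show ?thesis unfolding Q_def[abs_def] by measurable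
qed

definition G :: ennreal where
  "G = (\<integral>\<^sup>+s. \<integral>\<^sup>+t. \<integral>\<^sup>+\<omega>. ennreal ((Z \<omega> s * Z \<omega> t)\<^sup>2) \<partial>P \<partial>L \<partial>L)
     + (\<integral>\<^sup>+t. \<integral>\<^sup>+\<omega>. ennreal ((Z \<omega> t)\<^sup>2) \<partial>P \<partial>L) + (\<integral>\<^sup>+\<omega>. ennreal ((Y \<omega>)\<^sup>2) \<partial>P)
     + (\<integral>\<^sup>+t. \<integral>\<^sup>+\<omega>. ennreal ((Z \<omega> t * (Y \<omega> - EY))\<^sup>2) \<partial>P \<partial>L)"

lemma G_finite: "G < \<infinity>"
  unfolding G_def using ZZ_square Z_square' ZY_square[of EY] Y_sqint
  by (simp add: sqint_iff_nn_integral)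

text \<open>Fubini brings the expectation inside the integrals over the arguments, where the
  variance bounds hold at fixed arguments.\<close>

lemma Q_mean:
  assumes n: "1 \<le> n"
  shows "(\<integral>\<^sup>+\<omega>. Q n \<omega> \<partial>M) \<le> G"
proof -
  note [measurable] = xi_inner_meas[of n] xi0_jmeas[of n]
  have "(\<integral>\<^sup>+\<omega>. \<integral>\<^sup>+s. \<integral>\<^sup>+t. ennreal ((\<xi> n \<omega> s t)\<^sup>2) \<partial>L \<partial>L \<partial>M)
      = (\<integral>\<^sup>+s. \<integral>\<^sup>+\<omega>. \<integral>\<^sup>+t. ennreal ((\<xi> n \<omega> s t)\<^sup>2) \<partial>L \<partial>M \<partial>L)"
    by (intro S.Fubini'[symmetric]) measurable
  also have "\<dots> = (\<integral>\<^sup>+s. \<integral>\<^sup>+t. \<integral>\<^sup>+\<omega>. ennreal ((\<xi> n \<omega> s t)\<^sup>2) \<partial>M \<partial>L \<partial>L)"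
  proof (intro nn_integral_cong S.Fubini'[symmetric])
    fix s assume "s \<in> space L"
    then have [measurable]: "(\<lambda>(\<omega>, t). \<xi> n \<omega> s t) \<in> borel_measurable (M \<Otimes>\<^sub>M L)"
      by (intro xi_slice_meas) simp
    show "(\<lambda>(\<omega>, t). ennreal ((\<xi> n \<omega> s t)\<^sup>2)) \<in> borel_measurable (M \<Otimes>\<^sub>M L)" by measurable
  qed
  also have "\<dots> \<le> (\<integral>\<^sup>+s. \<integral>\<^sup>+t. \<integral>\<^sup>+\<omega>. ennreal ((Z \<omega> s * Z \<omega> t)\<^sup>2) \<partial>P \<partial>L \<partial>L)"
    by (intro nn_integral_mono xi_square) auto
  finally have 1: "(\<integral>\<^sup>+\<omega>. \<integral>\<^sup>+s. \<integral>\<^sup>+t. ennreal ((\<xi> n \<omega> s t)\<^sup>2) \<partial>L \<partial>L \<partial>M)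
      \<le> (\<integral>\<^sup>+s. \<integral>\<^sup>+t. \<integral>\<^sup>+\<omega>. ennreal ((Z \<omega> s * Z \<omega> t)\<^sup>2) \<partial>P \<partial>L \<partial>L)" .
  have "(\<integral>\<^sup>+\<omega>. \<integral>\<^sup>+t. ennreal ((m n \<omega> t)\<^sup>2) \<partial>L \<partial>M) = (\<integral>\<^sup>+t. \<integral>\<^sup>+\<omega>. ennreal ((m n \<omega> t)\<^sup>2) \<partial>M \<partial>L)"
    by (intro S.Fubini'[symmetric]) measurable
  also have "\<dots> \<le> (\<integral>\<^sup>+t. \<integral>\<^sup>+\<omega>. ennreal ((Z \<omega> t)\<^sup>2) \<partial>P \<partial>L)"
  proof (rule nn_integral_mono_AE)
    \<comment> \<open>Only almost every \<open>t\<close> is covered, because \<open>m_square\<close>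
      needs the centred process to be square integrable at \<open>t\<close>.\<close>
    show "AE t in L. (\<integral>\<^sup>+\<omega>. ennreal ((m n \<omega> t)\<^sup>2) \<partial>M) \<le> (\<integral>\<^sup>+\<omega>. ennreal ((Z \<omega> t)\<^sup>2) \<partial>P)"
      using Z_sqint AE_space by eventually_elim (rule m_square, use n in auto)
  qed
  finally have 2: "(\<integral>\<^sup>+\<omega>. \<integral>\<^sup>+t. ennreal ((m n \<omega> t)\<^sup>2) \<partial>L \<partial>M) \<le> (\<integral>\<^sup>+t. \<integral>\<^sup>+\<omega>. ennreal ((Z \<omega> t)\<^sup>2) \<partial>P \<partial>L)" .
  have "(\<integral>\<^sup>+\<omega>. \<integral>\<^sup>+t. ennreal ((\<xi>0 n \<omega> t)\<^sup>2) \<partial>L \<partial>M) = (\<integral>\<^sup>+t. \<integral>\<^sup>+\<omega>. ennreal ((\<xi>0 n \<omega> t)\<^sup>2) \<partial>M \<partial>L)"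
    by (intro S.Fubini'[symmetric]) measurable
  also have "\<dots> \<le> (\<integral>\<^sup>+t. \<integral>\<^sup>+\<omega>. ennreal ((Z \<omega> t * (Y \<omega> - EY))\<^sup>2) \<partial>P \<partial>L)"
    by (intro nn_integral_mono xi0_square) auto
  finally have 3: "(\<integral>\<^sup>+\<omega>. \<integral>\<^sup>+t. ennreal ((\<xi>0 n \<omega> t)\<^sup>2) \<partial>L \<partial>M)
      \<le> (\<integral>\<^sup>+t. \<integral>\<^sup>+\<omega>. ennreal ((Z \<omega> t * (Y \<omega> - EY))\<^sup>2) \<partial>P \<partial>L)" .
  have "(\<integral>\<^sup>+\<omega>. Q n \<omega> \<partial>M) = (\<integral>\<^sup>+\<omega>. \<integral>\<^sup>+s. \<integral>\<^sup>+t. ennreal ((\<xi> n \<omega> s t)\<^sup>2) \<partial>L \<partial>L \<partial>M)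
      + (\<integral>\<^sup>+\<omega>. \<integral>\<^sup>+t. ennreal ((m n \<omega> t)\<^sup>2) \<partial>L \<partial>M) + (\<integral>\<^sup>+\<omega>. ennreal ((y n \<omega>)\<^sup>2) \<partial>M)
      + (\<integral>\<^sup>+\<omega>. \<integral>\<^sup>+t. ennreal ((\<xi>0 n \<omega> t)\<^sup>2) \<partial>L \<partial>M)"
  proof -
    have "(\<lambda>\<omega>. \<integral>\<^sup>+s. \<integral>\<^sup>+t. ennreal ((\<xi> n \<omega> s t)\<^sup>2) \<partial>L \<partial>L) \<in> borel_measurable M"
      and "(\<lambda>\<omega>. \<integral>\<^sup>+t. ennreal ((m n \<omega> t)\<^sup>2) \<partial>L) \<in> borel_measurable M"
      and "(\<lambda>\<omega>. ennreal ((y n \<omega>)\<^sup>2)) \<in> borel_measurable M"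
      and "(\<lambda>\<omega>. \<integral>\<^sup>+t. ennreal ((\<xi>0 n \<omega> t)\<^sup>2) \<partial>L) \<in> borel_measurable M"
      by measurable
    then show ?thesis
      unfolding Q_def by (simp only: nn_integral_add borel_measurable_add)
  qed
  also have "\<dots> \<le> G"
    unfolding G_def by (intro add_mono 1 2 3 y_square n)
  finally show ?thesis .
qed

text \<open>The bridge from probability to the deterministic part: wherever \<open>Q n\<close> is at
  most \<open>B\<close>, the assumptions of \<open>kernel_perturbation\<close> hold with a constant
  that depends on neither \<open>n\<close> nor the sample point. The maximum is there because the
  same constant must also bound the norm of \<open>b\<close>.\<close>

lemma Q_bound_perturbation:
  assumes n: "1 \<le> n" and \<omega>: "\<omega> \<in> space M" and Q: "Q n \<omega> \<le> ennreal B" and B: "0 < B"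
    and \<theta>: "0 < \<theta>" and K_bound: "\<And>f. sqint L f \<Longrightarrow> l2norm L (ker_op I K f) \<le> \<theta> * l2norm L f"
  shows "kernel_perturbation I K (\<xi> n \<omega>) (Khat Xs n \<omega>) b (\<xi>0 n \<omega>) (m n \<omega>) (Khat1 Xs Ys n \<omega>) (y n \<omega>)
    \<theta> (max (sqrt B) (l2norm L b)) n"
proof -
  have le: "sqint N f \<and> l2norm N f \<le> sqrt B"
    if "f \<in> borel_measurable N" "(\<integral>\<^sup>+t. ennreal ((f t)\<^sup>2) \<partial>N) \<le> ennreal B" for N :: "'x measure" and f
  proof -
    have sq: "sqint N f"
      using that by (subst sqint_iff_nn_integral) (auto intro: le_less_trans)
    then have "ennreal ((l2norm N f)\<^sup>2) \<le> ennreal B" using that(2) by (simp add: nn_integral_square_eq)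
    then have "(l2norm N f)\<^sup>2 \<le> B" using B by (simp add: ennreal_le_iff)
    then show ?thesis using sq by (simp add: real_le_rsqrt)
  qed
  have parts: "(\<integral>\<^sup>+s. \<integral>\<^sup>+t. ennreal ((\<xi> n \<omega> s t)\<^sup>2) \<partial>L \<partial>L) \<le> ennreal B"
    "(\<integral>\<^sup>+t. ennreal ((m n \<omega> t)\<^sup>2) \<partial>L) \<le> ennreal B"
    "ennreal ((y n \<omega>)\<^sup>2) \<le> ennreal B" "(\<integral>\<^sup>+t. ennreal ((\<xi>0 n \<omega> t)\<^sup>2) \<partial>L) \<le> ennreal B"
    by (rule order_trans[OF _ Q], simp add: Q_def add_increasing add_increasing2 add.assoc)+
  have xi: "(\<lambda>(s, t). \<xi> n \<omega> s t) \<in> borel_measurable (L \<Otimes>\<^sub>M L)"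
    using measurable_compose[OF measurable_Pair1'[OF \<omega>] xi_jmeas[of n]] by (simp add: split_beta')
  have "(\<integral>\<^sup>+p. ennreal ((case p of (s, t) \<Rightarrow> \<xi> n \<omega> s t)\<^sup>2) \<partial>(L \<Otimes>\<^sub>M L)) \<le> ennreal B"
    using xi parts(1) by (subst nn_integral_fst[symmetric]) auto
  from le[OF xi this] have xi': "sqker (\<xi> n \<omega>)" "ker_norm I (\<xi> n \<omega>) \<le> sqrt B"
    by (auto simp: sqker_def ker_norm_eq)
  have m': "sqint L (m n \<omega>)" "l2norm L (m n \<omega>) \<le> sqrt B"
    using le[OF measurable_section1[OF m_jmeas \<omega>] parts(2)] by auto
  have xi0': "sqint L (\<xi>0 n \<omega>)" "l2norm L (\<xi>0 n \<omega>) \<le> sqrt B"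
    using le[OF measurable_section1[OF xi0_jmeas \<omega>] parts(4)] by auto
  have y': "\<bar>y n \<omega>\<bar> \<le> sqrt B"
    using parts(3) B by (intro real_le_rsqrt) (simp add: ennreal_le_iff)
  have n0: "real n \<noteq> 0" "sqrt (real n) * sqrt (real n) = real n" using n by auto
  show ?thesis
  proof unfold_locales
    show "sqker K" by (rule K_sqker)
    show "sqker (\<xi> n \<omega>)" "sqint L (m n \<omega>)" "sqint L (\<xi>0 n \<omega>)" by (rule xi' m' xi0')+
    show "sqint L b" by (rule b)
    show "1 \<le> n" "0 < \<theta>" by (rule n \<theta>)+
    show "l2norm L (ker_op I K f) \<le> \<theta> * l2norm L f" if "sqint L f" for f by (rule K_bound[OF that])
    show "ker_norm I (\<xi> n \<omega>) \<le> max (sqrt B) (l2norm L b)" "l2norm L (\<xi>0 n \<omega>) \<le> max (sqrt B) (l2norm L b)"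
      "l2norm L (m n \<omega>) \<le> max (sqrt B) (l2norm L b)" "\<bar>y n \<omega>\<bar> \<le> max (sqrt B) (l2norm L b)"
      "l2norm L b \<le> max (sqrt B) (l2norm L b)"
      using xi' m' xi0' y' by auto
    show "Khat1 Xs Ys n \<omega> \<in> borel_measurable L" by (rule measurable_section1[OF Khat1_jmeas \<omega>])
    show "Khat Xs n \<omega> s t = K s t + \<xi> n \<omega> s t / sqrt (real n) - m n \<omega> s * m n \<omega> t / real n"
      if "s \<in> space L" "t \<in> space L" for s t
    proof -
      have st: "s \<in> I" "t \<in> I" using that by auto
      \<comment> \<open>By equality in law, the mean removed by the centring is the population
        covariance.\<close>
      have "centred M (\<lambda>\<omega>. (Xs i \<omega> s - \<mu> s) * (Xs i \<omega> t - \<mu> t)) \<omega>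
          = (Xs i \<omega> s - \<mu> s) * (Xs i \<omega> t - \<mu> t) - K s t" if "1 \<le> i" for i
        using sample_expectation[OF that g_meas(2)[OF st(2,1)]]
        by (simp add: centred_def g_eq(2)[OF st(2,1)] cov_fun_def)
      then have "\<xi> n \<omega> s t / sqrt (real n) = (\<Sum>i=1..n. (Xs i \<omega> s - \<mu> s) * (Xs i \<omega> t - \<mu> t)) / real n - K s t"
        using n0 by (simp add: xi_def sum_subtractf divide_divide_eq_left diff_divide_distrib)
      moreover have "m n \<omega> s * m n \<omega> t / real n = (fun_avg Xs n \<omega> s - \<mu> s) * (fun_avg Xs n \<omega> t - \<mu> t)"
      proof -
        have "m n \<omega> s * m n \<omega> t = (sqrt (real n) * sqrt (real n)) * ((fun_avg Xs n \<omega> s - \<mu> s) * (fun_avg Xs n \<omega> t - \<mu> t))"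
          by (simp only: m_def mult_ac)
        then show ?thesis using n0 by simp
      qed
      moreover have "Khat Xs n \<omega> s t = (\<Sum>i=1..n. (Xs i \<omega> s - \<mu> s) * (Xs i \<omega> t - \<mu> t)) / real n
          - (fun_avg Xs n \<omega> s - \<mu> s) * (fun_avg Xs n \<omega> t - \<mu> t)"
        unfolding Khat_def fun_avg_def by (rule sum_recentre[OF n])
      ultimately show ?thesis by simp
    qed
    show "AE t in L. Khat1 Xs Ys n \<omega> t = ker_op I K b t + \<xi>0 n \<omega> t / sqrt (real n) - m n \<omega> t * y n \<omega> / real n"
      using normal_equation[of EY] AE_space
    proof eventually_elim
      case (elim t)
      then have t: "t \<in> I" by simp
      \<comment> \<open>By equality in law and the normal equation, the mean removed here is
        \<open>K\<close> applied to \<open>b\<close>; hence the restriction to almost every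
        \<open>t\<close>.\<close>
      have "centred M (\<lambda>\<omega>. (Xs i \<omega> t - \<mu> t) * (Ys i \<omega> - (LINT \<omega>|M. Ys i \<omega>))) \<omega>
          = (Xs i \<omega> t - \<mu> t) * (Ys i \<omega> - EY) - ker_op I K b t" if "1 \<le> i" for i
        using sample_expectation[OF that g_meas(3)[OF t]] elim(1)
        by (simp add: centred_def g_eq(3)[OF t] Ys_mean[OF that] Z_def)
      then have "\<xi>0 n \<omega> t / sqrt (real n) = (\<Sum>i=1..n. (Xs i \<omega> t - \<mu> t) * (Ys i \<omega> - EY)) / real n - ker_op I K b t"
        using n0 by (simp add: xi0_def sum_subtractf divide_divide_eq_left diff_divide_distrib)
      moreover have "m n \<omega> t * y n \<omega> / real n = (fun_avg Xs n \<omega> t - \<mu> t) * (avg Ys n \<omega> - EY)"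
      proof -
        have "m n \<omega> t * y n \<omega> = (sqrt (real n) * sqrt (real n)) * ((fun_avg Xs n \<omega> t - \<mu> t) * (avg Ys n \<omega> - EY))"
          by (simp only: m_def y_def mult_ac)
        then show ?thesis using n0 by simp
      qed
      moreover have "Khat1 Xs Ys n \<omega> t = (\<Sum>i=1..n. (Xs i \<omega> t - \<mu> t) * (Ys i \<omega> - EY)) / real n
          - (fun_avg Xs n \<omega> t - \<mu> t) * (avg Ys n \<omega> - EY)"
        unfolding Khat1_def fun_avg_def avg_def by (rule sum_recentre[OF n])
      ultimately show ?case by simp
    qed
  qed
qed

lemma kernel_const_jmeas:
  assumes "(\<lambda>(s, t). k s t) \<in> borel_measurable (L \<Otimes>\<^sub>M L)"
  shows "(\<lambda>(\<omega>, s, t). k s t) \<in> borel_measurable (M \<Otimes>\<^sub>M (L \<Otimes>\<^sub>M L))"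
  using measurable_compose[OF measurable_snd assms, of M] by (simp add: split_beta')

lemma function_const_jmeas:
  "f \<in> borel_measurable L \<Longrightarrow> (\<lambda>(\<omega>, t). f t) \<in> borel_measurable (M \<Otimes>\<^sub>M L)"
  using measurable_compose[OF measurable_snd, of f L borel M] by (simp add: split_beta')

lemmas K_iter_jmeas = ker_op_funpow_jointly_measurable[OF kernel_const_jmeas[OF K_meas]]

lemma K_iter_b_jmeas: "(\<lambda>(\<omega>, t). K_iter I K j b t) \<in> borel_measurable (M \<Otimes>\<^sub>M L)"
  unfolding K_iter_def by (rule K_iter_jmeas[OF function_const_jmeas[OF sqint_measurable[OF b]]])

lemma Khat_iter_jmeas: "(\<lambda>(\<omega>, t). Khat_iter I Xs Ys j n \<omega> t) \<in> borel_measurable (M \<Otimes>\<^sub>M L)"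
  unfolding Khat_iter_def by (rule ker_op_funpow_jointly_measurable[OF Khat_jmeas Khat1_jmeas])

lemma xij_jmeas: "(\<lambda>(\<omega>, t). xij I M K \<mu> b Xs Ys j n \<omega> t) \<in> borel_measurable (M \<Otimes>\<^sub>M L)"
proof -
  have "(\<lambda>(\<omega>, t). zeta I M K \<mu> b Xs i n \<omega> t) \<in> borel_measurable (M \<Otimes>\<^sub>M L)" for i
    using ker_op_jointly_measurable[OF xi_jmeas K_iter_b_jmeas] by (simp add: zeta_def ker_op_def)
  from K_iter_jmeas[OF this] K_iter_jmeas[OF xi0_jmeas]
  show ?thesis
    unfolding xij_def K_iter_def split_beta' by (intro borel_measurable_add borel_measurable_sum)
qed

lemma eta_jmeas: "(\<lambda>(\<omega>, t). eta I M K \<mu> b Xs Ys j n \<omega> t) \<in> borel_measurable (M \<Otimes>\<^sub>M L)"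
  using Khat_iter_jmeas xij_jmeas K_iter_b_jmeas
  unfolding eta_def split_beta'
  by (intro borel_measurable_times borel_measurable_diff borel_measurable_divide borel_measurable_const)

lemma zeta_eq: "zeta I M K \<mu> b Xs i n \<omega> = ker_op I (\<xi> n \<omega>) ((ker_op I K ^^ i) b)"
  by (simp add: fun_eq_iff zeta_def ker_op_def K_iter_def)

definition eta_ratio :: "real \<Rightarrow> nat \<Rightarrow> nat \<Rightarrow> 'w \<Rightarrow> ennreal" where
  "eta_ratio \<kappa> n j \<omega> = ennreal \<bar>fun_norm I (eta I M K \<mu> b Xs Ys j n \<omega>)\<bar> / ennreal (\<kappa> ^ j)"

definition h_remainder :: "nat \<Rightarrow> nat \<Rightarrow> nat \<Rightarrow> 'w \<Rightarrow> real" where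
  "h_remainder n j k \<omega> = hhat_coef I Xs Ys j k n \<omega> - (h_coef I K b j k
     + (LINT t|L. xij I M K \<mu> b Xs Ys (j + 1) n \<omega> t * K_iter I K k b t
          + K_iter I K (j + 1) b t * xij I M K \<mu> b Xs Ys k n \<omega> t) / sqrt (real n))"

definition h_ratio :: "real \<Rightarrow> real \<Rightarrow> nat \<Rightarrow> nat \<Rightarrow> nat \<Rightarrow> 'w \<Rightarrow> ennreal" where
  "h_ratio \<theta> \<kappa> n j k \<omega> = ennreal \<bar>h_remainder n j k \<omega>\<bar>
     / ennreal (\<theta> ^ j * \<kappa> ^ k / real n + \<kappa> ^ (j + k) / (real n)\<^sup>2)"

lemma eta_ratio_meas: "eta_ratio \<kappa> n j \<in> borel_measurable M"
proof -
  note [measurable] = eta_jmeas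
  show ?thesis unfolding eta_ratio_def[abs_def] fun_norm_def by measurable
qed

lemma h_ratio_meas: "h_ratio \<theta> \<kappa> n j k \<in> borel_measurable M"
proof -
  have [measurable]: "hhat_coef I Xs Ys j k n \<in> borel_measurable M"
    unfolding hhat_coef_def[abs_def]
    using borel_measurable_times[OF Khat_iter_jmeas[of "j + 1" n] Khat_iter_jmeas[of k n]]
    by (intro borel_measurable_lebesgue_integral) (simp add: split_beta')
  have [measurable]: "(\<lambda>\<omega>. LINT t|L. xij I M K \<mu> b Xs Ys (j + 1) n \<omega> t * K_iter I K k b t
          + K_iter I K (j + 1) b t * xij I M K \<mu> b Xs Ys k n \<omega> t) \<in> borel_measurable M"
    using borel_measurable_add[OF borel_measurable_times[OF xij_jmeas[of "j + 1" n] K_iter_b_jmeas[of k]]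
        borel_measurable_times[OF K_iter_b_jmeas[of "j + 1"] xij_jmeas[of k n]]]
    by (intro borel_measurable_lebesgue_integral) (simp add: split_beta')
  show ?thesis unfolding h_ratio_def[abs_def] h_remainder_def by measurable
qed

text \<open>The order of quantifiers is the point: \<open>c\<close> may depend on \<open>B\<close>
  and \<open>C\<close>, but not on the sample size, the sample point or the indices.\<close>

lemma ratio_bounds:
  assumes \<theta>: "0 < \<theta>" "\<theta> < \<kappa>" and K_bound: "\<And>f. sqint L f \<Longrightarrow> l2norm L (ker_op I K f) \<le> \<theta> * l2norm L f"
    and B: "0 < B"
  shows "\<exists>c. \<forall>n \<omega> j. 1 \<le> n \<longrightarrow> \<omega> \<in> space M \<longrightarrow> Q n \<omega> \<le> ennreal B \<longrightarrow> 1 \<le> j \<longrightarrow>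
      real j \<le> C * sqrt (real n) \<longrightarrow> eta_ratio \<kappa> n j \<omega> \<le> ennreal c"
    and "\<exists>c. \<forall>n \<omega> j k. 1 \<le> n \<longrightarrow> \<omega> \<in> space M \<longrightarrow> Q n \<omega> \<le> ennreal B \<longrightarrow> 1 \<le> j \<longrightarrow> j \<le> k \<longrightarrow>
      real k \<le> C * sqrt (real n) \<longrightarrow> h_ratio \<theta> \<kappa> n j k \<omega> \<le> ennreal c"
proof -
  obtain g where g: "0 \<le> g" "\<And>j. (real j)\<^sup>2 * \<theta> ^ j \<le> g * \<kappa> ^ j"
    using square_times_geometric_bounded[OF \<theta>] by blast
  define A where "A = max (sqrt B) (l2norm L b)"
  have kp: "kernel_perturbation I K (\<xi> n \<omega>) (Khat Xs n \<omega>) b (\<xi>0 n \<omega>) (m n \<omega>) (Khat1 Xs Ys n \<omega>) (y n \<omega>) \<theta> A n"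
    if "1 \<le> n" "\<omega> \<in> space M" "Q n \<omega> \<le> ennreal B" for n \<omega>
    unfolding A_def by (rule Q_bound_perturbation[OF that B \<theta>(1) K_bound])
  have eta: "eta_ratio \<kappa> n j \<omega> \<le> ennreal (remainder_const A \<theta> C * g)"
    if n: "1 \<le> n" and \<omega>: "\<omega> \<in> space M" "Q n \<omega> \<le> ennreal B" and j: "1 \<le> j" "real j \<le> C * sqrt (real n)" for n \<omega> j
  proof -
    interpret kp: kernel_perturbation I K "\<xi> n \<omega>" "Khat Xs n \<omega>" b "\<xi>0 n \<omega>" "m n \<omega>" "Khat1 Xs Ys n \<omega>" "y n \<omega>" \<theta> A n
      by (rule kp[OF n \<omega>])
    have "eta I M K \<mu> b Xs Ys j n \<omega> = kp.e j"
      by (simp add: fun_eq_iff eta_def kp.e_def kp.x_def Khat_iter_def K_iter_def xij_def zeta_eq)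
    then have "\<bar>fun_norm I (eta I M K \<mu> b Xs Ys j n \<omega>)\<bar> \<le> remainder_const A \<theta> C * ((real j)\<^sup>2 * \<theta> ^ j)"
      using kp.e_bound[OF j] by (simp add: fun_norm_eq)
    also have "\<dots> \<le> remainder_const A \<theta> C * (g * \<kappa> ^ j)"
      using kp.A_nonneg \<theta> by (intro mult_left_mono g) (simp add: remainder_const_def first_order_const_def)
    finally show ?thesis
      unfolding eta_ratio_def using \<theta> by (intro ennreal_ratio_le) (auto simp: mult_ac)
  qed
  then show "\<exists>c. \<forall>n \<omega> j. 1 \<le> n \<longrightarrow> \<omega> \<in> space M \<longrightarrow> Q n \<omega> \<le> ennreal B \<longrightarrow> 1 \<le> j \<longrightarrow>
      real j \<le> C * sqrt (real n) \<longrightarrow> eta_ratio \<kappa> n j \<omega> \<le> ennreal c"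
    by blast
  have h: "h_ratio \<theta> \<kappa> n j k \<omega> \<le> ennreal (product_const A \<theta> C * g)"
    if n: "1 \<le> n" and \<omega>: "\<omega> \<in> space M" "Q n \<omega> \<le> ennreal B"
      and jk: "1 \<le> j" "j \<le> k" "real k \<le> C * sqrt (real n)" for n \<omega> j k
  proof -
    interpret kp: kernel_perturbation I K "\<xi> n \<omega>" "Khat Xs n \<omega>" b "\<xi>0 n \<omega>" "m n \<omega>" "Khat1 Xs Ys n \<omega>" "y n \<omega>" \<theta> A n
      by (rule kp[OF n \<omega>])
    have x: "xij I M K \<mu> b Xs Ys i n \<omega> = kp.x i" for i
      by (simp add: fun_eq_iff kp.x_def K_iter_def xij_def zeta_eq)
    \<comment> \<open>An admissible index exists, which forces \<open>C\<close> to be nonnegative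
      and makes \<open>product_const\<close> nonnegative.\<close>
    have "0 \<le> C"
      using order_trans[OF of_nat_0_le_iff jk(3)] n by (simp add: zero_le_mult_iff)
    then have pc: "0 \<le> product_const A \<theta> C"
      using \<theta> by (simp add: product_const_def)
    have "\<bar>h_remainder n j k \<omega>\<bar> \<le> product_const A \<theta> C * ((real k)\<^sup>2 * \<theta> ^ (j + k)) / real n"
      using kp.product_bound[OF jk]
      by (simp add: h_remainder_def hhat_coef_def h_coef_def x Khat_iter_def K_iter_def)
    \<comment> \<open>The square of \<open>k\<close> is absorbed by passing from
      \<open>\<theta>\<close> to \<open>\<kappa>\<close> in the \<open>k\<close>-th power alone, so
      the \<open>j\<close>-th power keeps the base \<open>\<theta>\<close>.\<close>
    also have "(real k)\<^sup>2 * \<theta> ^ (j + k) = \<theta> ^ j * ((real k)\<^sup>2 * \<theta> ^ k)" by (simp add: power_add)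
    also have "product_const A \<theta> C * \<dots> / real n \<le> product_const A \<theta> C * (\<theta> ^ j * (g * \<kappa> ^ k)) / real n"
      using pc \<theta> by (intro divide_right_mono mult_left_mono g) auto
    also have "\<dots> = product_const A \<theta> C * g * (\<theta> ^ j * \<kappa> ^ k / real n)" by (simp add: mult_ac)
    also have "\<dots> \<le> product_const A \<theta> C * g * (\<theta> ^ j * \<kappa> ^ k / real n + \<kappa> ^ (j + k) / (real n)\<^sup>2)"
      using pc g \<theta> by (intro mult_left_mono) auto
    finally show ?thesis
      unfolding h_ratio_def using \<theta> n by (intro ennreal_ratio_le add_pos_pos) auto
  qed
  then show "\<exists>c. \<forall>n \<omega> j k. 1 \<le> n \<longrightarrow> \<omega> \<in> space M \<longrightarrow> Q n \<omega> \<le> ennreal B \<longrightarrow> 1 \<le> j \<longrightarrow> j \<le> k \<longrightarrow>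
      real k \<le> C * sqrt (real n) \<longrightarrow> h_ratio \<theta> \<kappa> n j k \<omega> \<le> ennreal c"
    by blast
qed

text \<open>Countability of the index type makes the supremum measurable; since \<open>c\<close> is
  free of the index, it bounds the supremum too.\<close>

lemma uniformly_bounded_in_prob:
  fixes S :: "nat \<Rightarrow> 'i::countable set" and A :: "nat \<Rightarrow> 'i \<Rightarrow> 'w \<Rightarrow> ennreal"
  assumes "\<And>n i. A n i \<in> borel_measurable M"
    and "\<And>B::real. 0 < B \<Longrightarrow> \<exists>c. \<forall>n \<omega> i. 1 \<le> n \<longrightarrow> \<omega> \<in> space M \<longrightarrow> Q n \<omega> \<le> ennreal B \<longrightarrow>
           i \<in> S n \<longrightarrow> A n i \<omega> \<le> ennreal c"
  shows "bounded_in_prob M (\<lambda>n \<omega>. SUP i\<in>S n. A n i \<omega>)"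
proof (rule M.bounded_in_probI[OF Q_meas Q_mean G_finite])
  show "(\<lambda>\<omega>. SUP i\<in>S n. A n i \<omega>) \<in> borel_measurable M" for n
    by (intro borel_measurable_SUP assms(1)) auto
next
  fix B :: real assume "0 < B"
  from assms(2)[OF this] show "\<exists>B'. \<forall>n\<ge>1. \<forall>\<omega>\<in>space M. Q n \<omega> \<le> ennreal B \<longrightarrow> (SUP i\<in>S n. A n i \<omega>) \<le> ennreal B'"
    by (auto simp: SUP_le_iff)
qed

lemma expansion:
  fixes C \<theta> \<kappa> :: real
  assumes \<theta>: "0 < \<theta>" "\<theta> < \<kappa>" and K_bound: "\<And>f. sqint L f \<Longrightarrow> l2norm L (ker_op I K f) \<le> \<theta> * l2norm L f"
  shows "Op_uniformly M (\<lambda>n. {j. 1 \<le> j \<and> real j \<le> C * sqrt (real n)})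
           (\<lambda>n j \<omega>. fun_norm I (eta I M K \<mu> b Xs Ys j n \<omega>)) (\<lambda>n j. \<kappa> ^ j)"
    and "Op_uniformly M (\<lambda>n. {(j, k). 1 \<le> j \<and> j \<le> k \<and> real k \<le> C * sqrt (real n)})
           (\<lambda>n (j, k) \<omega>. h_remainder n j k \<omega>)
           (\<lambda>n (j, k). \<theta> ^ j * \<kappa> ^ k / real n + \<kappa> ^ (j + k) / (real n)\<^sup>2)"
proof -
  have "bounded_in_prob M (\<lambda>n \<omega>. SUP j\<in>{j. 1 \<le> j \<and> real j \<le> C * sqrt (real n)}. eta_ratio \<kappa> n j \<omega>)"
  proof (rule uniformly_bounded_in_prob[OF eta_ratio_meas])
    fix B :: real assume "0 < B"
    from ratio_bounds(1)[OF \<theta> K_bound this, of C]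
    show "\<exists>c. \<forall>n \<omega> j. 1 \<le> n \<longrightarrow> \<omega> \<in> space M \<longrightarrow> Q n \<omega> \<le> ennreal B \<longrightarrow>
        j \<in> {j. 1 \<le> j \<and> real j \<le> C * sqrt (real n)} \<longrightarrow> eta_ratio \<kappa> n j \<omega> \<le> ennreal c"
      by blast
  qed
  then show "Op_uniformly M (\<lambda>n. {j. 1 \<le> j \<and> real j \<le> C * sqrt (real n)})
           (\<lambda>n j \<omega>. fun_norm I (eta I M K \<mu> b Xs Ys j n \<omega>)) (\<lambda>n j. \<kappa> ^ j)"
    unfolding Op_uniformly_def eta_ratio_def .
  have "bounded_in_prob M (\<lambda>n \<omega>. SUP p\<in>{(j, k). 1 \<le> j \<and> j \<le> k \<and> real k \<le> C * sqrt (real n)}.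
      h_ratio \<theta> \<kappa> n (fst p) (snd p) \<omega>)"
  proof (rule uniformly_bounded_in_prob[OF h_ratio_meas])
    fix B :: real assume "0 < B"
    from ratio_bounds(2)[OF \<theta> K_bound this, of C]
    show "\<exists>c. \<forall>n \<omega> p. 1 \<le> n \<longrightarrow> \<omega> \<in> space M \<longrightarrow> Q n \<omega> \<le> ennreal B \<longrightarrow>
        p \<in> {(j, k). 1 \<le> j \<and> j \<le> k \<and> real k \<le> C * sqrt (real n)} \<longrightarrow>
        h_ratio \<theta> \<kappa> n (fst p) (snd p) \<omega> \<le> ennreal c"
      by (rule ex_forward) auto
  qed
  then show "Op_uniformly M (\<lambda>n. {(j, k). 1 \<le> j \<and> j \<le> k \<and> real k \<le> C * sqrt (real n)})
           (\<lambda>n (j, k) \<omega>. h_remainder n j k \<omega>)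
           (\<lambda>n (j, k). \<theta> ^ j * \<kappa> ^ k / real n + \<kappa> ^ (j + k) / (real n)\<^sup>2)"
    unfolding Op_uniformly_def h_ratio_def by (simp add: split_beta')
qed

end

theorem theorem5p2:
  fixes P :: "'p measure" and M :: "'w measure"
    and c d a C :: real and I :: "real set" and b \<mu> :: "real \<Rightarrow> real"
    and X :: "'p \<Rightarrow> real \<Rightarrow> real" and Y \<epsilon> :: "'p \<Rightarrow> real"
    and Xs :: "nat \<Rightarrow> 'w \<Rightarrow> real \<Rightarrow> real" and Ys :: "nat \<Rightarrow> 'w \<Rightarrow> real"
    and K :: "real \<Rightarrow> real \<Rightarrow> real" and \<theta> :: "nat \<Rightarrow> real" and \<phi> :: "nat \<Rightarrow> real \<Rightarrow> real"
  assumes interval: "c < d" "I = {c..d}"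
    and population_space: "prob_space P"
    and X_random: "random_function P I X"
    and X_square: "(\<integral>\<^sup>+ t. (\<integral>\<^sup>+ \<omega>. ennreal ((X \<omega> t)\<^sup>2) \<partial>P) \<partial>lebesgue_on I) < \<infinity>"
    and X_fourth: "integrable P (\<lambda>\<omega>. fun_norm I (X \<omega>) ^ 4)"
    and b_square: "square_integrable_on b I"
    and eps_random: "\<epsilon> \<in> borel_measurable P"
    and eps_square: "integrable P (\<lambda>\<omega>. (\<epsilon> \<omega>)\<^sup>2)"
    and eps_cond: "AE \<omega> in P. real_cond_exp P (sigma_gen_path P I X) \<epsilon> \<omega> = 0"
    and X_eps_square: "integrable P (\<lambda>\<omega>. (fun_norm I (X \<omega>))\<^sup>2 * (\<epsilon> \<omega>)\<^sup>2)"
    and Y_random: "Y \<in> borel_measurable P"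
    and model: "AE \<omega> in P. Y \<omega> = a + (LINT t|lebesgue_on I. b t * X \<omega> t) + \<epsilon> \<omega>"
    and sample_space: "prob_space M"
    and Xs_random: "\<And>i. i \<ge> 1 \<Longrightarrow> random_function M I (Xs i)"
    and independent: "prob_space.indep_vars M (\<lambda>_. path_space I \<Otimes>\<^sub>M borel)
           (\<lambda>i \<omega>. (sample_path I (Xs i) \<omega>, Ys i \<omega>)) {1..}"
    and identical: "\<And>i. i \<ge> 1 \<Longrightarrow>
           distr M (path_space I \<Otimes>\<^sub>M borel) (\<lambda>\<omega>. (sample_path I (Xs i) \<omega>, Ys i \<omega>))
             = distr P (path_space I \<Otimes>\<^sub>M borel) (\<lambda>\<omega>. (sample_path I X \<omega>, Y \<omega>))"
    and mean: "\<mu> = mean_fun P X"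
    and covariance: "K = cov_fun P X"
    and spectral: "spectral_decomposition I K \<theta> \<phi>"
    and ordered: "\<And>k. k \<ge> 1 \<Longrightarrow> 0 \<le> \<theta> (Suc k) \<and> \<theta> (Suc k) \<le> \<theta> k"
    and theta1: "0 < \<theta> 1" "\<theta> 1 < ker_norm I K" "ker_norm I K < 1"
    and C_pos: "C > 0"
  shows "Op_uniformly M (\<lambda>n. {j. 1 \<le> j \<and> real j \<le> C * sqrt (real n)})
           (\<lambda>n j \<omega>. fun_norm I (eta I M K \<mu> b Xs Ys j n \<omega>))
           (\<lambda>n j. ker_norm I K ^ j) \<and>
         Op_uniformly M (\<lambda>n. {(j, k). 1 \<le> j \<and> j \<le> k \<and> real k \<le> C * sqrt (real n)})
           (\<lambda>n (j, k) \<omega>. hhat_coef I Xs Ys j k n \<omega> - (h_coef I K b j k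
              + (LINT t|lebesgue_on I. xij I M K \<mu> b Xs Ys (j + 1) n \<omega> t * K_iter I K k b t
                   + K_iter I K (j + 1) b t * xij I M K \<mu> b Xs Ys k n \<omega> t) / sqrt (real n)))
           (\<lambda>n (j, k). \<theta> 1 ^ j * ker_norm I K ^ k / real n
              + ker_norm I K ^ (j + k) / (real n)\<^sup>2)"
proof -
  interpret functional_sample I P X Y \<epsilon> b a M Xs Ys
  proof (intro functional_sample.intro functional_regression.intro lmeasurable_domain.intro
      functional_regression_axioms.intro functional_sample_axioms.intro)
    show "I \<in> lmeasurable" unfolding interval(2) by (metis cbox_interval lmeasurable_cbox)
    show "sqint (lebesgue_on I) b" using b_square by (simp add: square_integrable_on_eq)
  qed (fact population_space sample_space X_random X_square X_fourth eps_random eps_square eps_cond X_eps_square Y_random model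
      Xs_random independent identical)+
  have "l2norm (lebesgue_on I) (ker_op I K f) \<le> \<theta> 1 * l2norm (lebesgue_on I) f"
    if "sqint (lebesgue_on I) f" for f
    using spectral_op_bound[OF K_sqker[folded covariance] spectral ordered less_imp_le[OF theta1(1)] that] .
  \<comment> \<open>Here the operator bound is \<open>\<theta> 1\<close> and \<open>\<kappa>\<close>
    is \<open>ker_norm I K\<close>; the strict gap between them is what absorbs the polynomial
    factors.\<close>
  from expansion[OF theta1(1,2) this[unfolded covariance], of C]
  show ?thesis unfolding h_remainder_def mean covariance by (intro conjI) (simp_all add: mult_ac)
qed

end
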